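(* Let $G=\mathrm{SL}_n(\mathbb{C})$, $k\in[n-1]$, $J=[n-1]\setminus\{k\}$. For all pairs $v\leq w$ in $W=S_n$ with $w$ $k$-Grassmannian, under the identification $\pi_J:\overrightarrow R^{\circ}_{v,w}\xrightarrow{\sim}\Pi^{\circ}_{v,w}$, the right twist $\vec\tau_{v,w}$ and the left twist $\overleftarrow\tau_{v,w}$ of the open Richardson variety coincide respectively with the Muller--Speyer right and left twist maps of $\Pi^{\circ}_{v,w}$, i.e. $$\pi_J\circ\vec\tau_{v,w}=\vec\tau^{\,\mathrm{MS}}_{v,w}\circ\pi_J\qquad\text{and}\qquad \pi_J\circ\overleftarrow\tau_{v,w}=\overleftarrow\tau^{\,\mathrm{MS}}_{v,w}\circ\pi_J .$$
   Context: $G=\mathrm{SL}_n(\mathbb{C})$; $B,B_-,N,N_-,H$ are the upper triangular, lower triangular, upper unitriangular, lower unitriangular and diagonal matrices; $W=S_n$ with Bruhat order $\leq$. Let $\dot s_i\in G$ be the matrix with block $\begin{pmatrix}0&1\\-1&0\end{pmatrix}$ in rows and columns $i,i+1$ and the identity elsewhere; for a reduced word $w=s_{i_1}\cdots s_{i_m}$ put $\dot w=\dot s_{i_1}\cdots\dot s_{i_m}$. $g^T$ is the matrix transpose. For $g\in BB_-$ let $[g]_L^+\in N$ be defined by $g\in[g]_L^+B_-$; for $g\in B_-B$ let $[g]_R^+\in N$ be defined by $g\in B_-[g]_R^+$. Open Richardson varieties ($v\le w$): $\overrightarrow R^{\circ}_{v,w}=(B_-wB_-\cap BvB_-)/B_-$,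 $\overleftarrow R^{\circ}_{v,w}=B_-\backslash(B_-wB_-\cap B_-vB)$. Chiral map $\vec\chi_v:\overleftarrow R^{\circ}_{v,w}\xrightarrow{\sim}\overrightarrow R^{\circ}_{v,w}$, $B_-g\mapsto gB_-$ for $g\in N\dot v\cap\dot vN\cap B_-wB_-$ (both $g\mapsto B_-g$ and $g\mapsto gB_-$ are isomorphisms from this set), with inverse $\overleftarrow\chi_v$. Pre-twists: $\vec\tau^{\,\mathrm{pre}}_{v,w}(gB_-)=B_-\dot v[g^T\dot w]_L^+$ for $g\in N\dot v\cap B_-wB_-$, and $\overleftarrow\tau^{\,\mathrm{pre}}_{v,w}(B_-h)=[\dot wh^T]_R^+\dot vB_-$ for $h\in\dot vN\cap B_-wB_-$ (well defined). Twists: $\vec\tau_{v,w}=\vec\chi_v\circ\vec\tau^{\,\mathrm{pre}}_{v,w}$ and $\overleftarrow\tau_{v,w}=\overleftarrow\tau^{\,\mathrm{pre}}_{v,w}\circ\overleftarrow\chi_v$, both maps $\overrightarrow R^{\circ}_{v,w}\to\overrightarrow R^{\circ}_{v,w}$. Positroid varieties: $P^J_-\subset G$ is the group of block lower triangular matrices $\begin{pmatrix}A&0\\C&D\end{pmatrix}$ with $A\in\mathrm{GL}_k(\mathbb{C})$, $D\in\mathrm{GL}_{n-k}(\mathbb{C})$. $G/P^J_-$ is identified with the Grassmannian $\mathrm{Gr}(n-k,n)$ of $(n-k)$-planes in $\mathbb{C}^n$ by sending $gP^J_-$ to the span of the rightmost $n-k$ columns of $g$. $w\in S_n$ is $k$-Grassmannian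 if $w(1)<\cdots<w(k)$ and $w(k+1)<\cdots<w(n)$, where $w(j)=s_{i_1}(\cdots(s_{i_m}(j))\cdots)$ for $w=s_{i_1}\cdots s_{i_m}$. For such $w$ and $v\leq w$, the projection $\pi_J:G/B_-\to G/P^J_-$ restricts to an isomorphism of $\overrightarrow R^{\circ}_{v,w}$ onto $\Pi^{\circ}_{v,w}:=\pi_J(\overrightarrow R^{\circ}_{v,w})$ (an open positroid variety). Muller--Speyer twists: let a point of $\Pi^{\circ}_{v,w}$ be the column span of an $n\times(n-k)$ matrix $M$ with rows $M_1,\dots,M_n\in\mathbb{C}^{n-k}$, extended periodically by $M_{i+n}=M_i$ for $i\in\mathbb{Z}$. Let $\langle\cdot,\cdot\rangle$ be the standard (bilinear) inner product on $\mathbb{C}^{n-k}$. For $i\in\mathbb{Z}$ let $\vec I_i=\{j\geq i: M_j\notin\mathrm{span}(M_i,M_{i+1},\dots,M_{j-1})\}$ and $\overleftarrow I_i=\{j\leq i: M_j\notin\mathrm{span}(M_i,M_{i-1},\dots,M_{j+1})\}$, where the span of the empty set is $\{0\}$; each of $\{M_j\}_{j\in\vec I_i}$ and $\{M_j\}_{j\in\overleftarrow I_i}$ is a basis of $\mathbb{C}^{n-k}$. Let $\vec M_i\in\mathbb{C}^{n-k}$ be the unique vector with $\langle\vec M_i,M_j\rangle=\delta_{i,j}$ for all $j\in\vec I_i$, and $\overleftarrow M_i$ the unique vector with $\langle\overleftarrow M_i,M_j\rangle=\delta_{i,j}$ for all $j\in\overleftarrow I_i$. Then $\vec\tau^{\,\mathrm{MS}}_{v,w}$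 (resp. $\overleftarrow\tau^{\,\mathrm{MS}}_{v,w}$) sends the point to the column span of the matrix with rows $\vec M_1,\dots,\vec M_n$ (resp. $\overleftarrow M_1,\dots,\overleftarrow M_n$); these are automorphisms of $\Pi^{\circ}_{v,w}$. *)

theory Defs
  imports
    "Jordan_Normal_Form.VS_Connect"
    "HOL-Algebra.Coset"
    "HOL-Combinatorics.Permutations"
begin

text \<open>
  Indices are 0-based: rows, columns and permuted letters run through \<open>{..<n}\<close>, and the simple
  reflections are \<open>s_i = (i, i+1)\<close> for \<open>i + 1 < n\<close>.
\<close>

section \<open>The special linear group and its subgroups\<close>

definition SL :: "nat \<Rightarrow> complex mat monoid" where
  "SL n = \<lparr>carrier = {A \<in> carrier_mat n n. det A = 1}, mult = (*), one = 1\<^sub>m n\<rparr>"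

definition Bplus :: "nat \<Rightarrow> complex mat set" where
  "Bplus n = {A \<in> carrier (SL n). upper_triangular A}"

definition Bminus :: "nat \<Rightarrow> complex mat set" where
  "Bminus n = {A \<in> carrier (SL n). upper_triangular (transpose_mat A)}"

definition Nplus :: "nat \<Rightarrow> complex mat set" where
  "Nplus n = {A \<in> Bplus n. \<forall>i<n. A $$ (i, i) = 1}"

text \<open>The factors \<open>[g]\<^sub>L\<^sup>+\<close> (for \<open>g \<in> B B\<^sub>-\<close>) and \<open>[g]\<^sub>R\<^sup>+\<close> (for \<open>g \<in> B\<^sub>- B\<close>).\<close>

definition factL :: "nat \<Rightarrow> complex mat \<Rightarrow> complex mat" where
  "factL n g = (THE x. x \<in> Nplus n \<and> g \<in> x <#\<^bsub>SL n\<^esub> Bminus n)"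

definition factR :: "nat \<Rightarrow> complex mat \<Rightarrow> complex mat" where
  "factR n g = (THE x. x \<in> Nplus n \<and> g \<in> Bminus n #>\<^bsub>SL n\<^esub> x)"

section \<open>The symmetric group\<close>

definition is_word :: "nat \<Rightarrow> nat list \<Rightarrow> bool" where
  "is_word n is \<longleftrightarrow> (\<forall>i\<in>set is. Suc i < n)"

definition word_perm :: "nat list \<Rightarrow> nat \<Rightarrow> nat" where
  "word_perm is = foldr (\<lambda>i p. Transposition.transpose i (Suc i) \<circ> p) is id"

definition coxeter_length :: "nat \<Rightarrow> (nat \<Rightarrow> nat) \<Rightarrow> nat" where
  "coxeter_length n w = (LEAST m. \<exists>is. is_word n is \<and> word_perm is = w \<and> length is = m)"

definition reduced_word :: "nat \<Rightarrow> (nat \<Rightarrow> nat) \<Rightarrow> nat list \<Rightarrow> bool" where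
  "reduced_word n w is \<longleftrightarrow>
     is_word n is \<and> word_perm is = w \<and> length is = coxeter_length n w"

definition bruhat_step :: "nat \<Rightarrow> (nat \<Rightarrow> nat) \<Rightarrow> (nat \<Rightarrow> nat) \<Rightarrow> bool" where
  "bruhat_step n u w \<longleftrightarrow> u permutes {..<n} \<and>
     (\<exists>a<n. \<exists>b<n. a \<noteq> b \<and> w = u \<circ> Transposition.transpose a b) \<and>
     coxeter_length n u < coxeter_length n w"

definition bruhat_le :: "nat \<Rightarrow> (nat \<Rightarrow> nat) \<Rightarrow> (nat \<Rightarrow> nat) \<Rightarrow> bool" where
  "bruhat_le n = (bruhat_step n)\<^sup>*\<^sup>*"

definition grassmannian :: "nat \<Rightarrow> nat \<Rightarrow> (nat \<Rightarrow> nat) \<Rightarrow> bool" where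
  "grassmannian n k w \<longleftrightarrow> strict_mono_on {..<k} w \<and> strict_mono_on {k..<n} w"

definition sdot :: "nat \<Rightarrow> nat \<Rightarrow> complex mat" where
  "sdot n i = mat n n (\<lambda>(r, c).
     if r = i \<and> c = Suc i then 1
     else if r = Suc i \<and> c = i then - 1
     else if r = c \<and> r \<notin> {i, Suc i} then 1
     else 0)"

definition word_dot :: "nat \<Rightarrow> nat list \<Rightarrow> complex mat" where
  "word_dot n is = foldr (\<lambda>i A. sdot n i * A) is (1\<^sub>m n)"

text \<open>
  The choice is immaterial: the matrices \<open>sdot n i\<close> satisfy the braid relations, so the product
  does not depend on the reduced word.
\<close>

definition dot :: "nat \<Rightarrow> (nat \<Rightarrow> nat) \<Rightarrow> complex mat" where
  "dot n w = word_dot n (SOME is. reduced_word n w is)"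

section \<open>Open Richardson varieties and their twists\<close>

text \<open>Points of the quotients of \<open>G\<close> by \<open>B\<^sub>-\<close> on either side are cosets, i.e. sets of matrices.\<close>

definition BwB :: "nat \<Rightarrow> (nat \<Rightarrow> nat) \<Rightarrow> complex mat set" where
  "BwB n w = (Bminus n #>\<^bsub>SL n\<^esub> dot n w) <#>\<^bsub>SL n\<^esub> Bminus n"

definition richR :: "nat \<Rightarrow> (nat \<Rightarrow> nat) \<Rightarrow> (nat \<Rightarrow> nat) \<Rightarrow> complex mat set set" where
  "richR n v w = (\<lambda>g. g <#\<^bsub>SL n\<^esub> Bminus n) `
     (BwB n w \<inter> ((Bplus n #>\<^bsub>SL n\<^esub> dot n v) <#>\<^bsub>SL n\<^esub> Bminus n))"

definition richL :: "nat \<Rightarrow> (nat \<Rightarrow> nat) \<Rightarrow> (nat \<Rightarrow> nat) \<Rightarrow> complex mat set set" where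
  "richL n v w = (\<lambda>g. Bminus n #>\<^bsub>SL n\<^esub> g) `
     (BwB n w \<inter> ((Bminus n #>\<^bsub>SL n\<^esub> dot n v) <#>\<^bsub>SL n\<^esub> Bplus n))"

text \<open>
  Maps defined on representatives are rendered by \<open>THE\<close>, so that they are meaningful exactly
  where they are well defined.
\<close>

definition chiR ::
  "nat \<Rightarrow> (nat \<Rightarrow> nat) \<Rightarrow> (nat \<Rightarrow> nat) \<Rightarrow> complex mat set \<Rightarrow> complex mat set" where
  "chiR n v w X = (THE Y.
     \<exists>g \<in> (Nplus n #>\<^bsub>SL n\<^esub> dot n v) \<inter> (dot n v <#\<^bsub>SL n\<^esub> Nplus n) \<inter> BwB n w.
       X = Bminus n #>\<^bsub>SL n\<^esub> g \<and> Y = g <#\<^bsub>SL n\<^esub> Bminus n)"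

definition chiL ::
  "nat \<Rightarrow> (nat \<Rightarrow> nat) \<Rightarrow> (nat \<Rightarrow> nat) \<Rightarrow> complex mat set \<Rightarrow> complex mat set" where
  "chiL n v w = the_inv_into (richL n v w) (chiR n v w)"

definition pretwistR ::
  "nat \<Rightarrow> (nat \<Rightarrow> nat) \<Rightarrow> (nat \<Rightarrow> nat) \<Rightarrow> complex mat set \<Rightarrow> complex mat set" where
  "pretwistR n v w X = (THE Y. \<exists>g \<in> (Nplus n #>\<^bsub>SL n\<^esub> dot n v) \<inter> BwB n w.
     X = g <#\<^bsub>SL n\<^esub> Bminus n \<and>
     Y = Bminus n #>\<^bsub>SL n\<^esub> (dot n v * factL n (transpose_mat g * dot n w)))"

definition pretwistL ::
  "nat \<Rightarrow> (nat \<Rightarrow> nat) \<Rightarrow> (nat \<Rightarrow> nat) \<Rightarrow> complex mat set \<Rightarrow> complex mat set" where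
  "pretwistL n v w X = (THE Y. \<exists>h \<in> (dot n v <#\<^bsub>SL n\<^esub> Nplus n) \<inter> BwB n w.
     X = Bminus n #>\<^bsub>SL n\<^esub> h \<and>
     Y = (factR n (dot n w * transpose_mat h) * dot n v) <#\<^bsub>SL n\<^esub> Bminus n)"

definition twistR ::
  "nat \<Rightarrow> (nat \<Rightarrow> nat) \<Rightarrow> (nat \<Rightarrow> nat) \<Rightarrow> complex mat set \<Rightarrow> complex mat set" where
  "twistR n v w = chiR n v w \<circ> pretwistR n v w"

definition twistL ::
  "nat \<Rightarrow> (nat \<Rightarrow> nat) \<Rightarrow> (nat \<Rightarrow> nat) \<Rightarrow> complex mat set \<Rightarrow> complex mat set" where
  "twistL n v w = pretwistL n v w \<circ> chiL n v w"

section \<open>The projection to the Grassmannian\<close>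

definition PJminus :: "nat \<Rightarrow> nat \<Rightarrow> complex mat set" where
  "PJminus n k = carrier (SL n) \<inter>
     {four_block_mat A (0\<^sub>m k (n - k)) C D | A C D.
        A \<in> carrier_mat k k \<and> invertible_mat A \<and>
        D \<in> carrier_mat (n - k) (n - k) \<and> invertible_mat D \<and>
        C \<in> carrier_mat (n - k) k}"

definition piJ :: "nat \<Rightarrow> nat \<Rightarrow> complex mat set \<Rightarrow> complex mat set" where
  "piJ n k X = (THE Y. \<exists>g \<in> carrier (SL n).
     X = g <#\<^bsub>SL n\<^esub> Bminus n \<and> Y = g <#\<^bsub>SL n\<^esub> PJminus n k)"

abbreviation vspan :: "nat \<Rightarrow> complex vec set \<Rightarrow> complex vec set" where
  "vspan d S \<equiv> LinearCombinations.module.span class_ring (module_vec TYPE(complex) d) S"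

text \<open>The identification of \<open>G/P\<close> with \<open>Gr(n-k, n)\<close>; points of the latter are subspaces.\<close>

definition toGr :: "nat \<Rightarrow> nat \<Rightarrow> complex mat set \<Rightarrow> complex vec set" where
  "toGr n k X = (THE V. \<exists>g \<in> carrier (SL n).
     X = g <#\<^bsub>SL n\<^esub> PJminus n k \<and> V = vspan n (set (drop k (cols g))))"

section \<open>The Muller--Speyer twists\<close>

text \<open>
  Rows are extended periodically to all integers. In \<open>dual_row\<close> the Kronecker delta compares
  \<open>i\<close> and \<open>j\<close> as integers, not modulo \<open>n\<close>. If row \<open>i\<close> vanishes then \<open>i\<close> is not in the index
  set and the dual row is \<open>0\<close>.
\<close>

definition prow :: "complex mat \<Rightarrow> int \<Rightarrow> complex vec" where
  "prow M i = row M (nat (i mod int (dim_row M)))"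

definition indR :: "complex mat \<Rightarrow> int \<Rightarrow> int set" where
  "indR M i = {j. i \<le> j \<and> prow M j \<notin> vspan (dim_col M) (prow M ` {i..<j})}"

definition indL :: "complex mat \<Rightarrow> int \<Rightarrow> int set" where
  "indL M i = {j. j \<le> i \<and> prow M j \<notin> vspan (dim_col M) (prow M ` {j<..i})}"

definition dual_row :: "complex mat \<Rightarrow> int set \<Rightarrow> int \<Rightarrow> complex vec" where
  "dual_row M I i = (THE x. x \<in> carrier_vec (dim_col M) \<and>
     (\<forall>j\<in>I. x \<bullet> prow M j = (if i = j then 1 else 0)))"

definition ms_matR :: "complex mat \<Rightarrow> complex mat" where
  "ms_matR M = mat_of_rows (dim_col M)
     (map (\<lambda>i. dual_row M (indR M (int i)) (int i)) [0..<dim_row M])"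

definition ms_matL :: "complex mat \<Rightarrow> complex mat" where
  "ms_matL M = mat_of_rows (dim_col M)
     (map (\<lambda>i. dual_row M (indL M (int i)) (int i)) [0..<dim_row M])"

definition ms_twistR :: "nat \<Rightarrow> nat \<Rightarrow> complex vec set \<Rightarrow> complex vec set" where
  "ms_twistR n k V = (THE U. \<exists>M \<in> carrier_mat n (n - k).
     V = vspan n (set (cols M)) \<and> U = vspan n (set (cols (ms_matR M))))"

definition ms_twistL :: "nat \<Rightarrow> nat \<Rightarrow> complex vec set \<Rightarrow> complex vec set" where
  "ms_twistL n k V = (THE U. \<exists>M \<in> carrier_mat n (n - k).
     V = vspan n (set (cols M)) \<and> U = vspan n (set (cols (ms_matL M))))"

end

theory Submission
  imports Defs
begin

text \<open>
  Write \<open>P\<close>, \<open>Q\<close> for the matrices of \<open>v\<close>, \<open>w\<close>. Factoring unipotent matrices along permutations,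
  every point of the Richardson variety is \<open>u P B\<^sub>-\<close> with \<open>u\<close> upper unitriangular,
  \<open>u P = b Q t\<^sup>T\<close>, \<open>b\<close> lower triangular with off-diagonal entries only at inversions of \<open>w\<^sup>-\<^sup>1\<close>, and
  \<open>t\<close> supported where \<open>i \<le> j\<close> and \<open>v i \<le> v j\<close>. In these terms the right twist of
  \<open>u P B\<^sub>- = b Q B\<^sub>-\<close> is \<open>P t B\<^sub>-\<close>, and the left twist goes back. The matrices \<open>B = b Q\<close> and
  \<open>C = P t\<close> satisfy \<open>B C\<^sup>T = u\<close>. Splitting this product into the first \<open>k\<close> and the last \<open>n - k\<close>
  columns, the triangularity of \<open>u\<close> together with the supports of \<open>b\<close> and \<open>t\<close> shows that the rows of
  the last \<open>n - k\<close> columns of \<open>B\<close> and \<open>C\<close> are dual to each other in the sense of Muller and Speyer.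
\<close>

section \<open>Matrices with support in a relation\<close>

text \<open>Membership in a Muller-Speyer index set is a statement about spans. By duality it yields
  a vector \<open>z\<close> that vanishes on the rows passed on the way from \<open>i\<close> to
  \<open>j\<close>, but not on row \<open>j\<close>, and the orthogonality relations are derived
  from \<open>z\<close> alone. Two cases differ in nature. If \<open>j\<close> is reached within one
  period, the entry of \<open>u\<close> in question lies on or below the diagonal, so the product
  over all \<open>n\<close> columns is known and the contribution of the first \<open>k\<close>
  columns has to vanish. A nonzero term there would turn a row of an inverse matrix into a linear
  relation expressing row \<open>j\<close> by the rows before it, against \<open>z\<close>. If
  \<open>j\<close> is reached only after wrapping around, the entry of \<open>u\<close> lies
  strictly above the diagonal and is unknown; the product over the last \<open>n - k\<close> columns
  is then shown to vanish by applying a row or column of the inverse of \<open>u\<close> to the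
  values of \<open>z\<close>. The Grassmannian condition enters through the shape of
  \<open>B\<close>: its first \<open>k\<close> columns have one nonzero entry each, and its last
  ones are in echelon form with pivot rows given by \<open>w\<close>.\<close>

locale SL_n =
  fixes n :: nat
begin

section \<open>Inverses and transposes in the special linear group\<close>

lemma SL_iff: "A \<in> carrier (SL n) \<longleftrightarrow> A \<in> carrier_mat n n \<and> det A = 1"
  by (simp add: SL_def)

lemma SL_carrier: "A \<in> carrier (SL n) \<Longrightarrow> A \<in> carrier_mat n n"
  by (simp add: SL_iff)

lemma SL_dim [simp]: "A \<in> carrier (SL n) \<Longrightarrow> dim_row A = n" "A \<in> carrier (SL n) \<Longrightarrow> dim_col A = n"
  by (auto dest: SL_carrier)

lemma SL_mult [simp]: "mult (SL n) = (*)" "one (SL n) = 1\<^sub>m n"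
  by (simp_all add: SL_def)

lemma SL_one [simp]: "1\<^sub>m n \<in> carrier (SL n)"
  by (simp add: SL_iff)

lemma SL_times [simp]: "A \<in> carrier (SL n) \<Longrightarrow> B \<in> carrier (SL n) \<Longrightarrow> A * B \<in> carrier (SL n)"
  by (auto simp: SL_iff det_mult)

lemma SL_transpose [simp]: "A \<in> carrier (SL n) \<Longrightarrow> transpose_mat A \<in> carrier (SL n)"
  by (auto simp: SL_iff det_transpose)

text \<open>Determinant one makes the adjugate the inverse, so \<open>adj_mat\<close> serves as the
  group inverse throughout.\<close>

lemma SL_adj_inv [simp]:
  assumes "A \<in> carrier (SL n)"
  shows "A * adj_mat A = 1\<^sub>m n" "adj_mat A * A = 1\<^sub>m n"
  using assms adj_mat[of A n] by (auto simp: SL_iff)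

lemma SL_adj [simp]:
  assumes "A \<in> carrier (SL n)"
  shows "adj_mat A \<in> carrier (SL n)"
proof -
  have c: "A \<in> carrier_mat n n" "adj_mat A \<in> carrier_mat n n" using assms adj_mat[of A n] by (auto simp: SL_iff)
  have "det A * det (adj_mat A) = det (1\<^sub>m n)"
    using det_mult[OF c] SL_adj_inv(1)[OF assms] by simp
  then show ?thesis using assms c by (simp add: SL_iff)
qed

lemma SL_assoc: "A \<in> carrier (SL n) \<Longrightarrow> B \<in> carrier (SL n) \<Longrightarrow> C \<in> carrier (SL n) \<Longrightarrow> A * B * C = A * (B * C)"
  by (meson SL_carrier assoc_mult_mat)

lemma SL_mult_one [simp]: "A \<in> carrier (SL n) \<Longrightarrow> 1\<^sub>m n * A = A" "A \<in> carrier (SL n) \<Longrightarrow> A * 1\<^sub>m n = A"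
  by (auto dest: SL_carrier)

lemma SL_cancel [simp]:
  assumes "A \<in> carrier (SL n)" "B \<in> carrier (SL n)"
  shows "A * (adj_mat A * B) = B" "adj_mat A * (A * B) = B"
  using assms SL_assoc[of A "adj_mat A" B] SL_assoc[of "adj_mat A" A B] by auto

lemma SL_transpose_mult:
  "A \<in> carrier (SL n) \<Longrightarrow> B \<in> carrier (SL n) \<Longrightarrow> transpose_mat (A * B) = transpose_mat B * transpose_mat A"
  by (meson SL_carrier transpose_mult)

lemma SL_inv_unique:
  assumes "A \<in> carrier (SL n)" "B \<in> carrier (SL n)" "A * B = 1\<^sub>m n"
  shows "adj_mat A = B"
  using assms SL_cancel(2)[OF assms(1,2)] by (metis SL_adj SL_mult_one(2))

lemma SL_adj_mult:
  assumes "A \<in> carrier (SL n)" "B \<in> carrier (SL n)"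
  shows "adj_mat (A * B) = adj_mat B * adj_mat A"
  by (rule SL_inv_unique) (use assms in \<open>simp_all add: SL_assoc\<close>)

lemma SL_adj_transpose:
  assumes "A \<in> carrier (SL n)"
  shows "adj_mat (transpose_mat A) = transpose_mat (adj_mat A)"
  by (rule SL_inv_unique) (use assms in \<open>simp_all flip: SL_transpose_mult\<close>)

lemma SL_adj_adj [simp]: "A \<in> carrier (SL n) \<Longrightarrow> adj_mat (adj_mat A) = A"
  by (rule SL_inv_unique) simp_all

lemma SL_entry:
  assumes "A \<in> carrier (SL n)" "B \<in> carrier (SL n)" "i < n" "j < n"
  shows "(A * B) $$ (i, j) = (\<Sum>l<n. A $$ (i, l) * B $$ (l, j))"
  using assms by (simp add: scalar_prod_def atLeast0LessThan)

text \<open>With a relation as index, one family covers both triangular groups, the diagonal torus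
  (\<open>R\<close> is equality) and the intersections of these with conjugates under permutation
  matrices.\<close>

definition supp :: "(nat \<Rightarrow> nat \<Rightarrow> bool) \<Rightarrow> complex mat set" where
  "supp R = {A \<in> carrier (SL n). \<forall>i<n. \<forall>j<n. A $$ (i, j) \<noteq> 0 \<longrightarrow> R i j}"

definition unip :: "(nat \<Rightarrow> nat \<Rightarrow> bool) \<Rightarrow> complex mat set" where
  "unip R = {A \<in> supp R. \<forall>i<n. A $$ (i, i) = 1}"

text \<open>Transitivity gives closure under products; containment in one of the two linear orders
  makes the matrices triangular, which gives nonzero diagonals and closure under inverses.\<close>

definition tri :: "(nat \<Rightarrow> nat \<Rightarrow> bool) \<Rightarrow> bool" where
  "tri R \<longleftrightarrow> reflp R \<and> transp R \<and> (R \<le> (\<le>) \<or> R \<le> (\<ge>))"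

lemma suppI: "A \<in> carrier (SL n) \<Longrightarrow> (\<And>i j. i < n \<Longrightarrow> j < n \<Longrightarrow> A $$ (i, j) \<noteq> 0 \<Longrightarrow> R i j) \<Longrightarrow> A \<in> supp R"
  by (simp add: supp_def)

lemma suppD: "A \<in> supp R \<Longrightarrow> i < n \<Longrightarrow> j < n \<Longrightarrow> A $$ (i, j) \<noteq> 0 \<Longrightarrow> R i j"
  by (simp add: supp_def)

lemma supp_SL [simp]: "A \<in> supp R \<Longrightarrow> A \<in> carrier (SL n)"
  by (simp add: supp_def)

lemma unip_supp: "A \<in> unip R \<Longrightarrow> A \<in> supp R"
  by (simp add: unip_def)

lemma unip_SL [simp]: "A \<in> unip R \<Longrightarrow> A \<in> carrier (SL n)"
  by (rule supp_SL) (rule unip_supp)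

lemma unip_diag: "A \<in> unip R \<Longrightarrow> i < n \<Longrightarrow> A $$ (i, i) = 1"
  by (simp add: unip_def)

lemma supp_mono:
  "A \<in> supp R \<Longrightarrow> (\<And>i j. i < n \<Longrightarrow> j < n \<Longrightarrow> R i j \<Longrightarrow> R' i j) \<Longrightarrow> A \<in> supp R'"
  unfolding supp_def by blast

lemma unip_mono:
  "A \<in> unip R \<Longrightarrow> (\<And>i j. i < n \<Longrightarrow> j < n \<Longrightarrow> R i j \<Longrightarrow> R' i j) \<Longrightarrow> A \<in> unip R'"
  unfolding supp_def unip_def by blast

lemma Bplus_eq: "Bplus n = supp (\<le>)"
proof -
  have "upper_triangular A \<longleftrightarrow> (\<forall>i<n. \<forall>j<n. A $$ (i, j) \<noteq> 0 \<longrightarrow> i \<le> j)"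
    if "A \<in> carrier (SL n)" for A
    using SL_dim[OF that] unfolding upper_triangular_def by (metis leI less_trans not_le)
  then show ?thesis by (auto simp: Bplus_def supp_def simp del: supp_SL unip_SL)
qed

lemma Bminus_eq: "Bminus n = supp (\<ge>)"
proof -
  have "upper_triangular (transpose_mat A) \<longleftrightarrow> (\<forall>i<n. \<forall>j<n. A $$ (i, j) \<noteq> 0 \<longrightarrow> i \<ge> j)"
    if "A \<in> carrier (SL n)" for A
    using SL_dim[OF that] SL_dim[OF SL_transpose[OF that]] unfolding upper_triangular_def
    by (metis index_transpose_mat(1) leI less_trans not_le)
  then show ?thesis by (auto simp: Bminus_def supp_def simp del: supp_SL unip_SL)
qed

lemma Nplus_eq: "Nplus n = unip (\<le>)"
  by (auto simp: Nplus_def Bplus_eq unip_def simp del: supp_SL unip_SL)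

lemma supp_transpose: "A \<in> supp R \<Longrightarrow> transpose_mat A \<in> supp (\<lambda>i j. R j i)"
  by (auto simp: supp_def simp del: supp_SL unip_SL)

lemma unip_transpose: "A \<in> unip R \<Longrightarrow> transpose_mat A \<in> unip (\<lambda>i j. R j i)"
  by (auto simp: unip_def intro: supp_transpose)

lemma supp_mult:
  assumes "transp R" "A \<in> supp R" "B \<in> supp R"
  shows "A * B \<in> supp R"
proof (rule suppI)
  fix i j assume ij: "i < n" "j < n" "(A * B) $$ (i, j) \<noteq> 0"
  then have "(\<Sum>l<n. A $$ (i, l) * B $$ (l, j)) \<noteq> 0"
    using assms by (subst (asm) SL_entry) auto
  then obtain l where "l < n" "A $$ (i, l) * B $$ (l, j) \<noteq> 0"
    by (rule sum.not_neutral_contains_not_neutral) auto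
  then show "R i j" using assms ij by (auto dest: suppD intro: transpD)
qed (use assms in auto)

lemma tri_antisym: "tri R \<Longrightarrow> R i j \<Longrightarrow> R j i \<Longrightarrow> i = j"
  unfolding tri_def le_fun_def le_bool_def by (meson antisym)

lemma supp_diag_mult:
  assumes "tri R" "A \<in> supp R" "B \<in> supp R" "i < n"
  shows "(A * B) $$ (i, i) = A $$ (i, i) * B $$ (i, i)"
proof -
  have "(A * B) $$ (i, i) = (\<Sum>l<n. A $$ (i, l) * B $$ (l, i))" using assms by (subst SL_entry) auto
  also have "\<dots> = (\<Sum>l<n. if l = i then A $$ (i, i) * B $$ (i, i) else 0)"
    using assms tri_antisym[OF assms(1)] by (intro sum.cong) (auto dest: suppD)
  finally show ?thesis using assms by simp
qed

lemma unip_mult: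
  assumes "tri R" "A \<in> unip R" "B \<in> unip R"
  shows "A * B \<in> unip R"
  using assms supp_mult[of R A B] supp_diag_mult[of R A B] by (auto simp: unip_def tri_def simp del: supp_SL unip_SL)

lemma det_tri:
  assumes "R \<le> (\<le>) \<or> R \<le> (\<ge>)" "A \<in> carrier_mat n n"
    and "\<And>i j. i < n \<Longrightarrow> j < n \<Longrightarrow> A $$ (i, j) \<noteq> 0 \<Longrightarrow> R i j"
  shows "det A = (\<Prod>i<n. A $$ (i, i))"
proof -
  have "det A = prod_list (diag_mat A)"
    using assms(1)
  proof
    assume "R \<le> (\<le>)"
    then have "i \<le> j" if "R i j" for i j using that by (auto simp: le_fun_def)
    then have "upper_triangular A" using assms(2,3) unfolding upper_triangular_def
      by (metis carrier_matD(1) leD less_trans)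
    then show ?thesis using assms(2) det_upper_triangular by blast
  next
    assume "R \<le> (\<ge>)"
    then have "j \<le> i" if "R i j" for i j using that by (auto simp: le_fun_def)
    then show ?thesis using assms(2,3) by (intro det_lower_triangular[of n]) (metis leD less_trans)+
  qed
  also have "\<dots> = (\<Prod>i<n. A $$ (i, i))"
    using assms(2) by (simp add: diag_mat_def atLeast0LessThan prod.list_conv_set_nth)
  finally show ?thesis .
qed

lemma supp_diag_nonzero:
  assumes "R \<le> (\<le>) \<or> R \<le> (\<ge>)" "A \<in> supp R" "i < n"
  shows "A $$ (i, i) \<noteq> 0"
proof -
  have "(\<Prod>i<n. A $$ (i, i)) = 1"
    using det_tri[of R A] assms by (auto simp: supp_def SL_iff simp del: supp_SL unip_SL)
  then show ?thesis using \<open>i < n\<close> by (metis finite_lessThan lessThan_iff prod_zero_iff zero_neq_one)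
qed

text \<open>Row \<open>i\<close> of \<open>A * adj_mat A\<close> is compared with the identity at a
  position outside \<open>R\<close>. Once the rows \<open>l\<close> related to \<open>i\<close> have
  been treated, transitivity kills every summand except \<open>l = i\<close>, and that one contains
  a nonzero diagonal entry.\<close>

lemma supp_inv:
  assumes "tri R" "A \<in> supp R"
  shows "adj_mat A \<in> supp R"
proof -
  have R: "reflp R" "transp R" "R \<le> (\<le>) \<or> R \<le> (\<ge>)" using assms by (auto simp: tri_def)
  \<comment> \<open>Decreases along \<open>R\<close> off the diagonal in the upper and in the lower
    case alike, so a row is treated after the rows on which it depends.\<close>
  define rk where "rk i = (if R \<le> (\<le>) then n - i else i)" for i
  have rk: "rk l < rk i" if "R i l" "i \<noteq> l" "i < n" "l < n" for i l
    using R(3) that by (fastforce simp: rk_def le_fun_def)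
  have "i < n \<longrightarrow> adj_mat A $$ (i, j) \<noteq> 0 \<longrightarrow> R i j" if j: "j < n" for i j
  proof (induction i rule: measure_induct_rule[of rk])
    case (less i)
    show ?case
    proof (intro impI, rule ccontr)
      assume i: "i < n" and nz: "adj_mat A $$ (i, j) \<noteq> 0" and nR: "\<not> R i j"
      have "i \<noteq> j" using nR R(1) by (auto dest: reflpD)
      have z: "A $$ (i, l) * adj_mat A $$ (l, j) = 0" if "l < n" "l \<noteq> i" for l
      proof (rule ccontr)
        assume a: "A $$ (i, l) * adj_mat A $$ (l, j) \<noteq> 0"
        then have "R i l" using assms(2) i that by (auto dest: suppD)
        moreover have "R l j" using less[of l] rk[of i l] a that i \<open>R i l\<close> by auto
        ultimately show False using nR R(2) by (auto dest: transpD)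
      qed
      have "(A * adj_mat A) $$ (i, j) = (\<Sum>l<n. A $$ (i, l) * adj_mat A $$ (l, j))"
        using i j assms(2) by (subst SL_entry) auto
      also have "\<dots> = A $$ (i, i) * adj_mat A $$ (i, j)"
        using i by (subst sum.remove[of _ i]) (auto intro!: sum.neutral dest!: z)
      finally have "A $$ (i, i) * adj_mat A $$ (i, j) = 0"
        using i j \<open>i \<noteq> j\<close> assms(2) by simp
      then show False using nz supp_diag_nonzero[OF R(3) assms(2) i] by simp
    qed
  qed
  then show ?thesis using assms(2) by (auto simp: supp_def simp del: supp_SL unip_SL)
qed

lemma unip_inv:
  assumes "tri R" "A \<in> unip R"
  shows "adj_mat A \<in> unip R"
proof -
  have "adj_mat A \<in> supp R" using assms supp_inv unip_supp by blast
  moreover have "adj_mat A $$ (i, i) = 1" if "i < n" for i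
    using supp_diag_mult[OF assms(1) unip_supp[OF assms(2)] \<open>adj_mat A \<in> supp R\<close> that] that assms(2)
    by (simp add: unip_diag)
  ultimately show ?thesis by (simp add: unip_def del: supp_SL unip_SL)
qed

lemma tri_le [simp]: "tri (\<le>)" "tri (\<ge>)"
  by (auto simp: tri_def reflp_def transp_def)

section \<open>Factorisations of triangular matrices\<close>

lemma upper_lower_unip:
  assumes "A \<in> unip (\<le>)" "A \<in> supp (\<ge>)"
  shows "A = 1\<^sub>m n"
  using assms by (intro eq_matI) (auto simp: unip_diag dest!: unip_supp, (meson suppD leD less_le_not_le nat_neq_iff)+)

text \<open>Each column is divided by its diagonal entry. The product of these entries is the
  determinant of \<open>A\<close>, so the diagonal factor again has determinant one.\<close>

lemma supp_split_diag:
  assumes "reflp R" "R \<le> (\<le>) \<or> R \<le> (\<ge>)" "A \<in> supp R"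
  obtains y d where "y \<in> unip R" "d \<in> supp (=)" "A = y * d"
proof -
  define d where "d = mat n n (\<lambda>(i, j). if i = j then A $$ (i, i) else 0)"
  define y where "y = mat n n (\<lambda>(i, j). A $$ (i, j) / A $$ (j, j))"
  have nz: "A $$ (i, i) \<noteq> 0" if "i < n" for i using supp_diag_nonzero[OF assms(2,3) that] .
  have "det d = (\<Prod>i<n. d $$ (i, i))"
    by (rule det_tri[of "(=)"]) (auto simp: d_def split: if_splits)
  also have "\<dots> = (\<Prod>i<n. A $$ (i, i))" by (rule prod.cong) (auto simp: d_def)
  also have "\<dots> = det A" using det_tri[of R A] assms by (auto simp: supp_def SL_carrier simp del: supp_SL unip_SL)
  finally have d: "d \<in> supp (=)" using assms(3)
    by (intro suppI) (auto simp: SL_iff d_def split: if_splits dest!: supp_SL)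
  have ys: "y $$ (i, j) \<noteq> 0 \<Longrightarrow> R i j" if "i < n" "j < n" for i j
    using assms(3) that by (auto simp: y_def dest: suppD)
  have "det y = (\<Prod>i<n. y $$ (i, i))"
    by (rule det_tri[of R]) (use assms ys in \<open>auto simp: y_def\<close>)
  also have "\<dots> = 1" using nz by (intro prod.neutral) (auto simp: y_def)
  finally have "y \<in> carrier (SL n)" by (simp add: SL_iff y_def)
  then have y: "y \<in> unip R" using ys nz by (auto simp: unip_def y_def simp del: supp_SL unip_SL intro!: suppI)
  have "A = y * d"
  proof (rule eq_matI)
    fix i j assume "i < dim_row (y * d)" "j < dim_col (y * d)"
    then have ij: "i < n" "j < n" by (auto simp: y_def d_def)
    then have "(y * d) $$ (i, j) = (\<Sum>l<n. if l = j then y $$ (i, j) * d $$ (j, j) else 0)"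
      by (subst SL_entry) (use y d in \<open>auto simp: d_def if_distrib cong: if_cong intro!: sum.cong\<close>)
    also have "\<dots> = A $$ (i, j)" using ij nz by (simp add: y_def d_def)
    finally show "A $$ (i, j) = (y * d) $$ (i, j)" by simp
  qed (use assms(3) in \<open>auto simp: y_def d_def dest!: supp_SL\<close>)
  with y d show ?thesis using that by blast
qed

text \<open>The rows of the inverse of the unipotent factor solve independent triangular systems.\<close>

lemma tri_solve:
  fixes y :: "nat \<Rightarrow> nat \<Rightarrow> complex" and \<rho> :: "nat \<Rightarrow> int"
  assumes "finite S" "inj_on \<rho> S" "\<And>b c. b \<in> S \<Longrightarrow> c \<in> S \<Longrightarrow> y b c \<noteq> 0 \<Longrightarrow> \<rho> b \<le> \<rho> c"
    and "\<And>b. b \<in> S \<Longrightarrow> y b b \<noteq> 0"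
  shows "\<exists>x. \<forall>c\<in>S. (\<Sum>b\<in>S. x b * y b c) = t c"
  using assms
proof (induction "card S" arbitrary: S)
  case 0
  then show ?case by simp
next
  case (Suc m)
  then have "S \<noteq> {}" by auto
  \<comment> \<open>At the index \<open>a\<close> of largest rank, row \<open>a\<close> of the
    system has only its diagonal entry. Thus \<open>x a\<close> affects equation \<open>a\<close>
    alone and can be chosen after all other unknowns.\<close>
  have "Max (\<rho> ` S) \<in> \<rho> ` S" using Suc.prems(1) \<open>S \<noteq> {}\<close> by auto
  then obtain a where a: "a \<in> S" "\<rho> a = Max (\<rho> ` S)" by auto
  have amax: "\<rho> b < \<rho> a" if "b \<in> S" "b \<noteq> a" for b
  proof -
    have "\<rho> b \<le> \<rho> a" using a that Suc.prems(1) by simp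
    moreover have "\<rho> b \<noteq> \<rho> a" using a that Suc.prems(2) by (metis inj_onD)
    ultimately show ?thesis by simp
  qed
  have ya: "y a c = 0" if "c \<in> S" "c \<noteq> a" for c
    using Suc.prems(3)[of a c] amax[of c] that a by force
  have "\<exists>x. \<forall>c\<in>S - {a}. (\<Sum>b\<in>S - {a}. x b * y b c) = t c"
    by (rule Suc.hyps(1)) (use Suc.prems Suc.hyps(2) a in \<open>auto intro: inj_on_subset\<close>)
  then obtain x where x: "\<And>c. c \<in> S - {a} \<Longrightarrow> (\<Sum>b\<in>S - {a}. x b * y b c) = t c" by auto
  define x' where "x' = x(a := (t a - (\<Sum>b\<in>S - {a}. x b * y b a)) / y a a)"
  have s: "(\<Sum>b\<in>S. x' b * y b c) = x' a * y a c + (\<Sum>b\<in>S - {a}. x b * y b c)" for c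
    using Suc.prems(1) a by (subst sum.remove[of S a]) (auto simp: x'_def intro!: sum.cong)
  show ?case
  proof (intro exI ballI)
    fix c assume "c \<in> S"
    then show "(\<Sum>b\<in>S. x' b * y b c) = t c"
      using s[of c] x[of c] ya[of c] Suc.prems(4)[OF a(1)] by (cases "c = a") (auto simp: x'_def)
  qed
qed

text \<open>For \<open>\<sigma>\<close> a permutation this is the classical splitting of a
  triangular group into the part that conjugation by the permutation moves to the opposite side and
  the part that it keeps. The order \<open>lt\<close> is a parameter so that upper and lower
  matrices share one proof.\<close>

lemma supp_factor:
  fixes \<sigma> :: "nat \<Rightarrow> int"
  assumes inj: "inj_on \<sigma> {..<n}" and lt: "lt = (<) \<or> lt = (>)"
    and A: "A \<in> supp (\<lambda>i j. i = j \<or> lt i j)"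
  obtains y q where "y \<in> unip (\<lambda>i j. i = j \<or> lt i j \<and> \<sigma> i > \<sigma> j)"
    "q \<in> supp (\<lambda>i j. (i = j \<or> lt i j) \<and> \<sigma> i \<le> \<sigma> j)" "A = y * q"
proof -
  define \<rho> :: "nat \<Rightarrow> int" where "\<rho> i = (if lt = (<) then int i else - int i)" for i
  have \<rho>: "inj \<rho>" "lt i j \<longleftrightarrow> \<rho> i < \<rho> j" for i j
    using lt by (auto simp: \<rho>_def inj_def fun_eq_iff)
  have R: "(\<lambda>i j. i = j \<or> lt i j) \<le> (\<le>) \<or> (\<lambda>i j. i = j \<or> lt i j) \<le> (\<ge>)"
    using lt by auto
  \<comment> \<open>The off-diagonal positions allowed in row \<open>a\<close> of the first factor.
    Its inverse \<open>z\<close> has the same support, and row \<open>a\<close> of \<open>z\<close>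
    is found by requiring \<open>z * A\<close> to vanish at these positions.\<close>
  define S where "S a = {b. b < n \<and> lt a b \<and> \<sigma> a > \<sigma> b}" for a
  have S: "finite (S a)" "S a \<subseteq> {..<n}" "a \<notin> S a" for a by (auto simp: S_def \<rho>)
  have "\<exists>x. \<forall>c\<in>S a. (\<Sum>b\<in>S a. x b * A $$ (b, c)) = - A $$ (a, c)" for a
  proof (rule tri_solve[of _ \<rho>])
    show "\<rho> b \<le> \<rho> c" if "b \<in> S a" "c \<in> S a" "A $$ (b, c) \<noteq> 0" for b c
      using suppD[OF A, of b c] that by (auto simp: S_def \<rho>(2))
    show "A $$ (b, b) \<noteq> 0" if "b \<in> S a" for b
      using supp_diag_nonzero[OF R A] that by (auto simp: S_def)
  qed (use S \<rho> in \<open>auto intro: inj_on_subset\<close>)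
  then obtain x where x: "\<And>a c. c \<in> S a \<Longrightarrow> (\<Sum>b\<in>S a. x a b * A $$ (b, c)) = - A $$ (a, c)" by metis
  define z where "z = mat n n (\<lambda>(a, b). if a = b then 1 else if b \<in> S a then x a b else 0)"
  let ?U = "\<lambda>i j. i = j \<or> lt i j \<and> \<sigma> i > \<sigma> j"
  have tU: "tri ?U" using lt by (auto simp: tri_def reflp_def transp_def)
  have zs: "?U i j" if "i < n" "j < n" "z $$ (i, j) \<noteq> 0" for i j
    using that by (auto simp: z_def S_def split: if_splits)
  have "det z = (\<Prod>i<n. z $$ (i, i))"
    by (rule det_tri[of ?U]) (use tU zs in \<open>auto simp: z_def tri_def\<close>)
  also have "\<dots> = 1" by (rule prod.neutral) (auto simp: z_def)
  finally have "z \<in> carrier (SL n)" by (simp add: SL_iff z_def)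
  then have "z \<in> supp ?U" by (rule suppI) (rule zs)
  then have z: "z \<in> unip ?U" by (auto simp: unip_def z_def)
  have ent: "(z * A) $$ (a, c) = A $$ (a, c) + (\<Sum>b\<in>S a. x a b * A $$ (b, c))" if "a < n" "c < n" for a c
  proof -
    have "(z * A) $$ (a, c) = (\<Sum>b<n. z $$ (a, b) * A $$ (b, c))"
      using that z A by (subst SL_entry) auto
    also have "\<dots> = A $$ (a, c) + (\<Sum>b\<in>{..<n} - {a}. z $$ (a, b) * A $$ (b, c))"
      using that by (subst sum.remove[of _ a]) (auto simp: z_def)
    also have "(\<Sum>b\<in>{..<n} - {a}. z $$ (a, b) * A $$ (b, c)) = (\<Sum>b\<in>S a. z $$ (a, b) * A $$ (b, c))"
      using S[of a] that by (intro sum.mono_neutral_right) (auto simp: z_def)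
    also have "\<dots> = (\<Sum>b\<in>S a. x a b * A $$ (b, c))"
      using S[of a] that by (intro sum.cong) (auto simp: z_def S_def)
    finally show ?thesis .
  qed
  have "z * A \<in> supp (\<lambda>i j. (i = j \<or> lt i j) \<and> \<sigma> i \<le> \<sigma> j)"
  proof (rule suppI)
    fix i j assume ij: "i < n" "j < n" "(z * A) $$ (i, j) \<noteq> 0"
    have "z * A \<in> supp (\<lambda>i j. i = j \<or> lt i j)"
      by (rule supp_mult) (use lt A z in \<open>auto simp: transp_def intro: supp_mono dest!: unip_supp\<close>)
    then have 1: "i = j \<or> lt i j" using ij by (rule suppD)
    have "j \<notin> S i" using ent[of i j] x[of j i] ij by auto
    then show "(i = j \<or> lt i j) \<and> \<sigma> i \<le> \<sigma> j" using 1 ij by (auto simp: S_def)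
  qed (use z A in auto)
  moreover have "A = adj_mat z * (z * A)" using z A by simp
  moreover have "adj_mat z \<in> unip ?U" using unip_inv[OF tU z] .
  ultimately show ?thesis using that by blast
qed

text \<open>Transposition reverses the order of the factors; negating \<open>\<sigma>\<close>
  compensates for the reversal of \<open>lt\<close>.\<close>

lemma supp_factor':
  fixes \<sigma> :: "nat \<Rightarrow> int"
  assumes inj: "inj_on \<sigma> {..<n}" and lt: "lt = (<) \<or> lt = (>)"
    and A: "A \<in> supp (\<lambda>i j. i = j \<or> lt i j)"
  obtains y q where "y \<in> unip (\<lambda>i j. i = j \<or> lt i j \<and> \<sigma> i > \<sigma> j)"
    "q \<in> supp (\<lambda>i j. (i = j \<or> lt i j) \<and> \<sigma> i \<le> \<sigma> j)" "A = q * y"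
proof -
  have inj': "inj_on (\<lambda>i. - \<sigma> i) {..<n}" and lt': "(\<lambda>i j. lt j i) = (<) \<or> (\<lambda>i j. lt j i) = (>)"
    using inj lt by (auto simp: inj_on_def)
  have A': "transpose_mat A \<in> supp (\<lambda>i j. i = j \<or> lt j i)"
    using supp_transpose[OF A] by (rule supp_mono) auto
  obtain y q where yq: "y \<in> unip (\<lambda>i j. i = j \<or> lt j i \<and> - \<sigma> i > - \<sigma> j)"
    "q \<in> supp (\<lambda>i j. (i = j \<or> lt j i) \<and> - \<sigma> i \<le> - \<sigma> j)" "transpose_mat A = y * q"
    by (rule supp_factor[OF inj' lt' A'])
  have "A = transpose_mat (y * q)" unfolding yq(3)[symmetric] by simp
  then have "A = transpose_mat q * transpose_mat y"
    using SL_transpose_mult[OF unip_SL[OF yq(1)] supp_SL[OF yq(2)]] by simp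
  moreover have "transpose_mat y \<in> unip (\<lambda>i j. i = j \<or> lt i j \<and> \<sigma> i > \<sigma> j)"
    using unip_transpose[OF yq(1)] by (rule unip_mono) auto
  moreover have "transpose_mat q \<in> supp (\<lambda>i j. (i = j \<or> lt i j) \<and> \<sigma> i \<le> \<sigma> j)"
    using supp_transpose[OF yq(2)] by (rule supp_mono) auto
  ultimately show ?thesis using that by blast
qed

end

section \<open>Signed permutation matrices\<close>

context SL_n
begin

text \<open>The signs stay unspecified: later arguments use only the positions of the nonzero
  entries and that the signs square to one.\<close>

definition sperm :: "(nat \<Rightarrow> nat) \<Rightarrow> (nat \<Rightarrow> complex) \<Rightarrow> complex mat \<Rightarrow> bool" where
  "sperm v e P \<longleftrightarrow> P \<in> carrier (SL n) \<and> v permutes {..<n} \<and> (\<forall>j. e j * e j = 1) \<and>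
     (\<forall>i<n. \<forall>j<n. P $$ (i, j) = (if i = v j then e j else 0))"

lemma sperm_SL: "sperm v e P \<Longrightarrow> P \<in> carrier (SL n)"
  by (simp add: sperm_def)

lemma sperm_entry:
  "sperm v e P \<Longrightarrow> i < n \<Longrightarrow> j < n \<Longrightarrow> P $$ (i, j) = (if i = v j then e j else 0)"
  by (simp add: sperm_def)

lemma sperm_sign: "sperm v e P \<Longrightarrow> e j * e j = 1"
  by (simp add: sperm_def)

lemma sperm_nz: "sperm v e P \<Longrightarrow> e j \<noteq> 0"
  by (metis sperm_sign mult_zero_left zero_neq_one)

lemma sperm_perm: "sperm v e P \<Longrightarrow> v permutes {..<n}"
  by (simp add: sperm_def)

lemma sperm_bound: "sperm v e P \<Longrightarrow> i < n \<Longrightarrow> v i < n"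
  by (metis sperm_perm lessThan_iff permutes_in_image)

lemma sperm_inj: "sperm v e P \<Longrightarrow> v i = v j \<longleftrightarrow> i = j"
  by (metis sperm_perm permutes_inj inj_eq)

lemma sperm_ex: "sperm v e P \<Longrightarrow> i < n \<Longrightarrow> \<exists>a<n. i = v a"
  by (metis sperm_perm lessThan_iff permutes_in_image permutes_inverses(1))

lemma sperm_left:
  assumes P: "sperm v e P" and A: "A \<in> carrier (SL n)" and "i < n" "j < n"
  shows "(P * A) $$ (v i, j) = e i * A $$ (i, j)"
proof -
  have "(P * A) $$ (v i, j) = (\<Sum>l<n. P $$ (v i, l) * A $$ (l, j))"
    by (rule SL_entry) (use assms sperm_SL sperm_bound in auto)
  also have "\<dots> = (\<Sum>l<n. if l = i then e i * A $$ (i, j) else 0)"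
    using assms sperm_bound[OF P] by (intro sum.cong) (auto simp: sperm_entry sperm_inj[OF P])
  finally show ?thesis using assms by simp
qed

lemma sperm_right:
  assumes P: "sperm v e P" and A: "A \<in> carrier (SL n)" and "i < n" "j < n"
  shows "(A * P) $$ (i, j) = A $$ (i, v j) * e j"
proof -
  have "(A * P) $$ (i, j) = (\<Sum>l<n. A $$ (i, l) * P $$ (l, j))"
    by (rule SL_entry) (use assms sperm_SL in auto)
  also have "\<dots> = (\<Sum>l<n. if l = v j then A $$ (i, v j) * e j else 0)"
    using assms sperm_bound[OF P] by (intro sum.cong) (auto simp: sperm_entry)
  finally show ?thesis using assms sperm_bound[OF P] by simp
qed

lemma sperm_orth:
  assumes P: "sperm v e P"
  shows "transpose_mat P * P = 1\<^sub>m n"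
proof (rule eq_matI)
  have S: "P \<in> carrier (SL n)" using P by (rule sperm_SL)
  fix i j assume "i < dim_row (1\<^sub>m n)" "j < dim_col (1\<^sub>m n)"
  then have ij: "i < n" "j < n" by auto
  have "(transpose_mat P * P) $$ (i, j) = transpose_mat P $$ (i, v j) * e j"
    using sperm_right[OF P SL_transpose[OF S] ij] .
  also have "\<dots> = P $$ (v j, i) * e j" using S ij sperm_bound[OF P] by auto
  also have "\<dots> = (if i = j then 1 else 0)"
    using ij sperm_bound[OF P] sperm_inj[OF P] sperm_sign[OF P] by (auto simp: sperm_entry[OF P])
  finally show "(transpose_mat P * P) $$ (i, j) = 1\<^sub>m n $$ (i, j)" using ij by simp
qed (use sperm_SL[OF P] in auto)

lemma sperm_inv:
  assumes P: "sperm v e P"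
  shows "adj_mat P = transpose_mat P"
proof -
  have S: "P \<in> carrier (SL n)" using P by (rule sperm_SL)
  then have "adj_mat (transpose_mat P) = P"
    by (intro SL_inv_unique) (auto simp: sperm_orth[OF P])
  then show ?thesis using SL_adj_adj[OF SL_transpose[OF S]] by simp
qed

lemma sperm_cancel:
  assumes P: "sperm v e P"
  shows "P * transpose_mat P = 1\<^sub>m n" "transpose_mat P * P = 1\<^sub>m n"
    "A \<in> carrier (SL n) \<Longrightarrow> P * (transpose_mat P * A) = A"
    "A \<in> carrier (SL n) \<Longrightarrow> transpose_mat P * (P * A) = A"
  using SL_adj_inv[OF sperm_SL[OF P]] SL_cancel[OF sperm_SL[OF P]] unfolding sperm_inv[OF P] by auto

lemma sperm_conj_entry:
  assumes P: "sperm v e P" and A: "A \<in> carrier (SL n)" and "i < n" "j < n"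
  shows "(P * (A * transpose_mat P)) $$ (v i, v j) = e i * e j * A $$ (i, j)"
    "(transpose_mat P * (A * P)) $$ (i, j) = e i * e j * A $$ (v i, v j)"
proof -
  have S: "P \<in> carrier (SL n)" using P by (rule sperm_SL)
  have AT: "transpose_mat A \<in> carrier (SL n)" using A by simp
  have T: "A * transpose_mat P = transpose_mat (P * transpose_mat A)"
    "transpose_mat P * A = transpose_mat (transpose_mat A * P)"
    using A S by (auto simp: SL_transpose_mult)
  have "(P * (A * transpose_mat P)) $$ (v i, v j) = e i * transpose_mat (P * transpose_mat A) $$ (i, v j)"
    using assms S sperm_bound[OF P] by (subst sperm_left[OF P]) (auto simp: T)
  also have "transpose_mat (P * transpose_mat A) $$ (i, v j) = (P * transpose_mat A) $$ (v j, i)"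
    using assms S sperm_bound[OF P] by auto
  also have "\<dots> = e j * A $$ (i, j)"
    using assms S by (subst sperm_left[OF P AT]) auto
  finally show "(P * (A * transpose_mat P)) $$ (v i, v j) = e i * e j * A $$ (i, j)" by simp
  have "(transpose_mat P * (A * P)) $$ (i, j) = (transpose_mat P * A * P) $$ (i, j)"
    using A S by (simp add: SL_assoc)
  also have "\<dots> = transpose_mat (transpose_mat A * P) $$ (i, v j) * e j"
    using assms S by (subst sperm_right[OF P]) (auto simp: T)
  also have "transpose_mat (transpose_mat A * P) $$ (i, v j) = (transpose_mat A * P) $$ (v j, i)"
    using assms S sperm_bound[OF P] by auto
  also have "\<dots> = A $$ (v i, v j) * e i"
    using assms sperm_bound[OF P] by (subst sperm_right[OF P AT]) auto
  finally show "(transpose_mat P * (A * P)) $$ (i, j) = e i * e j * A $$ (v i, v j)" by simp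
qed

text \<open>Conjugation by \<open>P\<close> relabels rows and columns by \<open>v\<close> and
  otherwise changes only signs, so questions about conjugates of triangular groups become
  implications between relations.\<close>

lemma supp_conj:
  assumes P: "sperm v e P" and A: "A \<in> supp R"
    and R: "\<And>i j. i < n \<Longrightarrow> j < n \<Longrightarrow> R i j \<Longrightarrow> R' (v i) (v j)"
  shows "P * (A * transpose_mat P) \<in> supp R'"
proof (rule suppI)
  fix i j assume ij: "i < n" "j < n" "(P * (A * transpose_mat P)) $$ (i, j) \<noteq> 0"
  then obtain a b where "a < n" "i = v a" "b < n" "j = v b" using sperm_ex[OF P] by metis
  then show "R' i j" using sperm_conj_entry(1)[OF P supp_SL[OF A], of a b] ij R suppD[OF A] by auto
qed (use supp_SL[OF A] sperm_SL[OF P] in auto)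

lemma supp_conj':
  assumes P: "sperm v e P" and A: "A \<in> supp R"
    and R: "\<And>i j. i < n \<Longrightarrow> j < n \<Longrightarrow> R (v i) (v j) \<Longrightarrow> R' i j"
  shows "transpose_mat P * (A * P) \<in> supp R'"
proof (rule suppI)
  fix i j assume ij: "i < n" "j < n" "(transpose_mat P * (A * P)) $$ (i, j) \<noteq> 0"
  then show "R' i j" using sperm_conj_entry(2)[OF P supp_SL[OF A], of i j] R suppD[OF A] sperm_bound[OF P] by auto
qed (use supp_SL[OF A] sperm_SL[OF P] in auto)

lemma unip_conj:
  assumes P: "sperm v e P" and A: "A \<in> unip R"
    and R: "\<And>i j. i < n \<Longrightarrow> j < n \<Longrightarrow> R i j \<Longrightarrow> R' (v i) (v j)"
  shows "P * (A * transpose_mat P) \<in> unip R'"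
proof -
  have "(P * (A * transpose_mat P)) $$ (i, i) = 1" if "i < n" for i
  proof -
    obtain a where "a < n" "i = v a" using sperm_ex[OF P \<open>i < n\<close>] by auto
    then show ?thesis
      using sperm_conj_entry(1)[OF P unip_SL[OF A], of a a] unip_diag[OF A] sperm_sign[OF P] by auto
  qed
  then show ?thesis using supp_conj[OF P unip_supp[OF A], of R'] R by (simp add: unip_def)
qed

lemma unip_conj':
  assumes P: "sperm v e P" and A: "A \<in> unip R"
    and R: "\<And>i j. i < n \<Longrightarrow> j < n \<Longrightarrow> R (v i) (v j) \<Longrightarrow> R' i j"
  shows "transpose_mat P * (A * P) \<in> unip R'"
proof -
  have "(transpose_mat P * (A * P)) $$ (i, i) = 1" if "i < n" for i
    using sperm_conj_entry(2)[OF P unip_SL[OF A], of i i] unip_diag[OF A] sperm_sign[OF P]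
      sperm_bound[OF P] that by auto
  then show ?thesis using supp_conj'[OF P unip_supp[OF A], of R'] R by (simp add: unip_def)
qed

lemma sperm_mult:
  assumes P: "sperm v e P" and Q: "sperm w f Q"
  shows "sperm (v \<circ> w) (\<lambda>j. e (w j) * f j) (P * Q)"
  unfolding sperm_def
proof (intro conjI allI impI)
  show "P * Q \<in> carrier (SL n)" using P Q sperm_SL by auto
  show "v \<circ> w permutes {..<n}" using P Q by (simp add: sperm_perm permutes_compose)
  fix j
  have "e (w j) * f j * (e (w j) * f j) = (e (w j) * e (w j)) * (f j * f j)" by (simp only: ac_simps)
  then show "e (w j) * f j * (e (w j) * f j) = 1" by (simp add: sperm_sign[OF P] sperm_sign[OF Q])
next
  fix i j assume "i < n" "j < n"
  then show "(P * Q) $$ (i, j) = (if i = (v \<circ> w) j then e (w j) * f j else 0)"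
    using sperm_bound[OF Q] by (subst sperm_right[OF Q sperm_SL[OF P]]) (auto simp: sperm_entry[OF P])
qed

lemma sperm_sdot:
  assumes "Suc i < n"
  shows "\<exists>e. sperm (Transposition.transpose i (Suc i)) e (sdot n i)"
proof -
  have ent: "sdot n i $$ (r, c) = (if r = Transposition.transpose i (Suc i) c then if c = i then - 1 else 1 else 0)"
    if "r < n" "c < n" for r c
    using that by (cases "c = i"; cases "c = Suc i") (auto simp: sdot_def)
  \<comment> \<open>Three row additions with coefficients 1, -1, 1 carry the identity to
    \<open>sdot n i\<close>, and each preserves the determinant.\<close>
  let ?E = "addrow 1 i (Suc i) (addrow (- 1) (Suc i) i (addrow 1 i (Suc i) (1\<^sub>m n))) :: complex mat"
  have "sdot n i = ?E"
    using assms by (intro eq_matI) (auto simp: sdot_def)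
  then have "det (sdot n i) = 1"
    using assms by (simp add: det_addrow[of _ n])
  then have "sdot n i \<in> carrier (SL n)" by (simp add: SL_iff sdot_def)
  moreover have "Transposition.transpose i (Suc i) permutes {..<n}"
    using assms by (intro permutes_swap_id) auto
  ultimately have "sperm (Transposition.transpose i (Suc i)) (\<lambda>j. if j = i then - 1 else 1) (sdot n i)"
    unfolding sperm_def using ent by (intro conjI allI impI) simp_all
  then show ?thesis by blast
qed

lemma sperm_one: "sperm id (\<lambda>_. 1) (1\<^sub>m n)"
  by (auto simp: sperm_def permutes_id)

lemma sperm_word_dot: "is_word n is \<Longrightarrow> \<exists>e. sperm (word_perm is) e (word_dot n is)"
proof (induction "is")
  case Nil
  then show ?case using sperm_one by (auto simp: word_perm_def word_dot_def id_def)
next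
  case (Cons i xs)
  then obtain e f where "sperm (word_perm xs) e (word_dot n xs)"
    "sperm (Transposition.transpose i (Suc i)) f (sdot n i)"
    using sperm_sdot[of i] by (auto simp: is_word_def)
  from sperm_mult[OF this(2,1)] show ?case by (auto simp: word_perm_def word_dot_def comp_def)
qed

section \<open>Words for permutations\<close>

lemma word_perm_append: "word_perm (xs @ ys) = word_perm xs \<circ> word_perm ys"
  by (induction xs) (auto simp: word_perm_def comp_assoc)

text \<open>Conjugating by the adjacent transposition at the upper end increases the distance of the
  two letters by one.\<close>

lemma word_transpose_less:
  assumes "a + d < n" "0 < d"
  shows "\<exists>is. is_word n is \<and> word_perm is = Transposition.transpose a (a + d)"
  using assms(2,1)
proof (induction d rule: nat_induct_non_zero)
  case 1
  then show ?case by (intro exI[of _ "[a]"]) (auto simp: is_word_def word_perm_def)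
next
  case (Suc d)
  then obtain xs where xs: "is_word n xs" "word_perm xs = Transposition.transpose a (a + d)" by auto
  have "Transposition.transpose (a + Suc d) (a + d) \<circ> Transposition.transpose (a + d) a
      \<circ> Transposition.transpose (a + Suc d) (a + d) = Transposition.transpose (a + Suc d) a"
    using Suc by (intro transpose_comp_triple) auto
  then have "word_perm ([a + d] @ xs @ [a + d]) = Transposition.transpose a (a + Suc d)"
    unfolding word_perm_append xs(2) by (simp add: word_perm_def comp_assoc transpose_commute)
  moreover have "is_word n ([a + d] @ xs @ [a + d])" using xs Suc by (auto simp: is_word_def)
  ultimately show ?case by blast
qed

lemma word_exists:
  assumes "v permutes {..<n}"
  shows "\<exists>is. is_word n is \<and> word_perm is = v"
  using assms finite_lessThan
proof (induction rule: permutes_induct)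
  case id
  then show ?case by (intro exI[of _ "[]"]) (auto simp: is_word_def word_perm_def)
next
  case (swap a b p)
  have "\<exists>is. is_word n is \<and> word_perm is = Transposition.transpose a b"
  proof (cases "a < b")
    case True
    then show ?thesis using word_transpose_less[of a "b - a"] swap by auto
  next
    case False
    then show ?thesis using word_transpose_less[of b "a - b"] swap by (auto simp: transpose_commute)
  qed
  with swap obtain xs ys where "is_word n xs" "word_perm xs = Transposition.transpose a b"
    "is_word n ys" "word_perm ys = p" by auto
  then show ?case by (intro exI[of _ "xs @ ys"]) (auto simp: word_perm_append is_word_def)
qed

text \<open>\<open>dot\<close> chooses among reduced words, so the set of these must be seen to be
  nonempty: some word exists, and the least length is attained. What is retained of the choice is a
  signed permutation matrix of \<open>v\<close>.\<close>

lemma sperm_dot: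
  assumes "v permutes {..<n}"
  obtains e where "sperm v e (dot n v)"
proof -
  obtain xs where "is_word n xs \<and> word_perm xs = v" using word_exists[OF assms] by auto
  then have "\<exists>m is. is_word n is \<and> word_perm is = v \<and> length is = m" by auto
  then have "\<exists>is. is_word n is \<and> word_perm is = v \<and> length is = coxeter_length n v"
    unfolding coxeter_length_def by (rule LeastI_ex)
  then have "\<exists>is. reduced_word n v is" by (simp add: reduced_word_def)
  then have red: "reduced_word n v (SOME is. reduced_word n v is)" by (rule someI_ex)
  have "is_word n is \<and> word_perm is = v" if "reduced_word n v is" for "is"
    using that by (simp add: reduced_word_def)
  from this[OF red] show ?thesis
    using sperm_word_dot[of "SOME is. reduced_word n v is"] that by (auto simp flip: dot_def)
qed

end

section \<open>The twists in matrix form\<close>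

locale richardson = SL_n +
  fixes v w :: "nat \<Rightarrow> nat" and e f :: "nat \<Rightarrow> complex"
  assumes P: "sperm v e (dot n v)" and Q: "sperm w f (dot n w)"
begin

abbreviation "P \<equiv> dot n v"
abbreviation "Q \<equiv> dot n w"
abbreviation "vi \<equiv> inv_into UNIV v"
abbreviation "wi \<equiv> inv_into UNIV w"
abbreviation "Lcos g \<equiv> g <#\<^bsub>SL n\<^esub> Bminus n"
abbreviation "Rcos g \<equiv> Bminus n #>\<^bsub>SL n\<^esub> g"

lemmas PQ_SL [simp] = sperm_SL[OF P] sperm_SL[OF Q]
lemmas PQ_cancel [simp] = sperm_cancel[OF P] sperm_cancel[OF Q]
lemmas algebra = SL_assoc SL_transpose_mult

lemma inv_v [simp]: "vi (v i) = i" and inv_w [simp]: "wi (w i) = i"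
  using sperm_perm[OF P] sperm_perm[OF Q] by (auto simp: permutes_inverses)

section \<open>Cosets of the lower triangular group\<close>

lemma Lcos_mem: "x \<in> Lcos g \<longleftrightarrow> (\<exists>b\<in>supp (\<ge>). x = g * b)"
  by (auto simp: l_coset_def Bminus_eq)

lemma Rcos_mem: "x \<in> Rcos g \<longleftrightarrow> (\<exists>b\<in>supp (\<ge>). x = b * g)"
  by (auto simp: r_coset_def Bminus_eq)

lemma one_supp: "reflp R \<Longrightarrow> 1\<^sub>m n \<in> supp R"
  by (rule suppI) (auto dest: reflpD split: if_splits)

lemma lower_mult: "a \<in> supp (\<ge>) \<Longrightarrow> b \<in> supp (\<ge>) \<Longrightarrow> a * b \<in> supp (\<ge>)"
  by (rule supp_mult) (auto simp: transp_def)

lemma lower_inv: "a \<in> supp (\<ge>) \<Longrightarrow> adj_mat a \<in> supp (\<ge>)"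
  by (rule supp_inv) simp_all

lemma Lcos_mult:
  assumes "g \<in> carrier (SL n)" "b \<in> supp (\<ge>)"
  shows "Lcos (g * b) = Lcos g"
proof (rule Set.set_eqI)
  fix x
  show "x \<in> Lcos (g * b) \<longleftrightarrow> x \<in> Lcos g"
    unfolding Lcos_mem
  proof
    assume "\<exists>c\<in>supp (\<ge>). x = g * b * c"
    then obtain c where c: "c \<in> supp (\<ge>)" "x = g * b * c" by auto
    then have "x = g * (b * c)" using assms by (simp add: algebra)
    then show "\<exists>c\<in>supp (\<ge>). x = g * c" using lower_mult assms c by auto
  next
    assume "\<exists>c\<in>supp (\<ge>). x = g * c"
    then obtain c where c: "c \<in> supp (\<ge>)" "x = g * c" by auto
    then have "x = g * b * (adj_mat b * c)" using assms by (simp add: algebra)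
    then show "\<exists>c\<in>supp (\<ge>). x = g * b * c" using lower_mult lower_inv assms c by blast
  qed
qed

lemma Rcos_mult:
  assumes "g \<in> carrier (SL n)" "b \<in> supp (\<ge>)"
  shows "Rcos (b * g) = Rcos g"
proof (rule Set.set_eqI)
  fix x
  show "x \<in> Rcos (b * g) \<longleftrightarrow> x \<in> Rcos g"
    unfolding Rcos_mem
  proof
    assume "\<exists>c\<in>supp (\<ge>). x = c * (b * g)"
    then obtain c where c: "c \<in> supp (\<ge>)" "x = c * (b * g)" by auto
    then have "x = (c * b) * g" using assms by (simp add: algebra)
    then show "\<exists>c\<in>supp (\<ge>). x = c * g" using lower_mult assms c by auto
  next
    assume "\<exists>c\<in>supp (\<ge>). x = c * g"
    then obtain c where c: "c \<in> supp (\<ge>)" "x = c * g" by auto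
    then have "x = (c * adj_mat b) * (b * g)" using assms by (simp add: algebra)
    then show "\<exists>c\<in>supp (\<ge>). x = c * (b * g)" using lower_mult lower_inv assms c by blast
  qed
qed

lemma Lcos_eqD:
  assumes "Lcos g = Lcos h" "h \<in> carrier (SL n)"
  shows "\<exists>b\<in>supp (\<ge>). h = g * b"
proof -
  have "h \<in> Lcos h" using assms(2) one_supp[of "(\<ge>)"] unfolding Lcos_mem by (force simp: reflp_def)
  then show ?thesis using assms(1) Lcos_mem by auto
qed

lemma Rcos_eqD:
  assumes "Rcos g = Rcos h" "h \<in> carrier (SL n)"
  shows "\<exists>b\<in>supp (\<ge>). h = b * g"
proof -
  have "h \<in> Rcos h" using assms(2) one_supp[of "(\<ge>)"] unfolding Rcos_mem by (force simp: reflp_def)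
  then show ?thesis using assms(1) Rcos_mem by auto
qed

lemma BwB_iff: "x \<in> BwB n w \<longleftrightarrow> (\<exists>a\<in>supp (\<ge>). \<exists>b\<in>supp (\<ge>). x = a * (Q * b))"
proof -
  have "x \<in> BwB n w \<longleftrightarrow> (\<exists>a\<in>supp (\<ge>). \<exists>b\<in>supp (\<ge>). x = a * Q * b)"
    by (auto simp: BwB_def set_mult_def r_coset_def Bminus_eq)
  moreover have "a * Q * b = a * (Q * b)" if "a \<in> supp (\<ge>)" "b \<in> supp (\<ge>)" for a b
    using that by (simp add: algebra)
  ultimately show ?thesis by (metis (no_types, lifting))
qed

lemma BwB_SL [simp]: "x \<in> BwB n w \<Longrightarrow> x \<in> carrier (SL n)"
  unfolding BwB_iff by auto

lemma BwB_mult: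
  assumes "x \<in> BwB n w" "c \<in> supp (\<ge>)"
  shows "x * c \<in> BwB n w" "c * x \<in> BwB n w"
proof -
  obtain a b where ab: "a \<in> supp (\<ge>)" "b \<in> supp (\<ge>)" "x = a * (Q * b)"
    using assms BwB_iff by auto
  have "x * c = a * (Q * (b * c))" "c * x = (c * a) * (Q * b)"
    using ab assms(2) by (simp_all add: algebra)
  then show "x * c \<in> BwB n w" "c * x \<in> BwB n w"
    unfolding BwB_iff using lower_mult ab assms(2) by blast+
qed

text \<open>An upper unitriangular matrix that is also lower triangular is the identity. This is the
  source of uniqueness for the unipotent factors and for chiral representatives, on either
  side.\<close>

lemma unip_lower_eq:
  assumes "x \<in> unip (\<le>)" "y \<in> unip (\<le>)" "b \<in> supp (\<ge>)" "x * b = y \<or> b * x = y"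
  shows "x = y"
proof -
  have "adj_mat x * y \<in> unip (\<le>)" "y * adj_mat x \<in> unip (\<le>)"
    using assms unip_mult unip_inv tri_le by blast+
  moreover have "b = adj_mat x * y \<or> b = y * adj_mat x"
    using assms(4) by (rule disj_forward) (use assms in \<open>auto simp: algebra\<close>)
  ultimately have "b \<in> unip (\<le>)" by auto
  then have "b = 1\<^sub>m n" using assms(3) upper_lower_unip by blast
  then show ?thesis using assms by auto
qed

section \<open>Unipotent factors and chiral representatives\<close>

lemma factL_eq:
  assumes "x \<in> unip (\<le>)" "b \<in> supp (\<ge>)"
  shows "factL n (x * b) = x"
  unfolding factL_def Nplus_eq
proof (rule the_equality)
  show "x \<in> unip (\<le>) \<and> x * b \<in> Lcos x" using assms Lcos_mem by auto
  fix y assume "y \<in> unip (\<le>) \<and> x * b \<in> Lcos y"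
  then obtain c where c: "y \<in> unip (\<le>)" "c \<in> supp (\<ge>)" "x * b = y * c" using Lcos_mem by auto
  have "y = y * (c * adj_mat c)" using c by simp
  also have "\<dots> = x * b * adj_mat c" unfolding c(3) using c by (simp add: algebra)
  also have "\<dots> = x * (b * adj_mat c)" using c(1,2) assms by (simp add: algebra)
  finally show "y = x" using unip_lower_eq[of x y "b * adj_mat c"] c assms lower_mult lower_inv by metis
qed

lemma factR_eq:
  assumes "x \<in> unip (\<le>)" "b \<in> supp (\<ge>)"
  shows "factR n (b * x) = x"
  unfolding factR_def Nplus_eq
proof (rule the_equality)
  show "x \<in> unip (\<le>) \<and> b * x \<in> Rcos x" using assms Rcos_mem by auto
  fix y assume "y \<in> unip (\<le>) \<and> b * x \<in> Rcos y"
  then obtain c where c: "y \<in> unip (\<le>)" "c \<in> supp (\<ge>)" "b * x = c * y" using Rcos_mem by auto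
  have "y = adj_mat c * (b * x)" unfolding c(3) using c by simp
  also have "\<dots> = (adj_mat c * b) * x" using c(1,2) assms by (simp add: algebra)
  finally show "y = x" using unip_lower_eq[of x y "adj_mat c * b"] c assms lower_mult lower_inv by metis
qed

definition chiral :: "complex mat \<Rightarrow> bool" where
  "chiral h \<longleftrightarrow> (\<exists>u\<in>unip (\<le>). h = u * P) \<and> (\<exists>y\<in>unip (\<le>). h = P * y) \<and> h \<in> BwB n w"

lemma chiral_iff:
  "h \<in> (Nplus n #>\<^bsub>SL n\<^esub> P) \<inter> (P <#\<^bsub>SL n\<^esub> Nplus n) \<inter> BwB n w \<longleftrightarrow> chiral h"
  by (auto simp: chiral_def r_coset_def l_coset_def Nplus_eq)

lemma chiral_eqL:
  assumes "chiral h" "chiral h'" "Lcos h = Lcos h'"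
  shows "h = h'"
proof -
  obtain y y' b where y: "y \<in> unip (\<le>)" "h = P * y" "y' \<in> unip (\<le>)" "h' = P * y'"
    "b \<in> supp (\<ge>)" "h' = h * b"
    using assms Lcos_eqD[of h h'] BwB_SL unfolding chiral_def by metis
  then have "transpose_mat P * (P * (y * b)) = transpose_mat P * (P * y')" by (simp add: algebra)
  then have "y * b = y'" using y by simp
  then show ?thesis using unip_lower_eq y by metis
qed

lemma chiral_eqR:
  assumes "chiral h" "chiral h'" "Rcos h = Rcos h'"
  shows "h = h'"
proof -
  obtain y y' b where y: "y \<in> unip (\<le>)" "h = y * P" "y' \<in> unip (\<le>)" "h' = y' * P"
    "b \<in> supp (\<ge>)" "h' = b * h"
    using assms Rcos_eqD[of h h'] BwB_SL unfolding chiral_def by metis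
  then have "b * y * P * transpose_mat P = y' * P * transpose_mat P" by (simp add: algebra)
  then have "b * y = y'" using y by (simp add: algebra)
  then show ?thesis using unip_lower_eq y by metis
qed

lemma chiR_eq:
  assumes "chiral h"
  shows "chiR n v w (Rcos h) = Lcos h"
  unfolding chiR_def
proof (rule the_equality)
  show "\<exists>g\<in>(Nplus n #>\<^bsub>SL n\<^esub> P) \<inter> (P <#\<^bsub>SL n\<^esub> Nplus n) \<inter> BwB n w. Rcos h = Rcos g \<and> Lcos h = Lcos g"
    using assms chiral_iff by blast
  fix Y
  assume "\<exists>g\<in>(Nplus n #>\<^bsub>SL n\<^esub> P) \<inter> (P <#\<^bsub>SL n\<^esub> Nplus n) \<inter> BwB n w. Rcos h = Rcos g \<and> Y = Lcos g"
  then show "Y = Lcos h" using assms chiral_eqR chiral_iff by metis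
qed

text \<open>The support conditions are chosen so that conjugation by \<open>P\<close> makes
  \<open>y\<close> lower triangular and keeps \<open>t\<close> upper triangular.\<close>

lemma factor_v:
  assumes "b \<in> supp (\<le>)"
  obtains y t where "y \<in> unip (\<lambda>i j. i = j \<or> i < j \<and> v i > v j)"
    "t \<in> supp (\<lambda>i j. i \<le> j \<and> v i \<le> v j)" "b = y * t"
proof -
  have inj: "inj_on (\<lambda>i. int (v i)) {..<n}" using sperm_inj[OF P] by (auto simp: inj_on_def)
  have b: "b \<in> supp (\<lambda>i j. i = j \<or> i < j)" using assms by (rule supp_mono) auto
  obtain y q where yq: "y \<in> unip (\<lambda>i j. i = j \<or> i < j \<and> int (v i) > int (v j))"
    "q \<in> supp (\<lambda>i j. (i = j \<or> i < j) \<and> int (v i) \<le> int (v j))" "b = y * q"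
    by (rule supp_factor[OF inj disjI1[OF refl] b])
  show ?thesis
  proof (rule that[OF _ _ yq(3)])
    show "y \<in> unip (\<lambda>i j. i = j \<or> i < j \<and> v i > v j)" using yq(1) by (rule unip_mono) auto
    show "q \<in> supp (\<lambda>i j. i \<le> j \<and> v i \<le> v j)" using yq(2) by (rule supp_mono) auto
  qed
qed

lemma tri_V [simp]: "tri (\<lambda>i j. i \<le> j \<and> v i \<le> v j)"
  by (auto simp: tri_def reflp_def transp_def)

text \<open>The part of \<open>b\<close> that \<open>P\<close> conjugates into lower triangular
  form, and the diagonal, move to the left of \<open>P\<close> and disappear in the coset; the rest
  can stand on either side of \<open>P\<close>. The lemma is what makes \<open>chiR\<close>
  injective on all of \<open>richL\<close>, as its use through \<open>the_inv_into\<close>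
  requires.\<close>

lemma richL_rep:
  assumes "X \<in> richL n v w"
  shows "\<exists>h. chiral h \<and> X = Rcos h"
proof -
  obtain g a b where g: "g \<in> BwB n w" "X = Rcos g" "a \<in> supp (\<ge>)" "b \<in> supp (\<le>)" "g = a * P * b"
    using assms by (auto simp: richL_def set_mult_def r_coset_def Bminus_eq Bplus_eq)
  obtain y1 t where y1: "y1 \<in> unip (\<lambda>i j. i = j \<or> i < j \<and> v i > v j)"
    and t: "t \<in> supp (\<lambda>i j. i \<le> j \<and> v i \<le> v j)" and b: "b = y1 * t"
    by (rule factor_v[OF g(4)])
  \<comment> \<open>\<open>supp_split_diag\<close> leaves the diagonal factor on the right;
    splitting the transpose puts it on the left, next to \<open>P\<close>.\<close>
  have "transpose_mat t \<in> supp (\<lambda>i j. i \<ge> j \<and> v i \<ge> v j)" using supp_transpose[OF t] by simp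
  then obtain y' d where y': "y' \<in> unip (\<lambda>i j. i \<ge> j \<and> v i \<ge> v j)" "d \<in> supp (=)" "transpose_mat t = y' * d"
    by (rule supp_split_diag[rotated 2]) (auto simp: reflp_def)
  define y where "y = transpose_mat y'"
  have y: "y \<in> unip (\<lambda>i j. i \<le> j \<and> v i \<le> v j)" using unip_transpose[OF y'(1)] by (simp add: y_def)
  have d: "transpose_mat d \<in> supp (=)" using supp_transpose[OF y'(2)] by (rule supp_mono) auto
  have "t = transpose_mat (transpose_mat t)" by simp
  then have td: "t = transpose_mat d * y" unfolding y'(3) y_def using y' by (simp add: algebra)
  define c where "c = a * (P * (y1 * transpose_mat P) * (P * (transpose_mat d * transpose_mat P)))"
  have "P * (y1 * transpose_mat P) \<in> unip (\<ge>)" by (rule unip_conj[OF P y1]) auto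
  moreover have "P * (transpose_mat d * transpose_mat P) \<in> supp (\<ge>)" by (rule supp_conj[OF P d]) auto
  ultimately have c: "c \<in> supp (\<ge>)" unfolding c_def using g(3) lower_mult unip_supp by metis
  have gc: "g = c * (P * y)" using g(3) y y1 d supp_SL[OF y'(2)] by (simp add: g(5) b td c_def algebra)
  have "P * y = adj_mat c * g" unfolding gc using c y by simp
  then have "P * y \<in> BwB n w" using BwB_mult(2)[OF g(1) lower_inv[OF c]] by simp
  moreover have "P * y = (P * (y * transpose_mat P)) * P" using y by (simp add: algebra)
  moreover have "P * (y * transpose_mat P) \<in> unip (\<le>)" by (rule unip_conj[OF P y]) auto
  moreover have "y \<in> unip (\<le>)" using y by (rule unip_mono) auto
  ultimately have "chiral (P * y)" unfolding chiral_def by blast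
  moreover have "X = Rcos (P * y)" using g(2) gc Rcos_mult c y by simp
  ultimately show ?thesis by blast
qed

lemma chiL_eq:
  assumes "chiral h"
  shows "chiL n v w (Lcos h) = Rcos h"
  unfolding chiL_def
proof (rule the_inv_into_f_eq)
  show "inj_on (chiR n v w) (richL n v w)"
    by (rule inj_onI) (metis richL_rep chiR_eq chiral_eqL)
  show "chiR n v w (Rcos h) = Lcos h" using assms chiR_eq by blast
  obtain y where y: "y \<in> unip (\<le>)" "h = P * y" "h \<in> BwB n w" using assms chiral_def by auto
  have "h = 1\<^sub>m n * P * y" using y by simp
  moreover have "1\<^sub>m n \<in> supp (\<ge>)" by (rule one_supp) (auto simp: reflp_def)
  ultimately have "h \<in> (Bminus n #>\<^bsub>SL n\<^esub> P) <#>\<^bsub>SL n\<^esub> Bplus n"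
    unfolding set_mult_def r_coset_def Bminus_eq Bplus_eq SL_mult using unip_supp[OF y(1)] by blast
  then show "Rcos h \<in> richL n v w" unfolding richL_def using y(3) by blast
qed

section \<open>Factored representatives and the values of the twists\<close>

lemma richR_rep:
  assumes "X \<in> richR n v w"
  obtains u where "u \<in> unip (\<le>)" "u * P \<in> BwB n w" "X = Lcos (u * P)"
proof -
  obtain g a b where g: "g \<in> BwB n w" "X = Lcos g" "a \<in> supp (\<le>)" "b \<in> supp (\<ge>)" "g = a * P * b"
    using assms by (auto simp: richR_def set_mult_def r_coset_def Bminus_eq Bplus_eq)
  obtain u d where u: "u \<in> unip (\<le>)" "d \<in> supp (=)" "a = u * d"
    by (rule supp_split_diag[OF _ _ g(3)]) (auto simp: reflp_def)
  define c where "c = transpose_mat P * (d * P) * b"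
  have "transpose_mat P * (d * P) \<in> supp (\<ge>)" by (rule supp_conj'[OF P u(2)]) (auto simp: sperm_inj[OF P])
  then have c: "c \<in> supp (\<ge>)" unfolding c_def using g(4) lower_mult by blast
  have gc: "g = u * P * c" using g(4) u by (simp add: g(5) c_def algebra)
  have "u * P = g * adj_mat c" unfolding gc using c u by (simp add: algebra)
  then have "u * P \<in> BwB n w" using BwB_mult(1)[OF g(1) lower_inv[OF c]] by simp
  moreover have "X = Lcos (u * P)" using g(2) gc Lcos_mult c u by simp
  ultimately show ?thesis using that u by blast
qed

text \<open>The support of \<open>b\<close> says that conjugating it back by \<open>Q\<close> gives
  an upper triangular matrix, that of \<open>t\<close> that conjugating by \<open>P\<close> keeps it
  upper triangular. The diagonals of \<open>b\<close> and \<open>t\<close> are left free because the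
  two constructions below normalise different ones: the first makes \<open>b\<close> unitriangular,
  the second \<open>t\<close>.\<close>

definition twist_config :: "complex mat \<Rightarrow> complex mat \<Rightarrow> complex mat \<Rightarrow> bool" where
  "twist_config u b t \<longleftrightarrow> u \<in> unip (\<le>) \<and> b \<in> supp (\<lambda>i j. i = j \<or> i > j \<and> wi i < wi j) \<and>
     t \<in> supp (\<lambda>i j. i \<le> j \<and> v i \<le> v j) \<and> u * P = b * (Q * transpose_mat t)"

lemma richR_twist_config:
  assumes "X \<in> richR n v w"
  obtains u b t where "twist_config u b t" "X = Lcos (u * P)"
proof -
  obtain u0 where u0: "u0 \<in> unip (\<le>)" "u0 * P \<in> BwB n w" "X = Lcos (u0 * P)"
    using richR_rep[OF assms] .
  obtain a b where ab: "a \<in> supp (\<ge>)" "b \<in> supp (\<ge>)" "u0 * P = a * (Q * b)"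
    using u0(2) BwB_iff by auto
  have inj: "inj_on (\<lambda>i. - int (wi i)) {..<n}"
    using permutes_inj[OF permutes_inv[OF sperm_perm[OF Q]]] by (auto simp: inj_on_def inj_def)
  have a: "a \<in> supp (\<lambda>i j. i = j \<or> i > j)" using ab(1) by (rule supp_mono) auto
  obtain z y where z: "z \<in> unip (\<lambda>i j. i = j \<or> i > j \<and> - int (wi i) > - int (wi j))"
    and y: "y \<in> supp (\<lambda>i j. (i = j \<or> i > j) \<and> - int (wi i) \<le> - int (wi j))" and azy: "a = z * y"
    by (rule supp_factor[OF inj disjI2[OF refl] a])
  \<comment> \<open>The part of \<open>a\<close> that remains lower triangular behind
    \<open>Q\<close> is moved into the right factor.\<close>
  define b2 where "b2 = transpose_mat Q * (y * Q) * b"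
  have "transpose_mat Q * (y * Q) \<in> supp (\<ge>)" by (rule supp_conj'[OF Q y]) auto
  then have b2: "b2 \<in> supp (\<ge>)" unfolding b2_def using ab lower_mult by blast
  have e0: "u0 * P = z * (Q * b2)" using ab(2) z y by (simp add: ab(3) azy b2_def algebra)
  obtain y1 t where y1: "y1 \<in> unip (\<lambda>i j. i = j \<or> i < j \<and> v i > v j)"
    and t: "t \<in> supp (\<lambda>i j. i \<le> j \<and> v i \<le> v j)" and b2y: "transpose_mat b2 = y1 * t"
    by (rule factor_v[OF supp_transpose[OF b2]])
  have "b2 = transpose_mat (transpose_mat b2)" by simp
  then have b2t: "b2 = transpose_mat t * transpose_mat y1" unfolding b2y using y1 t by (simp add: algebra)
  \<comment> \<open>Cancels the factor of \<open>b2\<close> that violates the support condition. It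
    is lower triangular, so the coset is unchanged, and conjugation by \<open>P\<close> makes it
    upper unitriangular, so only \<open>u\<close> is altered.\<close>
  define m where "m = adj_mat (transpose_mat y1)"
  have m: "m \<in> unip (\<lambda>i j. j = i \<or> j < i \<and> v j > v i)"
    unfolding m_def
    by (rule unip_inv[OF _ unip_transpose[OF y1]]) (auto simp: tri_def reflp_def transp_def)
  define u where "u = u0 * (P * (m * transpose_mat P))"
  have "P * (m * transpose_mat P) \<in> unip (\<le>)" by (rule unip_conj[OF P m]) auto
  then have u: "u \<in> unip (\<le>)" unfolding u_def using unip_mult u0 by simp
  have um: "u * P = (u0 * P) * m" using u0 m by (simp add: u_def algebra)
  also have "\<dots> = z * (Q * transpose_mat t)" unfolding e0 b2t m_def using z t y1 by (simp add: algebra)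
  finally have "u * P = z * (Q * transpose_mat t)" .
  moreover have "z \<in> supp (\<lambda>i j. i = j \<or> i > j \<and> wi i < wi j)"
    using unip_supp[OF z] by (rule supp_mono) auto
  ultimately have "twist_config u z t" using u t by (simp add: twist_config_def)
  moreover have "m \<in> supp (\<ge>)" using unip_supp[OF m] by (rule supp_mono) auto
  then have "X = Lcos (u * P)" unfolding um using u0 by (simp add: Lcos_mult)
  ultimately show ?thesis using that by blast
qed

text \<open>Transposing the defining equation writes \<open>transpose_mat (u * P) * Q\<close> as
  \<open>t\<close> times a lower triangular matrix. Its unipotent factor is therefore
  \<open>t\<close> without its diagonal, and \<open>P\<close> times that factor is already
  chiral.\<close>

lemma twist_config_twistR:
  assumes c: "twist_config u b t"
  shows "twistR n v w (Lcos (u * P)) = Lcos (P * t)"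
proof -
  have u: "u \<in> unip (\<le>)" and b: "b \<in> supp (\<lambda>i j. i = j \<or> i > j \<and> wi i < wi j)"
    and t: "t \<in> supp (\<lambda>i j. i \<le> j \<and> v i \<le> v j)" and eq: "u * P = b * (Q * transpose_mat t)"
    using c by (auto simp: twist_config_def)
  obtain y d where y: "y \<in> unip (\<lambda>i j. i \<le> j \<and> v i \<le> v j)" "d \<in> supp (=)" "t = y * d"
    by (rule supp_split_diag[OF _ _ t]) (auto simp: reflp_def)
  have d: "d \<in> supp (\<ge>)" using y(2) by (rule supp_mono) auto
  have yN: "y \<in> unip (\<le>)" using y(1) by (rule unip_mono) auto
  \<comment> \<open>The restriction of \<open>b\<close> to inversions is what makes this conjugate
    of its transpose lower triangular.\<close>
  define c where "c = transpose_mat Q * (transpose_mat b * Q)"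
  have "c \<in> supp (\<ge>)" unfolding c_def by (rule supp_conj'[OF Q supp_transpose[OF b]]) (auto simp: sperm_inj[OF Q])
  then have dc: "d * c \<in> supp (\<ge>)" using d lower_mult by blast
  have "transpose_mat (u * P) * Q = t * c" unfolding eq c_def using b t by (simp add: algebra)
  also have "\<dots> = y * (d * c)" using y d \<open>c \<in> supp (\<ge>)\<close> by (simp add: algebra)
  finally have fac: "transpose_mat (u * P) * Q = y * (d * c)" .
  have uPSL: "u * P \<in> carrier (SL n)" using u by simp
  have "b \<in> supp (\<ge>)" using b by (rule supp_mono) auto
  moreover have "transpose_mat t \<in> supp (\<ge>)" using supp_transpose[OF t] by (rule supp_mono) auto
  ultimately have uPB: "u * P \<in> BwB n w" unfolding eq BwB_iff by blast
  have "pretwistR n v w (Lcos (u * P)) = Rcos (P * y)"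
    unfolding pretwistR_def
  proof (rule the_equality)
    have "u * P \<in> Nplus n #>\<^bsub>SL n\<^esub> P" using u by (auto simp: r_coset_def Nplus_eq)
    then show "\<exists>g\<in>(Nplus n #>\<^bsub>SL n\<^esub> P) \<inter> BwB n w. Lcos (u * P) = Lcos g \<and>
        Rcos (P * y) = Rcos (P * factL n (transpose_mat g * Q))"
      using uPB factL_eq[OF yN dc] by (intro bexI[of _ "u * P"]) (auto simp only: fac)
  next
    \<comment> \<open>Independence of the representative: another one is \<open>u * P * m\<close>
      with \<open>m\<close> lower unitriangular. Its transpose multiplies the unipotent factor from
      the left, and conjugated by \<open>P\<close> this transpose is lower triangular, hence
      absorbed by the coset.\<close>
    fix Y
    assume "\<exists>g\<in>(Nplus n #>\<^bsub>SL n\<^esub> P) \<inter> BwB n w. Lcos (u * P) = Lcos g \<and>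
        Y = Rcos (P * factL n (transpose_mat g * Q))"
    then obtain g where g: "g \<in> Nplus n #>\<^bsub>SL n\<^esub> P" "g \<in> BwB n w" "Lcos (u * P) = Lcos g"
      "Y = Rcos (P * factL n (transpose_mat g * Q))" by auto
    then obtain u1 where u1: "u1 \<in> unip (\<le>)" "g = u1 * P" by (auto simp: r_coset_def Nplus_eq)
    obtain m where m: "m \<in> supp (\<ge>)" "g = u * P * m" using Lcos_eqD[OF g(3) BwB_SL[OF g(2)]] by auto
    have "P * (m * transpose_mat P) = adj_mat u * (u * P * m * transpose_mat P)" using u m(1) by (simp add: algebra)
    also have "u * P * m * transpose_mat P = u1 * P * transpose_mat P" using m(2) u1(2) by simp
    also have "\<dots> = u1" using u1(1) by (simp add: algebra)
    finally have W: "P * (m * transpose_mat P) \<in> unip (\<le>)" using unip_mult unip_inv u u1 by simp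
    have "m = transpose_mat P * ((P * (m * transpose_mat P)) * P)" using m by (simp add: algebra)
    moreover have "transpose_mat P * ((P * (m * transpose_mat P)) * P) \<in> unip (\<lambda>i j. v i \<le> v j)"
      by (rule unip_conj'[OF P W])
    ultimately have "m \<in> unip (\<ge>)" using m(1) by (auto simp: unip_def)
    then have mT: "transpose_mat m \<in> unip (\<le>)" using unip_transpose by blast
    have "transpose_mat g * Q = transpose_mat m * (transpose_mat (u * P) * Q)" using m u by (simp add: algebra)
    also have "\<dots> = transpose_mat m * y * (d * c)" unfolding fac using m y dc d \<open>c \<in> supp (\<ge>)\<close> by (simp add: algebra)
    finally have "factL n (transpose_mat g * Q) = transpose_mat m * y"
      using factL_eq[OF unip_mult[OF _ mT yN] dc] by simp
    then have "Y = Rcos (P * (transpose_mat m * y))" using g(4) by simp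
    also have "P * (transpose_mat m * y) = transpose_mat (P * (m * transpose_mat P)) * (P * y)"
      using m y by (simp add: algebra)
    also have "Rcos \<dots> = Rcos (P * y)"
      using unip_supp[OF unip_transpose[OF W]] y by (intro Rcos_mult) auto
    finally show "Y = Rcos (P * y)" .
  qed
  moreover have "chiral (P * y)"
  proof -
    have "P * y = (P * (y * transpose_mat P)) * P" using y by (simp add: algebra)
    moreover have "P * (y * transpose_mat P) \<in> unip (\<le>)" by (rule unip_conj[OF P y(1)]) auto
    \<comment> \<open>The transposed equation, read in the other direction, places the twisted point
      in the double coset of \<open>w\<close>.\<close>
    moreover have "P * y = transpose_mat u * (Q * adj_mat (d * c))"
    proof -
      have "P * (transpose_mat (u * P) * Q) = transpose_mat u * Q" using u by (simp add: algebra)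
      then have "transpose_mat u * Q * adj_mat (d * c) = P * (y * (d * c)) * adj_mat (d * c)" using fac by simp
      then show ?thesis using u y dc by (simp add: algebra)
    qed
    moreover have "transpose_mat u \<in> supp (\<ge>)" using supp_transpose[OF unip_supp[OF u]] by simp
    ultimately show ?thesis unfolding chiral_def BwB_iff using yN lower_inv[OF dc] by blast
  qed
  ultimately have "twistR n v w (Lcos (u * P)) = Lcos (P * y)" by (simp add: twistR_def chiR_eq)
  also have "\<dots> = Lcos (P * t)" using Lcos_mult[of "P * y" d] y d by (simp add: algebra)
  finally show ?thesis .
qed

text \<open>The configuration is built from its other end: the point is brought to the chiral form
  \<open>P * t\<close>, and \<open>u\<close> and \<open>b\<close> are read off by transposing a
  factorisation of \<open>P * t\<close> in the double coset of \<open>w\<close>.\<close>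

lemma richR_twist_config_left:
  assumes "X \<in> richR n v w"
  obtains u b t where "twist_config u b t" "X = Lcos (P * t)" "twistL n v w X = Lcos (u * P)"
proof -
  obtain u0 where u0: "u0 \<in> unip (\<le>)" "u0 * P \<in> BwB n w" "X = Lcos (u0 * P)"
    using richR_rep[OF assms] .
  have inj: "inj_on (\<lambda>i. int (vi i)) {..<n}"
    using permutes_inj[OF permutes_inv[OF sperm_perm[OF P]]] by (auto simp: inj_on_def inj_def)
  have u0s: "u0 \<in> supp (\<lambda>i j. i = j \<or> i < j)" using unip_supp[OF u0(1)] by (rule supp_mono) auto
  obtain u1 u2 where u1: "u1 \<in> unip (\<lambda>i j. i = j \<or> i < j \<and> int (vi i) > int (vi j))"
    and u2: "u2 \<in> supp (\<lambda>i j. (i = j \<or> i < j) \<and> int (vi i) \<le> int (vi j))" and u0': "u0 = u2 * u1"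
    by (rule supp_factor'[OF inj disjI1[OF refl] u0s])
  have u1i: "adj_mat u1 \<in> unip (\<lambda>i j. i = j \<or> i < j \<and> int (vi i) > int (vi j))"
    by (rule unip_inv[OF _ u1]) (auto simp: tri_def reflp_def transp_def)
  have "u2 = u0 * adj_mat u1" unfolding u0' using u1 u2 by (simp add: algebra)
  moreover have "adj_mat u1 \<in> unip (\<le>)" using u1i by (rule unip_mono) auto
  ultimately have u2N: "u2 \<in> unip (\<le>)" using unip_mult u0 by simp
  have "u2 \<in> supp (\<lambda>i j. i \<le> j \<and> vi i \<le> vi j)" using u2 by (rule supp_mono) auto
  then have u2': "u2 \<in> unip (\<lambda>i j. i \<le> j \<and> vi i \<le> vi j)" using u2N by (simp add: unip_def)
  define l where "l = transpose_mat P * (adj_mat u1 * P)"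
  have l: "l \<in> supp (\<ge>)" unfolding l_def by (rule supp_conj'[OF P unip_supp[OF u1i]]) (auto simp: sperm_inj[OF P])
  have ul: "u2 * P = u0 * P * l" using u1 u2 by (simp add: l_def u0' algebra)
  then have g2: "u2 * P \<in> BwB n w" "X = Lcos (u2 * P)"
    using BwB_mult(1)[OF u0(2) l] u0 Lcos_mult[of "u0 * P" l] l by auto
  define t where "t = transpose_mat P * (u2 * P)"
  have t: "t \<in> unip (\<lambda>i j. i \<le> j \<and> v i \<le> v j)" unfolding t_def by (rule unip_conj'[OF P u2']) auto
  have tN: "t \<in> unip (\<le>)" using t by (rule unip_mono) auto
  have ut: "u2 * P = P * t" using u2 by (simp add: t_def)
  have ch: "chiral (P * t)"
  proof -
    have "\<exists>u\<in>unip (\<le>). P * t = u * P" using u2N ut by metis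
    moreover have "P * t \<in> BwB n w" using g2 ut by simp
    ultimately show ?thesis unfolding chiral_def using tN by blast
  qed
  have X: "X = Lcos (P * t)" using g2 ut by simp
  obtain a \<beta> where ab: "a \<in> supp (\<ge>)" "\<beta> \<in> supp (\<ge>)" "P * t = a * (Q * \<beta>)"
    using g2(1) ut BwB_iff by auto
  have inj2: "inj_on (\<lambda>i. - int (w i)) {..<n}" using sperm_inj[OF Q] by (auto simp: inj_on_def)
  have \<beta>s: "\<beta> \<in> supp (\<lambda>i j. i = j \<or> i > j)" using ab(2) by (rule supp_mono) auto
  obtain \<beta>1 \<beta>2 where \<beta>1: "\<beta>1 \<in> unip (\<lambda>i j. i = j \<or> i > j \<and> - int (w i) > - int (w j))"
    and \<beta>2: "\<beta>2 \<in> supp (\<lambda>i j. (i = j \<or> i > j) \<and> - int (w i) \<le> - int (w j))" and \<beta>: "\<beta> = \<beta>2 * \<beta>1"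
    by (rule supp_factor'[OF inj2 disjI2[OF refl] \<beta>s])
  have "Q * (\<beta>2 * transpose_mat Q) \<in> supp (\<ge>)" by (rule supp_conj[OF Q \<beta>2]) auto
  then have "a * (Q * (\<beta>2 * transpose_mat Q)) \<in> supp (\<ge>)" using ab lower_mult by blast
  then obtain l2 d where l2: "l2 \<in> unip (\<ge>)" "d \<in> supp (=)" "a * (Q * (\<beta>2 * transpose_mat Q)) = l2 * d"
    by (rule supp_split_diag[rotated 2]) (auto simp: reflp_def)
  let ?R = "\<lambda>i j. i = j \<or> i > j \<and> w i < w j"
  \<comment> \<open>The diagonal factor \<open>d\<close> is carried across \<open>Q\<close>, so that
    \<open>l2\<close> is unitriangular and its transpose can serve as \<open>u\<close>.\<close>
  define \<gamma> where "\<gamma> = transpose_mat Q * (d * Q) * \<beta>1"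
  have "transpose_mat Q * (d * Q) \<in> supp ?R" by (rule supp_conj'[OF Q l2(2)]) (auto simp: sperm_inj[OF Q])
  moreover have "\<beta>1 \<in> supp ?R" using unip_supp[OF \<beta>1] by (rule supp_mono) auto
  ultimately have \<gamma>: "\<gamma> \<in> supp ?R" unfolding \<gamma>_def
    by (rule supp_mult[rotated]) (auto simp: transp_def)
  have "a * (Q * \<beta>) = a * (Q * (\<beta>2 * transpose_mat Q)) * (Q * \<beta>1)"
    using ab(1) \<beta>1 \<beta>2 by (simp add: \<beta> algebra)
  also have "\<dots> = l2 * (Q * \<gamma>)" unfolding l2(3) using l2 \<beta>1 by (simp add: \<gamma>_def algebra)
  finally have Pt: "P * t = l2 * (Q * \<gamma>)" using ab(3) by simp
  define u where "u = transpose_mat l2"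
  have u: "u \<in> unip (\<le>)" using unip_transpose[OF l2(1)] by (simp add: u_def)
  have \<gamma>T: "transpose_mat \<gamma> \<in> supp (\<lambda>i j. i = j \<or> j > i \<and> w j < w i)"
    using supp_transpose[OF \<gamma>] by (rule supp_mono) auto
  \<comment> \<open>The matrix obtained by transposing \<open>P * t = l2 * (Q * \<gamma>)\<close>
    and solving for \<open>u * P\<close>.\<close>
  define b where "b = Q * (adj_mat (transpose_mat \<gamma>) * transpose_mat Q)"
  have "adj_mat (transpose_mat \<gamma>) \<in> supp (\<lambda>i j. i = j \<or> j > i \<and> w j < w i)"
    by (rule supp_inv[OF _ \<gamma>T]) (auto simp: tri_def reflp_def transp_def)
  then have b: "b \<in> supp (\<lambda>i j. i = j \<or> i > j \<and> wi i < wi j)"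
    unfolding b_def by (rule supp_conj[OF Q]) auto
  have tr: "transpose_mat (P * t) = transpose_mat \<gamma> * (transpose_mat Q * u)"
    unfolding Pt u_def using l2 \<gamma> by (simp add: algebra)
  have "transpose_mat t = transpose_mat (P * t) * P" using t by (simp add: algebra)
  then have "b * (Q * transpose_mat t) = u * P"
    unfolding tr b_def using u \<gamma> by (simp add: algebra)
  then have twist_config: "twist_config u b t" using u b unip_supp[OF t] by (simp add: twist_config_def)
  \<comment> \<open>Lower triangular, so \<open>u\<close> is the unipotent factor occurring in the
    left pre-twist.\<close>
  define k where "k = Q * (transpose_mat \<gamma> * transpose_mat Q)"
  have k: "k \<in> supp (\<ge>)" unfolding k_def by (rule supp_conj[OF Q \<gamma>T]) auto
  have fac: "Q * transpose_mat (P * t) = k * u" unfolding tr k_def using \<gamma> u by (simp add: algebra)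
  have "pretwistL n v w (Rcos (P * t)) = Lcos (u * P)"
    unfolding pretwistL_def
  proof (rule the_equality)
    have "P * t \<in> P <#\<^bsub>SL n\<^esub> Nplus n" using tN by (auto simp: l_coset_def Nplus_eq)
    then show "\<exists>h\<in>(P <#\<^bsub>SL n\<^esub> Nplus n) \<inter> BwB n w. Rcos (P * t) = Rcos h \<and>
        Lcos (u * P) = Lcos (factR n (Q * transpose_mat h) * P)"
      using ch factR_eq[OF u k] by (intro bexI[of _ "P * t"]) (auto simp only: fac chiral_def Int_iff)
  next
    fix Y
    assume "\<exists>h\<in>(P <#\<^bsub>SL n\<^esub> Nplus n) \<inter> BwB n w. Rcos (P * t) = Rcos h \<and>
        Y = Lcos (factR n (Q * transpose_mat h) * P)"
    then obtain h where h: "h \<in> P <#\<^bsub>SL n\<^esub> Nplus n" "h \<in> BwB n w" "Rcos (P * t) = Rcos h"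
      "Y = Lcos (factR n (Q * transpose_mat h) * P)" by auto
    then obtain y1 where y1: "y1 \<in> unip (\<le>)" "h = P * y1" by (auto simp: l_coset_def Nplus_eq)
    obtain m where m: "m \<in> supp (\<ge>)" "h = m * (P * t)" using Rcos_eqD[OF h(3) BwB_SL[OF h(2)]] by auto
    have "transpose_mat P * (m * P) = transpose_mat P * (m * (P * t)) * adj_mat t" using t m by (simp add: algebra)
    also have "m * (P * t) = P * y1" using m(2) y1(2) by simp
    also have "transpose_mat P * (P * y1) * adj_mat t = y1 * adj_mat t" using y1(1) by simp
    finally have W: "transpose_mat P * (m * P) \<in> unip (\<le>)" using unip_mult unip_inv tN y1 by simp
    have "m = P * ((transpose_mat P * (m * P)) * transpose_mat P)" using m by (simp add: algebra)
    moreover have "P * ((transpose_mat P * (m * P)) * transpose_mat P) \<in> unip (\<lambda>i j. vi i \<le> vi j)"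
      by (rule unip_conj[OF P W]) simp
    ultimately have "m \<in> unip (\<ge>)" using m(1) by (auto simp: unip_def)
    then have mT: "transpose_mat m \<in> unip (\<le>)" using unip_transpose by blast
    have "Q * transpose_mat h = Q * transpose_mat (P * t) * transpose_mat m" using m t by (simp add: algebra)
    also have "\<dots> = k * (u * transpose_mat m)" unfolding fac using m u k by (simp add: algebra)
    finally have "factR n (Q * transpose_mat h) = u * transpose_mat m"
      using factR_eq[OF unip_mult[OF _ u mT] k] by simp
    then have "Y = Lcos (u * transpose_mat m * P)" using h(4) by simp
    also have "u * transpose_mat m * P = (u * P) * transpose_mat (transpose_mat P * (m * P))"
      using m u by (simp add: algebra)
    also have "Lcos \<dots> = Lcos (u * P)"
      using unip_supp[OF unip_transpose[OF W]] u by (intro Lcos_mult) auto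
    finally show "Y = Lcos (u * P)" .
  qed
  then have "twistL n v w X = Lcos (u * P)" unfolding X by (simp add: twistL_def chiL_eq[OF ch])
  then show ?thesis using that twist_config X by blast
qed

end

section \<open>Orthogonality relations\<close>

lemma sum_nz:
  fixes g :: "'a \<Rightarrow> 'b::comm_monoid_add"
  assumes "(\<Sum>l\<in>S. g l) \<noteq> 0"
  obtains l where "l \<in> S" "g l \<noteq> 0"
  using assms by (rule sum.not_neutral_contains_not_neutral)

text \<open>
  The arrays \<open>B\<close> and \<open>C\<close> are the matrices of a point and of its right twist, \<open>U = B C\<^sup>T\<close> and
  \<open>D = U\<^sup>-\<^sup>1\<close>, so that \<open>D B\<close> is the inverse of \<open>C\<^sup>T\<close> and \<open>C\<^sup>T D\<close> the inverse of \<open>B\<close>.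
\<close>

locale twisted_pair =
  fixes n k :: nat and v w :: "nat \<Rightarrow> nat" and B C U D BI CI :: "nat \<Rightarrow> nat \<Rightarrow> complex"
  assumes kn: "k \<le> n"
    and vb: "\<And>a. a < n \<Longrightarrow> v a < n" and wb: "\<And>a. a < n \<Longrightarrow> w a < n"
    and vs: "\<And>i. i < n \<Longrightarrow> \<exists>a<n. i = v a"
    and vinj: "\<And>a b. v a = v b \<Longrightarrow> a = b" and winj: "\<And>a b. w a = w b \<Longrightarrow> a = b"
    and w1: "\<And>a b. a < b \<Longrightarrow> b < k \<Longrightarrow> w a < w b"
    and w2: "\<And>a b. k \<le> a \<Longrightarrow> a < b \<Longrightarrow> b < n \<Longrightarrow> w a < w b"
    and U: "\<And>i j. i < n \<Longrightarrow> j < n \<Longrightarrow> U i j = (\<Sum>c<n. B i c * C j c)"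
    and Ulow: "\<And>i j. i < n \<Longrightarrow> j < i \<Longrightarrow> U i j = 0" and Udiag: "\<And>i. i < n \<Longrightarrow> U i i = 1"
    and Dlow: "\<And>i j. i < n \<Longrightarrow> j < i \<Longrightarrow> D i j = 0"
    and Bnz: "\<And>c. c < n \<Longrightarrow> B (w c) c \<noteq> 0"
    and B1: "\<And>i c. i < n \<Longrightarrow> c < k \<Longrightarrow> B i c \<noteq> 0 \<Longrightarrow> i = w c"
    and B2: "\<And>i c. i < n \<Longrightarrow> c < n \<Longrightarrow> B i c \<noteq> 0 \<Longrightarrow> w c \<le> i"
    and B3: "\<And>a c. k \<le> a \<Longrightarrow> a < n \<Longrightarrow> c < n \<Longrightarrow> a \<noteq> c \<Longrightarrow> B (w a) c = 0"
    and Cnz: "\<And>c. c < n \<Longrightarrow> C (v c) c \<noteq> 0"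
    and C1: "\<And>a c. a < n \<Longrightarrow> c < n \<Longrightarrow> C (v a) c \<noteq> 0 \<Longrightarrow> a \<le> c \<and> v a \<le> v c"
    and BI: "\<And>c l. c < n \<Longrightarrow> l < n \<Longrightarrow> BI c l = (\<Sum>i<n. C i c * D i l)"
    and BInz: "\<And>c. c < n \<Longrightarrow> BI c (w c) \<noteq> 0"
    and BI1: "\<And>c l. c < k \<Longrightarrow> l < n \<Longrightarrow> BI c l \<noteq> 0 \<Longrightarrow> l \<le> w c"
    and BI2: "\<And>a c. k \<le> c \<Longrightarrow> c < n \<Longrightarrow> a < n \<Longrightarrow> a \<noteq> c \<Longrightarrow> BI c (w a) = 0"
    and CI: "\<And>i c. i < n \<Longrightarrow> c < n \<Longrightarrow> CI i c = (\<Sum>l<n. D i l * B l c)"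
    and CInz: "\<And>c. c < n \<Longrightarrow> CI (v c) c \<noteq> 0"
    and CI1: "\<And>a c. a < n \<Longrightarrow> c < n \<Longrightarrow> CI (v a) c \<noteq> 0 \<Longrightarrow> c \<le> a \<and> v c \<le> v a"
    and CCI: "\<And>a c. a < n \<Longrightarrow> c < n \<Longrightarrow> (\<Sum>l<n. CI l a * C l c) = (if a = c then 1 else 0)"
    and DU: "\<And>i c. i < n \<Longrightarrow> c < n \<Longrightarrow> D i c = (\<Sum>l<n. CI i l * BI l c)"
begin

lemma w1': "a \<le> b \<Longrightarrow> b < k \<Longrightarrow> w a \<le> w b"
  using w1[of a b] by (cases "a = b") auto

lemma w2': "k \<le> a \<Longrightarrow> a \<le> b \<Longrightarrow> b < n \<Longrightarrow> w a \<le> w b"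
  using w2[of a b] by (cases "a = b") auto

lemma U_split:
  assumes "i < n" "j < n"
  shows "(\<Sum>c=k..<n. B i c * C j c) = U i j - (\<Sum>c<k. B i c * C j c)"
proof -
  have "{..<n} = {..<k} \<union> {k..<n}" using kn by auto
  then have "(\<Sum>c<n. B i c * C j c) = (\<Sum>c<k. B i c * C j c) + (\<Sum>c=k..<n. B i c * C j c)"
    by (simp add: sum.union_disjoint ivl_disj_int)
  then show ?thesis using U[OF assms] by simp
qed

text \<open>A linear relation among the rows of the last \<open>n - k\<close> columns, with
  coefficients \<open>x\<close>, persists after pairing every row with \<open>z\<close>.\<close>

lemma pair_swap:
  fixes x z :: "nat \<Rightarrow> complex" and M :: "nat \<Rightarrow> nat \<Rightarrow> complex"
  assumes "\<And>c. k \<le> c \<Longrightarrow> c < n \<Longrightarrow> (\<Sum>l<n. x l * M l c) = 0"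
  shows "(\<Sum>l<n. x l * (\<Sum>c=k..<n. z c * M l c)) = 0"
proof -
  have "(\<Sum>l<n. x l * (\<Sum>c=k..<n. z c * M l c)) = (\<Sum>c=k..<n. \<Sum>l<n. z c * (x l * M l c))"
    by (subst sum.swap) (simp add: sum_distrib_left algebra_simps)
  also have "\<dots> = 0" using assms by (intro sum.neutral) (simp flip: sum_distrib_left)
  finally show ?thesis .
qed

lemma sum_single:
  fixes x y :: "nat \<Rightarrow> complex"
  assumes "j < n" "\<And>l. l < n \<Longrightarrow> l \<noteq> j \<Longrightarrow> x l = 0 \<or> y l = 0"
  shows "(\<Sum>l<n. x l * y l) = x j * y j"
proof -
  have "(\<Sum>l\<in>{..<n} - {j}. x l * y l) = 0" using assms by (intro sum.neutral) auto
  then show ?thesis using assms by (subst sum.remove[of _ j]) auto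
qed

text \<open>\<open>U\<close> prescribes the product over all columns, so the first \<open>k\<close>
  must contribute nothing. A nonzero term there forces \<open>j = w c\<close>, and a truncation of
  row \<open>c\<close> of \<open>BI\<close> is then a relation among rows \<open>i\<close> to
  \<open>j\<close> with nonzero coefficient at \<open>j\<close>. Pairing with \<open>z\<close>
  refutes it.\<close>

lemma right_near:
  assumes ij: "i \<le> j" "j < n"
    and z0: "\<And>l. i \<le> l \<Longrightarrow> l < j \<Longrightarrow> (\<Sum>c=k..<n. z c * B l c) = 0"
    and zj: "(\<Sum>c=k..<n. z c * B j c) \<noteq> 0"
  shows "(\<Sum>c=k..<n. B j c * C i c) = (if i = j then 1 else 0)"
proof -
  have "(\<Sum>c<k. B j c * C i c) = 0"
  proof (rule ccontr)
    assume "(\<Sum>c<k. B j c * C i c) \<noteq> 0"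
    then obtain c where c: "c < k" "B j c \<noteq> 0" "C i c \<noteq> 0" by (auto elim!: sum_nz)
    then have cn: "c < n" using kn by simp
    have j: "j = w c" using B1 c ij by simp
    obtain a where a: "a < n" "i = v a" using vs[of i] ij by auto
    then have ac: "a \<le> c" "v a \<le> v c" using C1[of a c] c cn by auto
    \<comment> \<open>Row \<open>c\<close> of \<open>BI\<close> with the summands of index below
      \<open>i\<close> removed. This confines its support to positions from \<open>i\<close> on,
      while the entries at \<open>j\<close> and beyond are unchanged because the removed summands
      vanish there.\<close>
    define x where "x l = (\<Sum>i'=i..<n. C i' c * D i' l)" for l
    have xlow: "x l = 0" if "l < i" for l
      unfolding x_def using that Dlow by (intro sum.neutral) auto
    have xhigh: "x l = BI c l" if l: "j \<le> l" "l < n" for l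
    proof -
      have z: "C i' c * D i' l = 0" if "i' < i" for i'
      proof (rule ccontr)
        assume nz: "C i' c * D i' l \<noteq> 0"
        have i'n: "i' < n" using that ij by simp
        obtain a' where a': "a' < n" "i' = v a'" using vs[OF i'n] by auto
        have "a' \<le> c" using C1[of a' c] a' cn nz by auto
        moreover have "a' \<noteq> c" using that a a' ac by auto
        ultimately have "a' < c" by simp
        have "(\<Sum>m<n. CI i' m * BI m l) \<noteq> 0" using DU[of i' l] nz i'n l by auto
        then obtain m where m: "m < n" "CI i' m \<noteq> 0" "BI m l \<noteq> 0" by (auto elim!: sum_nz)
        have "m \<le> a'" using CI1[of a' m] a' m by auto
        then have "m < c" using \<open>a' < c\<close> by simp
        then have "l \<le> w m" "w m < w c" using BI1[of m l] m l c w1 by auto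
        then show False using l j by simp
      qed
      have "{..<n} = {..<i} \<union> {i..<n}" using ij by auto
      then have "BI c l = (\<Sum>i'<i. C i' c * D i' l) + x l"
        using BI[OF cn l(2)] by (simp add: sum.union_disjoint ivl_disj_int x_def)
      then show ?thesis using z by simp
    qed
    \<comment> \<open>After truncation each summand must vanish by itself: \<open>C\<close> requires
      \<open>a' <= c\<close> and \<open>CI\<close> requires \<open>c' <= a'\<close>, against
      \<open>c < k <= c'\<close>.\<close>
    have xM: "(\<Sum>l<n. x l * B l c') = 0" if c': "k \<le> c'" "c' < n" for c'
    proof -
      have "(\<Sum>l<n. x l * B l c') = (\<Sum>i'=i..<n. \<Sum>l<n. C i' c * (D i' l * B l c'))"
        unfolding x_def by (subst sum.swap) (simp add: sum_distrib_right mult.assoc)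
      also have "\<dots> = (\<Sum>i'=i..<n. C i' c * CI i' c')"
        using c' by (intro sum.cong) (auto simp: CI sum_distrib_left)
      also have "\<dots> = 0"
      proof (rule sum.neutral, rule ballI, rule ccontr)
        fix i' assume i': "i' \<in> {i..<n}" and nz: "C i' c * CI i' c' \<noteq> 0"
        obtain a' where a': "a' < n" "i' = v a'" using vs[of i'] i' by auto
        have "a' \<le> c" "c' \<le> a'" using C1[of a' c] CI1[of a' c'] a' c' cn nz by auto
        then show False using c c' by simp
      qed
      finally show ?thesis .
    qed
    have "(\<Sum>l<n. x l * (\<Sum>c=k..<n. z c * B l c)) = x j * (\<Sum>c=k..<n. z c * B j c)"
    proof (rule sum_single)
      fix l assume l: "l < n" "l \<noteq> j"
      consider "l < i" | "i \<le> l" "l < j" | "j < l" using l by linarith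
      then show "x l = 0 \<or> (\<Sum>c=k..<n. z c * B l c) = 0"
      proof cases
        case 3
        then show ?thesis using xhigh[of l] l BI1[of c l] c j by force
      qed (use xlow z0 in auto)
    qed (use ij in auto)
    moreover have "x j \<noteq> 0" using xhigh[of j] ij j BInz[OF cn] by simp
    ultimately show False using pair_swap[OF xM] zj by simp
  qed
  then show ?thesis using U_split[of j i] ij Ulow[of j i] Udiag[of j] by (cases "i = j") auto
qed

text \<open>A nonzero value forces \<open>j\<close> to be a pivot row \<open>w b\<close>, with
  \<open>i <= v b\<close>. Row \<open>v b\<close> of \<open>D\<close> then meets only rows on which
  \<open>z\<close> vanishes, although the resulting sum is \<open>z b * CI (v b) b\<close>, which is
  nonzero.\<close>

lemma right_far:
  assumes ij: "j < i" "i < n"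
    and z0: "\<And>l. l < j \<Longrightarrow> (\<Sum>c=k..<n. z c * B l c) = 0"
      "\<And>l. i \<le> l \<Longrightarrow> l < n \<Longrightarrow> (\<Sum>c=k..<n. z c * B l c) = 0"
    and zj: "(\<Sum>c=k..<n. z c * B j c) \<noteq> 0"
  shows "(\<Sum>c=k..<n. B j c * C i c) = 0"
proof (rule ccontr)
  assume nz: "(\<Sum>c=k..<n. B j c * C i c) \<noteq> 0"
  \<comment> \<open>Rows \<open>w b\<close> with \<open>b >= k\<close> are pivots, so pairing with
    \<open>z\<close> there reads off a single coordinate of \<open>z\<close>.\<close>
  have Zw: "(\<Sum>c=k..<n. z c * B (w b) c) = z b * B (w b) b" if "k \<le> b" "b < n" for b
    using that B3 by (subst sum.remove[of _ b]) (auto intro!: sum.neutral)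
  have zw: "j \<le> w b" if "k \<le> b" "b < n" "z b \<noteq> 0" for b
    using Zw[of b] z0(1)[of "w b"] that Bnz[of b] by force
  obtain b where b: "k \<le> b" "b < n" "z b \<noteq> 0" "B j b \<noteq> 0" using zj by (auto elim!: sum_nz)
  then have j: "j = w b" using B2[of j b] zw[of b] ij by simp
  have "C i b \<noteq> 0"
  proof -
    obtain c where c: "k \<le> c" "c < n" "B j c \<noteq> 0" "C i c \<noteq> 0" using nz by (auto elim!: sum_nz)
    then have "c = b" using B3[of b c] b j by auto
    then show ?thesis using c by simp
  qed
  obtain a where "a < n" "i = v a" using vs ij by auto
  then have ib: "i \<le> v b" using C1[of a b] b \<open>C i b \<noteq> 0\<close> by auto
  have "(\<Sum>l<n. D (v b) l * (\<Sum>c=k..<n. z c * B l c)) = 0"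
  proof (rule sum.neutral, rule ballI)
    fix l assume "l \<in> {..<n}"
    then show "D (v b) l * (\<Sum>c=k..<n. z c * B l c) = 0"
      using Dlow[of "v b" l] z0(2)[of l] ib vb[OF b(2)] by (cases "l < v b") auto
  qed
  moreover have "(\<Sum>l<n. D (v b) l * (\<Sum>c=k..<n. z c * B l c)) = (\<Sum>c=k..<n. z c * CI (v b) c)"
    using vb[OF b(2)]
    by (simp add: sum_distrib_left CI) (subst sum.swap, simp add: algebra_simps)
  moreover have "(\<Sum>c=k..<n. z c * CI (v b) c) = z b * CI (v b) b"
  proof -
    have "z c * CI (v b) c = 0" if c: "c \<in> {k..<n} - {b}" for c
    proof (rule ccontr)
      assume nz: "z c * CI (v b) c \<noteq> 0"
      then have "c < b" using CI1[of b c] b c by force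
      then have "w c < w b" using w2 c b by auto
      then show False using zw[of c] nz c j by auto
    qed
    then have "(\<Sum>c\<in>{k..<n} - {b}. z c * CI (v b) c) = 0" by (rule sum.neutral[OF ballI])
    then show ?thesis using b by (subst sum.remove[of _ b]) simp_all
  qed
  ultimately show False using CInz b by auto
qed

text \<open>The relation among the rows of \<open>C\<close> is column \<open>a\<close> of
  \<open>CI\<close>, where \<open>j = v a\<close>. It needs no truncation: the shape of
  \<open>CI\<close> starts it at \<open>j\<close>, and the formula for \<open>CI\<close> through
  \<open>D\<close> and \<open>B\<close> ends it at \<open>w a\<close>, which is at most
  \<open>i\<close>.\<close>

lemma left_near:
  assumes ij: "j \<le> i" "i < n"
    and z0: "\<And>l. j < l \<Longrightarrow> l \<le> i \<Longrightarrow> (\<Sum>c=k..<n. z c * C l c) = 0"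
    and zj: "(\<Sum>c=k..<n. z c * C j c) \<noteq> 0"
  shows "(\<Sum>c=k..<n. B i c * C j c) = (if i = j then 1 else 0)"
proof -
  have "(\<Sum>c<k. B i c * C j c) = 0"
  proof (rule ccontr)
    assume "(\<Sum>c<k. B i c * C j c) \<noteq> 0"
    then obtain c where c: "c < k" "B i c \<noteq> 0" "C j c \<noteq> 0" by (auto elim!: sum_nz)
    then have cn: "c < n" using kn by simp
    have i: "i = w c" using B1 c ij by simp
    obtain a where a: "a < n" "j = v a" using vs[of j] ij by auto
    then have ac: "a \<le> c" using C1[of a c] c cn by auto
    then have ak: "a < k" "w a \<le> w c" using c w1' by auto
    have xlow: "j \<le> l" if "l < n" "CI l a \<noteq> 0" for l
      using vs[OF that(1)] that CI1[of _ a] a by auto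
    have xhigh: "l \<le> i" if l: "l < n" "CI l a \<noteq> 0" for l
    proof -
      have "(\<Sum>m<n. D l m * B m a) \<noteq> 0" using CI[of l a] l a by simp
      then obtain m where m: "m < n" "D l m \<noteq> 0" "B m a \<noteq> 0" by (auto elim!: sum_nz)
      then have "m = w a" "l \<le> m" using B1[of m a] ak Dlow[of l m] l by (auto simp: not_less[symmetric])
      then show ?thesis using ak i by simp
    qed
    have "(\<Sum>l<n. CI l a * (\<Sum>c=k..<n. z c * C l c)) = CI j a * (\<Sum>c=k..<n. z c * C j c)"
    proof (rule sum_single)
      fix l assume l: "l < n" "l \<noteq> j"
      then show "CI l a = 0 \<or> (\<Sum>c=k..<n. z c * C l c) = 0"
        using xlow[of l] xhigh[of l] z0[of l] by fastforce
    qed (use ij in auto)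
    moreover have "(\<Sum>l<n. CI l a * (\<Sum>c=k..<n. z c * C l c)) = 0"
      using CCI a ak by (intro pair_swap) auto
    ultimately show False using CInz a zj by auto
  qed
  then show ?thesis using U_split[of i j] ij Ulow[of i j] Udiag[of i] by (cases "i = j") auto
qed

text \<open>The witness is column \<open>w a\<close> of \<open>D\<close>, where
  \<open>j = v a\<close>. It vanishes after row \<open>w a\<close>, and \<open>z\<close> vanishes on
  the rows up to \<open>i\<close>, hence up to \<open>w a\<close>; yet the sum equals the nonzero
  \<open>z a * BI a (w a)\<close>.\<close>

lemma left_far:
  assumes ij: "i < j" "j < n"
    and z0: "\<And>l. l \<le> i \<Longrightarrow> (\<Sum>c=k..<n. z c * C l c) = 0"
      "\<And>l. j < l \<Longrightarrow> l < n \<Longrightarrow> (\<Sum>c=k..<n. z c * C l c) = 0"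
    and zj: "(\<Sum>c=k..<n. z c * C j c) \<noteq> 0"
  shows "(\<Sum>c=k..<n. B i c * C j c) = 0"
proof (rule ccontr)
  assume nz: "(\<Sum>c=k..<n. B i c * C j c) \<noteq> 0"
  define S where "S = {c \<in> {k..<n}. z c \<noteq> 0}"
  \<comment> \<open>For \<open>m\<close> in the support of \<open>z\<close> with \<open>v m\<close>
    maximal, row \<open>v m\<close> pairs with \<open>z\<close> through the single term of
    \<open>m\<close>. The value is nonzero, so this row cannot lie beyond \<open>j\<close>.\<close>
  have Sv: "v c \<le> j" if "c \<in> S" for c
  proof -
    have fS: "finite S" "S \<noteq> {}" using that by (auto simp: S_def)
    have "Max (v ` S) \<in> v ` S" using fS by simp
    then obtain m where m: "m \<in> S" "v m = Max (v ` S)" by auto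
    have max: "v c' \<le> v m" if "c' \<in> S" for c' using that m fS by simp
    have "z c' * C (v m) c' = 0" if c': "c' \<in> {k..<n} - {m}" for c'
    proof (rule ccontr)
      assume nz: "z c' * C (v m) c' \<noteq> 0"
      then have "c' \<in> S" using c' by (auto simp: S_def)
      then have "v c' \<le> v m" by (rule max)
      moreover have "v m \<le> v c'" using C1[of m c'] nz m(1) c' by (simp add: S_def)
      ultimately have "v c' = v m" by simp
      then show False using vinj c' by auto
    qed
    then have "(\<Sum>c\<in>{k..<n} - {m}. z c * C (v m) c) = 0" by (rule sum.neutral[OF ballI])
    then have "(\<Sum>c=k..<n. z c * C (v m) c) = z m * C (v m) m"
      using m(1) by (subst sum.remove[of _ m]) (simp_all add: S_def)
    then have "(\<Sum>c=k..<n. z c * C (v m) c) \<noteq> 0" using m(1) Cnz[of m] by (auto simp: S_def)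
    then have "v m \<le> j" using z0(2)[of "v m"] vb[of m] m(1) by (force simp: S_def)
    then show ?thesis using max[OF that] by simp
  qed
  obtain c where c: "c \<in> S" "C j c \<noteq> 0" using zj by (auto elim!: sum_nz simp: S_def)
  obtain a where a: "a < n" "j = v a" using vs ij by auto
  have "v a = v c" using C1[of a c] Sv[of c] a c by (auto simp: S_def)
  then have ac: "a = c" using vinj by simp
  then have aS: "k \<le> a" "z a \<noteq> 0" using c by (auto simp: S_def)
  obtain b where b: "k \<le> b" "b < n" "B i b \<noteq> 0" "C j b \<noteq> 0" using nz by (auto elim!: sum_nz)
  then have "a \<le> b" "w b \<le> i" using C1[of a b] B2[of i b] a ij by auto
  then have wa: "w a \<le> i" using w2'[of a b] aS b by simp
  have "(\<Sum>l<n. D l (w a) * (\<Sum>c=k..<n. z c * C l c)) = 0"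
  proof (rule sum.neutral, rule ballI)
    fix l assume "l \<in> {..<n}"
    then show "D l (w a) * (\<Sum>c=k..<n. z c * C l c) = 0"
      using Dlow[of l "w a"] z0(1)[of l] wa by (cases "w a < l") auto
  qed
  moreover have "(\<Sum>l<n. D l (w a) * (\<Sum>c=k..<n. z c * C l c)) = (\<Sum>c=k..<n. z c * BI c (w a))"
    using wb[OF a(1)]
    by (simp add: sum_distrib_left BI) (subst sum.swap, simp add: algebra_simps)
  moreover have "(\<Sum>c=k..<n. z c * BI c (w a)) = z a * BI a (w a)"
    using aS a BI2 by (subst sum.remove[of _ a]) auto
  ultimately show False using BInz a aS by auto
qed

end

section \<open>Spans and the Muller--Speyer twists\<close>

lemma vspan_cols:
  assumes "M \<in> carrier_mat n d"
  shows "vspan n (set (cols M)) = {M *\<^sub>v x | x. x \<in> carrier_vec d}"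
proof -
  interpret V: vec_space "TYPE(complex)" n .
  show ?thesis using V.col_space_eq[OF assms] assms unfolding V.col_space_def by auto
qed

lemma vspan_annihilate:
  assumes "finite S" "S \<subseteq> carrier_vec d" "x \<in> vspan d S" "z \<in> carrier_vec d"
    and z: "\<And>s. s \<in> S \<Longrightarrow> z \<bullet> s = 0"
  shows "z \<bullet> x = 0"
proof -
  obtain ss where ss: "set ss = S" using finite_list[OF assms(1)] by auto
  define M where "M = mat_of_cols d ss"
  have M: "M \<in> carrier_mat d (length ss)" by (simp add: M_def)
  have "cols M = ss" using ss assms(2) by (simp add: M_def)
  then obtain y where y: "y \<in> carrier_vec (length ss)" "x = M *\<^sub>v y"
    using assms(3) ss vspan_cols[OF M] by auto
  have "transpose_mat M *\<^sub>v z = 0\<^sub>v (length ss)"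
  proof (rule eq_vecI)
    fix i assume i: "i < dim_vec (0\<^sub>v (length ss) :: complex vec)"
    then have "ss ! i \<in> S" using ss by auto
    then have "ss ! i \<bullet> z = 0" using z[of "ss ! i"] assms(2,4) by (auto simp: comm_scalar_prod[of _ d])
    moreover have "col M i = ss ! i" using \<open>ss ! i \<in> S\<close> i assms(2) by (simp add: M_def col_mat_of_cols subset_iff)
    ultimately show "(transpose_mat M *\<^sub>v z) $ i = 0\<^sub>v (length ss) $ i" using i M by simp
  qed (use M in auto)
  then show ?thesis using transpose_vec_mult_scalar[OF M y(1) assms(4)] y by simp
qed

text \<open>The pairing is bilinear, so isotropic vectors rule out orthogonal projection. If the new
  vector \<open>s\<close> is independent of \<open>S\<close>, a vector \<open>t\<close> dual to it
  corrects both sides: a multiple of \<open>s\<close> is subtracted from \<open>x\<close>, and a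
  multiple of \<open>t\<close> from the vector separating the result.\<close>

lemma vspan_separate:
  assumes "finite S" "S \<subseteq> carrier_vec d" "x \<in> carrier_vec d" "x \<notin> vspan d S"
  shows "\<exists>z\<in>carrier_vec d. (\<forall>s\<in>S. z \<bullet> s = 0) \<and> z \<bullet> x = 1"
  using assms
proof (induction S arbitrary: x rule: finite_induct)
  case empty
  interpret V: vec_space "TYPE(complex)" d .
  have "x \<noteq> 0\<^sub>v d" using empty V.span_zero[of "{}"] by auto
  then obtain i where i: "i < d" "x $ i \<noteq> 0" using empty(2) by (auto simp: vec_eq_iff)
  have "((1 / x $ i) \<cdot>\<^sub>v unit_vec d i) \<bullet> x = 1" using i empty(2) by simp
  then show ?case by (intro bexI[of _ "(1 / x $ i) \<cdot>\<^sub>v unit_vec d i"]) auto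
next
  case (insert s S)
  interpret V: vec_space "TYPE(complex)" d .
  have S: "S \<subseteq> carrier_vec d" "s \<in> carrier_vec d" "insert s S \<subseteq> carrier_vec d" using insert by auto
  have mono: "vspan d S \<subseteq> vspan d (insert s S)" by (rule V.span_is_monotone) auto
  have s: "s \<in> vspan d (insert s S)" using V.span_mem[of "insert s S" s] S by auto
  show ?case
  proof (cases "s \<in> vspan d S")
    case True
    have "x \<notin> vspan d S" using insert.prems(3) mono by blast
    from insert.IH[OF S(1) insert.prems(2) this]
    obtain z where z: "z \<in> carrier_vec d" "\<forall>s\<in>S. z \<bullet> s = 0" "z \<bullet> x = 1" by blast
    have "z \<bullet> s = 0" by (rule vspan_annihilate[OF insert.hyps(1) S(1) True z(1)]) (use z(2) in blast)
    then show ?thesis using z by blast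
  next
    case False
    from insert.IH[OF S(1) S(2) this]
    obtain t where t: "t \<in> carrier_vec d" "\<forall>s\<in>S. t \<bullet> s = 0" "t \<bullet> s = 1" by blast
    define x' where "x' = x - (t \<bullet> x) \<cdot>\<^sub>v s"
    have x': "x' \<in> carrier_vec d" using insert S by (simp add: x'_def)
    have xx': "x = x' + (t \<bullet> x) \<cdot>\<^sub>v s" using insert S by (auto simp: x'_def)
    have "x' \<notin> vspan d S"
    proof
      assume "x' \<in> vspan d S"
      then have "x' + (t \<bullet> x) \<cdot>\<^sub>v s \<in> vspan d (insert s S)"
        using V.span_add1[of "insert s S" x' "(t \<bullet> x) \<cdot>\<^sub>v s"] V.smult_in_span[of "insert s S" s] mono s S by auto
      then show False using xx' insert by simp
    qed
    from insert.IH[OF S(1) x' this]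
    obtain z where z: "z \<in> carrier_vec d" "\<forall>s\<in>S. z \<bullet> s = 0" "z \<bullet> x' = 1" by blast
    define y where "y = z - (z \<bullet> s) \<cdot>\<^sub>v t"
    have y: "y \<in> carrier_vec d" using z t by (simp add: y_def)
    have ys: "y \<bullet> u = z \<bullet> u - (z \<bullet> s) * (t \<bullet> u)" if "u \<in> carrier_vec d" for u
      using that z t by (simp add: y_def minus_scalar_prod_distrib[of _ d])
    have "z \<bullet> x' = z \<bullet> x - (t \<bullet> x) * (z \<bullet> s)"
      using insert S z by (simp add: x'_def scalar_prod_minus_distrib[of _ d])
    then have "y \<bullet> x = 1" using ys[of x] insert z by (simp add: mult.commute)
    moreover have "y \<bullet> s = 0" using ys[of s] S t by simp
    moreover have "y \<bullet> u = 0" if "u \<in> S" for u using ys[of u] S t z that by auto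
    ultimately show ?thesis using y by blast
  qed
qed

lemma vspan_iff:
  assumes "finite S" "S \<subseteq> carrier_vec d" "x \<in> carrier_vec d"
  shows "x \<in> vspan d S \<longleftrightarrow> (\<forall>z\<in>carrier_vec d. (\<forall>s\<in>S. z \<bullet> s = 0) \<longrightarrow> z \<bullet> x = 0)"
proof
  assume "x \<in> vspan d S"
  then show "\<forall>z\<in>carrier_vec d. (\<forall>s\<in>S. z \<bullet> s = 0) \<longrightarrow> z \<bullet> x = 0"
    using vspan_annihilate[OF assms(1,2)] by blast
next
  assume "\<forall>z\<in>carrier_vec d. (\<forall>s\<in>S. z \<bullet> s = 0) \<longrightarrow> z \<bullet> x = 0"
  then show "x \<in> vspan d S" using vspan_separate[OF assms] by force
qed

section \<open>Planes and changes of basis\<close>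

lemma vspan_cols_le:
  assumes M: "M \<in> carrier_mat n d" "N \<in> carrier_mat n d'"
    and le: "vspan n (set (cols M)) \<subseteq> vspan n (set (cols N))"
  obtains A where "A \<in> carrier_mat d' d" "M = N * A"
proof -
  interpret V: vec_space "TYPE(complex)" n .
  have "\<exists>y\<in>carrier_vec d'. N *\<^sub>v y = col M c" if "c < d" for c
  proof -
    have "col M c \<in> set (cols M)" using that M by (auto simp: cols_def)
    then have "col M c \<in> vspan n (set (cols M))" using V.span_mem[of "set (cols M)"] M cols_dim[of M] by auto
    then obtain y where "y \<in> carrier_vec d'" "col M c = N *\<^sub>v y" using le vspan_cols[OF M(2)] by blast
    then show ?thesis by auto
  qed
  then obtain g where g: "\<And>c. c < d \<Longrightarrow> g c \<in> carrier_vec d' \<and> N *\<^sub>v g c = col M c" by metis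
  define A where "A = mat_of_cols d' (map g [0..<d])"
  have A: "A \<in> carrier_mat d' d" using mat_of_cols_carrier(1)[of d' "map g [0..<d]"] by (simp add: A_def)
  have "col A c = g c" if "c < d" for c using that g by (simp add: A_def)
  then have "M = N * A" using M A g by (intro mat_col_eqI) (auto simp: mult_mat_vec_def)
  then show ?thesis using that A by blast
qed

lemma vspan_cols_mult:
  assumes M: "M \<in> carrier_mat n d" "A \<in> carrier_mat d d" "A' \<in> carrier_mat d d" "A * A' = 1\<^sub>m d"
  shows "vspan n (set (cols (M * A))) = vspan n (set (cols M))"
proof -
  have "M *\<^sub>v x = (M * A) *\<^sub>v (A' *\<^sub>v x)" if "x \<in> carrier_vec d" for x
  proof -
    have "A *\<^sub>v (A' *\<^sub>v x) = x" using assoc_mult_mat_vec[OF M(2,3) that] M(4) that by simp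
    then show ?thesis using M that by simp
  qed
  moreover have "(M * A) *\<^sub>v x = M *\<^sub>v (A *\<^sub>v x)" if "x \<in> carrier_vec d" for x using M that by simp
  moreover have "A *\<^sub>v x \<in> carrier_vec d" "A' *\<^sub>v x \<in> carrier_vec d" if "x \<in> carrier_vec d" for x
    using M that by auto
  ultimately have "{(M * A) *\<^sub>v x | x. x \<in> carrier_vec d} = {M *\<^sub>v x | x. x \<in> carrier_vec d}" by blast
  then show ?thesis using vspan_cols[OF M(1)] vspan_cols[OF mult_carrier_mat[OF M(1,2)]] by simp
qed

text \<open>The sign \<open>s\<close> treats the right (\<open>s = 1\<close>) and the left (\<open>s = -1\<close>) twist together.\<close>

definition ms_ind :: "int \<Rightarrow> complex mat \<Rightarrow> int \<Rightarrow> int set" where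
  "ms_ind s M i = {j. 0 \<le> s * (j - i) \<and>
     prow M j \<notin> vspan (dim_col M) (prow M ` {l. 0 \<le> s * (l - i) \<and> s * (l - i) < s * (j - i)})}"

definition ms_mat :: "int \<Rightarrow> complex mat \<Rightarrow> complex mat" where
  "ms_mat s M = mat_of_rows (dim_col M)
     (map (\<lambda>i. dual_row M (ms_ind s M (int i)) (int i)) [0..<dim_row M])"

definition ms_twist :: "int \<Rightarrow> nat \<Rightarrow> nat \<Rightarrow> complex vec set \<Rightarrow> complex vec set" where
  "ms_twist s n k V = (THE U. \<exists>M \<in> carrier_mat n (n - k).
     V = vspan n (set (cols M)) \<and> U = vspan n (set (cols (ms_mat s M))))"

lemma indR_eq: "indR M i = ms_ind 1 M i"
proof -
  have "{l. 0 \<le> 1 * (l - i) \<and> 1 * (l - i) < 1 * (j - i)} = {i..<j}" for j by auto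
  then show ?thesis by (auto simp: indR_def ms_ind_def)
qed

lemma indL_eq: "indL M i = ms_ind (- 1) M i"
proof -
  have "{l. 0 \<le> - 1 * (l - i) \<and> - 1 * (l - i) < - 1 * (j - i)} = {j<..i}" for j by auto
  then show ?thesis by (auto simp: indL_def ms_ind_def)
qed

lemma ms_twist_eq: "ms_twistR = ms_twist 1" "ms_twistL = ms_twist (- 1)"
  unfolding ms_twistR_def ms_twistL_def ms_twist_def ms_matR_def ms_matL_def ms_mat_def indR_eq indL_eq
  by (auto simp: fun_eq_iff)

locale ms =
  fixes s :: int and n d :: nat
  assumes s: "s = 1 \<or> s = - 1" and n: "0 < n"
begin

lemma prow_carrier [simp]: "M \<in> carrier_mat n d \<Longrightarrow> prow M j \<in> carrier_vec d"
  using n by (auto simp: prow_def)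

lemma finite_before: "finite {l. 0 \<le> s * (l - i) \<and> s * (l - i) < s * (j - i)}"
proof -
  have "{l. 0 \<le> s * (l - i) \<and> s * (l - i) < s * (j - i)} \<subseteq> {i..j} \<union> {j..i}" using s by auto
  then show ?thesis by (rule finite_subset) simp
qed

text \<open>Replaces spans by a test vector \<open>z\<close>, the form in which the orthogonality
  relations use an index set and in which a change of basis acts simply.\<close>

lemma ms_ind_iff:
  assumes M: "M \<in> carrier_mat n d"
  shows "j \<in> ms_ind s M i \<longleftrightarrow> 0 \<le> s * (j - i) \<and> (\<exists>z\<in>carrier_vec d. z \<bullet> prow M j \<noteq> 0 \<and>
    (\<forall>l. 0 \<le> s * (l - i) \<longrightarrow> s * (l - i) < s * (j - i) \<longrightarrow> z \<bullet> prow M l = 0))"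
proof -
  have "prow M j \<in> vspan d (prow M ` {l. 0 \<le> s * (l - i) \<and> s * (l - i) < s * (j - i)}) \<longleftrightarrow>
    (\<forall>z\<in>carrier_vec d. (\<forall>l. 0 \<le> s * (l - i) \<longrightarrow> s * (l - i) < s * (j - i) \<longrightarrow> z \<bullet> prow M l = 0)
      \<longrightarrow> z \<bullet> prow M j = 0)"
    using finite_before M by (subst vspan_iff) auto
  then show ?thesis using M unfolding ms_ind_def by auto
qed

lemma prow_mult:
  assumes "M \<in> carrier_mat n d" "A \<in> carrier_mat d d" "z \<in> carrier_vec d"
  shows "z \<bullet> prow (M * A) j = (A *\<^sub>v z) \<bullet> prow M j"
proof -
  let ?r = "nat (j mod int n)"
  have r: "?r < n" using n by (simp add: nat_less_iff)
  have "(A *\<^sub>v z) \<bullet> prow M j = row M ?r \<bullet> (A *\<^sub>v z)"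
    using assms r by (simp add: prow_def comm_scalar_prod[of _ d])
  also have "\<dots> = (M *\<^sub>v (A *\<^sub>v z)) $ ?r" using assms r by simp
  also have "\<dots> = ((M * A) *\<^sub>v z) $ ?r" using assms by simp
  also have "\<dots> = row (M * A) ?r \<bullet> z"
    using assms r by (simp del: row_mult assoc_mult_mat_vec)
  also have "\<dots> = z \<bullet> prow (M * A) j"
    using assms r by (simp add: prow_def comm_scalar_prod[of _ d] del: row_mult)
  finally show ?thesis by simp
qed

text \<open>A test vector \<open>z\<close> for \<open>M * A\<close> becomes the test vector
  \<open>A *\<^sub>v z\<close> for \<open>M\<close>. Applied to a change of basis and to its
  inverse, this gives equality of index sets.\<close>

lemma ms_ind_mult_le:
  assumes "M \<in> carrier_mat n d" "A \<in> carrier_mat d d"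
  shows "ms_ind s (M * A) i \<subseteq> ms_ind s M i"
proof
  fix j assume "j \<in> ms_ind s (M * A) i"
  moreover have "M * A \<in> carrier_mat n d" using assms by simp
  ultimately obtain z where z: "0 \<le> s * (j - i)" "z \<in> carrier_vec d" "z \<bullet> prow (M * A) j \<noteq> 0"
    "\<forall>l. 0 \<le> s * (l - i) \<longrightarrow> s * (l - i) < s * (j - i) \<longrightarrow> z \<bullet> prow (M * A) l = 0"
    by (auto simp: ms_ind_iff)
  then have "A *\<^sub>v z \<in> carrier_vec d" "(A *\<^sub>v z) \<bullet> prow M j \<noteq> 0"
    "\<forall>l. 0 \<le> s * (l - i) \<longrightarrow> s * (l - i) < s * (j - i) \<longrightarrow> (A *\<^sub>v z) \<bullet> prow M l = 0"
    using assms prow_mult[OF assms z(2)] by auto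
  then show "j \<in> ms_ind s M i" unfolding ms_ind_iff[OF assms(1)] using z(1) by blast
qed

text \<open>This gives uniqueness of dual rows. A row outside the index set depends on the rows
  between \<open>i\<close> and itself, so vanishing on the index set propagates in the direction
  \<open>s\<close>.\<close>

lemma ms_ind_spans:
  assumes M: "M \<in> carrier_mat n d" and i: "i < n"
    and y: "y \<in> carrier_vec d" "\<And>j. j \<in> ms_ind s M (int i) \<Longrightarrow> y \<bullet> prow M j = 0"
  shows "M *\<^sub>v y = 0\<^sub>v n"
proof -
  have rows: "y \<bullet> prow M j = 0" if "0 \<le> s * (j - int i)" for j
    using that
  proof (induction j rule: measure_induct_rule[of "\<lambda>j. nat (s * (j - int i))"])
    case (less j)
    show ?case
    proof (cases "j \<in> ms_ind s M (int i)")
      case False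
      have "y \<bullet> prow M l = 0" if "0 \<le> s * (l - int i)" "s * (l - int i) < s * (j - int i)" for l
        using less.IH[of l] that by auto
      then show ?thesis using False less.prems y(1) unfolding ms_ind_iff[OF M] by blast
    qed (use y in auto)
  qed
  have "row M r \<bullet> y = 0" if r: "r < n" for r
  proof -
    \<comment> \<open>A shift by one period in the direction \<open>s\<close> puts a copy of row
      \<open>r\<close> on the required side of \<open>i\<close>.\<close>
    define j where "j = int r + s * int n"
    have "j mod int n = int r" using s r by (auto simp: j_def)
    moreover have "0 \<le> s * (j - int i)" using s r i by (auto simp: j_def)
    ultimately have "y \<bullet> row M r = 0" using rows[of j] M by (simp add: prow_def)
    then show ?thesis using M y r by (simp add: comm_scalar_prod[of _ d])
  qed
  then show ?thesis using M by (intro eq_vecI) auto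
qed

lemma dual_row_eq:
  assumes M: "M \<in> carrier_mat n d" and i: "i < n"
    and inj: "\<And>y. y \<in> carrier_vec d \<Longrightarrow> M *\<^sub>v y = 0\<^sub>v n \<Longrightarrow> y = 0\<^sub>v d"
    and x: "x \<in> carrier_vec d"
      "\<And>j. j \<in> ms_ind s M (int i) \<Longrightarrow> x \<bullet> prow M j = (if int i = j then 1 else 0)"
  shows "dual_row M (ms_ind s M (int i)) (int i) = x"
  unfolding dual_row_def
proof (rule the_equality)
  show "x \<in> carrier_vec (dim_col M) \<and>
    (\<forall>j\<in>ms_ind s M (int i). x \<bullet> prow M j = (if int i = j then 1 else 0))"
    using M x by simp
  fix y
  assume "y \<in> carrier_vec (dim_col M) \<and>
    (\<forall>j\<in>ms_ind s M (int i). y \<bullet> prow M j = (if int i = j then 1 else 0))"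
  then have y: "y \<in> carrier_vec d" "\<And>j. j \<in> ms_ind s M (int i) \<Longrightarrow> y \<bullet> prow M j = x \<bullet> prow M j"
    using M x by auto
  have "(y - x) \<bullet> prow M j = 0" if "j \<in> ms_ind s M (int i)" for j
    using y(2)[OF that] y(1) x(1) M by (simp add: minus_scalar_prod_distrib[of _ d])
  then have "y - x = 0\<^sub>v d" using inj ms_ind_spans[OF M i, of "y - x"] y x by simp
  then show "y = x" using y(1) x(1) by (auto simp: vec_eq_iff)
qed

text \<open>Changing the basis of the plane by \<open>A\<close> changes the dual rows by the inverse of \<open>A\<close>.\<close>

lemma ms_mat_span:
  assumes M: "M \<in> carrier_mat n d" and M': "M' \<in> carrier_mat n d"
    and inj: "\<And>y. y \<in> carrier_vec d \<Longrightarrow> M *\<^sub>v y = 0\<^sub>v n \<Longrightarrow> y = 0\<^sub>v d"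
    and dual: "\<And>i j. i < n \<Longrightarrow> j \<in> ms_ind s M (int i) \<Longrightarrow>
      row M' i \<bullet> prow M j = (if int i = j then 1 else 0)"
    and N: "N \<in> carrier_mat n d" and span: "vspan n (set (cols N)) = vspan n (set (cols M))"
  shows "vspan n (set (cols (ms_mat s N))) = vspan n (set (cols M'))"
proof -
  obtain A where A: "A \<in> carrier_mat d d" "N = M * A"
    using vspan_cols_le[OF N M] span by auto
  obtain A' where A': "A' \<in> carrier_mat d d" "M = N * A'"
    using vspan_cols_le[OF M N] span by auto
  \<comment> \<open>Injectivity of \<open>M\<close> permits cancelling it in
    \<open>M * (A * A') = M\<close>.\<close>
  have "A * A' = 1\<^sub>m d"
  proof (rule eq_matI)
    fix i j assume "i < dim_row (1\<^sub>m d :: complex mat)" "j < dim_col (1\<^sub>m d :: complex mat)"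
    then have ij: "i < d" "j < d" by auto
    have "M * (A * A') = M * A * A'" using assoc_mult_mat[OF M A(1) A'(1)] by simp
    then have MA: "M * (A * A') = M" unfolding A(2)[symmetric] A'(2)[symmetric] .
    have "M *\<^sub>v (col (A * A') j - unit_vec d j) = M *\<^sub>v col (A * A') j - M *\<^sub>v unit_vec d j"
      using A(1) A'(1) M ij by (intro mult_minus_distrib_mat_vec) auto
    also have "M *\<^sub>v unit_vec d j = col M j" using M ij by (intro eq_vecI) auto
    also have "M *\<^sub>v col (A * A') j = col (M * (A * A')) j" using M A(1) A'(1) ij by (intro col_mult2[symmetric]) auto
    finally have "M *\<^sub>v (col (A * A') j - unit_vec d j) = 0\<^sub>v n" unfolding MA using M ij by auto
    moreover have "col (A * A') j - unit_vec d j \<in> carrier_vec d"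
      using col_carrier_vec[OF ij(2) mult_carrier_mat[OF A(1) A'(1)]] by simp
    ultimately have "col (A * A') j - unit_vec d j = 0\<^sub>v d" using inj by blast
    then have "(col (A * A') j - unit_vec d j) $ i = 0\<^sub>v d $ i" by simp
    then show "(A * A') $$ (i, j) = 1\<^sub>m d $$ (i, j)" using A(1) A'(1) ij by (auto split: if_splits)
  qed (use A(1) A'(1) in auto)
  then have A'A: "A' * A = 1\<^sub>m d" using mat_mult_left_right_inverse[OF A(1) A'(1)] by simp
  have ind: "ms_ind s N i = ms_ind s M i" for i
    using ms_ind_mult_le[OF M A(1), of i, folded A(2)] ms_ind_mult_le[OF N A'(1), of i, folded A'(2)] by blast
  have injN: "y = 0\<^sub>v d" if "y \<in> carrier_vec d" "N *\<^sub>v y = 0\<^sub>v n" for y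
  proof -
    have "M *\<^sub>v (A *\<^sub>v y) = 0\<^sub>v n" using that A(2) assoc_mult_mat_vec[OF M A(1) that(1)] by simp
    then have "A *\<^sub>v y = 0\<^sub>v d" using inj that A(1) by simp
    then have "A' *\<^sub>v (A *\<^sub>v y) = 0\<^sub>v d" using A'(1) by auto
    moreover have "A' *\<^sub>v (A *\<^sub>v y) = (A' * A) *\<^sub>v y" using A(1) A'(1) that by simp
    ultimately show ?thesis using that A'A by simp
  qed
  have dr: "dual_row N (ms_ind s N (int i)) (int i) = A' *\<^sub>v row M' i" if i: "i < n" for i
  proof (rule dual_row_eq[OF N i injN])
    have r: "row M' i \<in> carrier_vec d" using M' by auto
    then show c: "A' *\<^sub>v row M' i \<in> carrier_vec d" using A'(1) by simp
    fix j assume j: "j \<in> ms_ind s N (int i)"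
    have "(A' *\<^sub>v row M' i) \<bullet> prow N j = (A *\<^sub>v (A' *\<^sub>v row M' i)) \<bullet> prow M j"
      unfolding A(2) by (rule prow_mult[OF M A(1) c])
    also have "A *\<^sub>v (A' *\<^sub>v row M' i) = (A * A') *\<^sub>v row M' i" using A(1) A'(1) r by simp
    also have "\<dots> = row M' i" using r \<open>A * A' = 1\<^sub>m d\<close> by simp
    finally show "(A' *\<^sub>v row M' i) \<bullet> prow N j = (if int i = j then 1 else 0)"
      using dual[OF i] j ind by simp
  qed
  have At: "transpose_mat A \<in> carrier_mat d d" "transpose_mat A' \<in> carrier_mat d d" using A(1) A'(1) by auto
  have "ms_mat s N = M' * transpose_mat A'"
  proof (rule eq_rowI)
    fix i assume "i < dim_row (M' * transpose_mat A')"
    then have i: "i < n" using M' by simp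
    have "row M' i \<in> carrier_vec d" using M' by auto
    then have c: "A' *\<^sub>v row M' i \<in> carrier_vec d" using A'(1) by simp
    have "row (ms_mat s N) i = A' *\<^sub>v row M' i"
      using dr[OF i] i N c by (simp add: ms_mat_def)
    also have "\<dots> = row (M' * transpose_mat A') i"
      using M' A'(1) i by (intro eq_vecI) (auto simp: comm_scalar_prod[of _ d])
    finally show "row (ms_mat s N) i = row (M' * transpose_mat A') i" .
  qed (use M' A'(1) N in \<open>auto simp: ms_mat_def\<close>)
  moreover have "transpose_mat A' * transpose_mat A = 1\<^sub>m d"
    using transpose_mult[OF A(1) A'(1)] \<open>A * A' = 1\<^sub>m d\<close> by simp
  ultimately show ?thesis using vspan_cols_mult[OF M' At(2,1)] by simp
qed

lemma ms_twist_span: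
  assumes M: "M \<in> carrier_mat n d" and M': "M' \<in> carrier_mat n d"
    and inj: "\<And>y. y \<in> carrier_vec d \<Longrightarrow> M *\<^sub>v y = 0\<^sub>v n \<Longrightarrow> y = 0\<^sub>v d"
    and dual: "\<And>i j. i < n \<Longrightarrow> j \<in> ms_ind s M (int i) \<Longrightarrow>
      row M' i \<bullet> prow M j = (if int i = j then 1 else 0)"
    and d: "d = n - k"
  shows "ms_twist s n k (vspan n (set (cols M))) = vspan n (set (cols M'))"
  unfolding ms_twist_def
proof (rule the_equality)
  show "\<exists>N\<in>carrier_mat n (n - k). vspan n (set (cols M)) = vspan n (set (cols N)) \<and>
      vspan n (set (cols M')) = vspan n (set (cols (ms_mat s N)))"
    using ms_mat_span[OF M M' inj dual M refl] M d by blast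
  fix U
  assume "\<exists>N\<in>carrier_mat n (n - k). vspan n (set (cols M)) = vspan n (set (cols N)) \<and>
      U = vspan n (set (cols (ms_mat s N)))"
  then show "U = vspan n (set (cols M'))" using ms_mat_span[OF M M' inj dual] d by metis
qed

end

section \<open>The projection to the Grassmannian\<close>

definition last_cols :: "nat \<Rightarrow> nat \<Rightarrow> complex mat \<Rightarrow> complex mat" where
  "last_cols n k g = mat n (n - k) (\<lambda>(r, c). g $$ (r, k + c))"

lemma last_cols_carrier [simp]: "last_cols n k g \<in> carrier_mat n (n - k)"
  by (simp add: last_cols_def)

lemma sum_shift_last: "(\<Sum>c = 0..<n - k. h (k + c)) = (\<Sum>c = k..<n. h c)" if "k \<le> n" for h :: "nat \<Rightarrow> complex"
  using sum.shift_bounds_nat_ivl[of h 0 k "n - k"] that by (simp add: add.commute)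

lemma last_cols_mult:
  assumes "k \<le> n" "y \<in> carrier_vec (n - k)" "r < n"
  shows "(last_cols n k g *\<^sub>v y) $ r = (\<Sum>c = k..<n. y $ (c - k) * g $$ (r, c))"
  using assms sum_shift_last[OF assms(1), of "\<lambda>c. y $ (c - k) * g $$ (r, c)"]
  by (simp add: last_cols_def scalar_prod_def mult.commute)

lemma last_cols_scalar:
  assumes "k \<le> n" "i < n" "j < n"
  shows "row (last_cols n k g) i \<bullet> row (last_cols n k h) j = (\<Sum>c = k..<n. g $$ (i, c) * h $$ (j, c))"
  using assms sum_shift_last[OF assms(1), of "\<lambda>c. g $$ (i, c) * h $$ (j, c)"]
  by (simp add: last_cols_def scalar_prod_def)

lemma set_last_cols:
  assumes "g \<in> carrier_mat n n" "k \<le> n"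
  shows "set (drop k (cols g)) = set (cols (last_cols n k g))"
proof -
  have "drop k (cols g) = cols (last_cols n k g)"
    using assms by (intro nth_equalityI) (auto simp: last_cols_def)
  then show ?thesis by simp
qed

lemma invertible_mat_det:
  fixes A :: "complex mat"
  assumes "A \<in> carrier_mat m m" "det A \<noteq> 0"
  shows "invertible_mat A"
proof -
  let ?B = "(1 / det A) \<cdot>\<^sub>m adj_mat A"
  have "A * ?B = 1\<^sub>m m" "?B * A = 1\<^sub>m m"
    using assms adj_mat[OF assms(1)] by (auto simp: mult_smult_distrib[of _ m m _ m] mult_smult_assoc_mat[of _ m m _ m])
  then show ?thesis unfolding invertible_mat_def inverts_mat_def using assms adj_mat(1)[OF assms(1)]
    by (intro conjI exI[of _ ?B]) auto
qed

context SL_n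
begin

text \<open>The determinant of a block triangular matrix is the product of those of its diagonal
  blocks, so determinant one makes both blocks invertible and the zero block alone describes the
  group.\<close>

lemma PJminus_eq:
  assumes "k \<le> n"
  shows "PJminus n k = {p \<in> carrier (SL n). \<forall>r<k. \<forall>c. k \<le> c \<longrightarrow> c < n \<longrightarrow> p $$ (r, c) = 0}"
proof (intro subset_antisym subsetI)
  fix p assume "p \<in> PJminus n k"
  then show "p \<in> {p \<in> carrier (SL n). \<forall>r<k. \<forall>c. k \<le> c \<longrightarrow> c < n \<longrightarrow> p $$ (r, c) = 0}"
    unfolding PJminus_def by auto
next
  fix p assume "p \<in> {p \<in> carrier (SL n). \<forall>r<k. \<forall>c. k \<le> c \<longrightarrow> c < n \<longrightarrow> p $$ (r, c) = 0}"
  then have p: "p \<in> carrier (SL n)" and z: "\<And>r c. r < k \<Longrightarrow> k \<le> c \<Longrightarrow> c < n \<Longrightarrow> p $$ (r, c) = 0"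
    by auto
  define A where "A = mat k k (\<lambda>(i, j). p $$ (i, j))"
  define C where "C = mat (n - k) k (\<lambda>(i, j). p $$ (k + i, j))"
  define D where "D = mat (n - k) (n - k) (\<lambda>(i, j). p $$ (k + i, k + j))"
  have car: "A \<in> carrier_mat k k" "C \<in> carrier_mat (n - k) k" "D \<in> carrier_mat (n - k) (n - k)"
    by (auto simp: A_def C_def D_def)
  have pb: "p = four_block_mat A (0\<^sub>m k (n - k)) C D"
  proof (rule eq_matI)
    fix i j assume "i < dim_row (four_block_mat A (0\<^sub>m k (n - k)) C D)"
      "j < dim_col (four_block_mat A (0\<^sub>m k (n - k)) C D)"
    then have "i < n" "j < n" using car assms by auto
    then show "p $$ (i, j) = four_block_mat A (0\<^sub>m k (n - k)) C D $$ (i, j)"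
      using car assms z by (auto simp: A_def C_def D_def)
  qed (use p car assms in auto)
  have "det p = det A * det D"
    unfolding pb by (rule det_four_block_mat_upper_right_zero[OF car(1) refl car(2,3)])
  then have "det A \<noteq> 0" "det D \<noteq> 0" using p by (auto simp: SL_iff)
  then have "invertible_mat A" "invertible_mat D" using invertible_mat_det car by auto
  then show "p \<in> PJminus n k" unfolding PJminus_def using p pb car by auto
qed

lemma PJminus_times:
  assumes k: "k \<le> n" and "p \<in> PJminus n k" "q \<in> PJminus n k"
  shows "p * q \<in> PJminus n k"
proof -
  have pq: "p \<in> carrier (SL n)" "q \<in> carrier (SL n)" using assms by (auto simp: PJminus_eq)
  have "(p * q) $$ (r, c) = 0" if "r < k" "k \<le> c" "c < n" for r c
  proof -
    have "(p * q) $$ (r, c) = (\<Sum>l<n. p $$ (r, l) * q $$ (l, c))"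
      using that k pq by (subst SL_entry) auto
    also have "\<dots> = 0"
    proof (rule sum.neutral, rule ballI)
      fix l assume "l \<in> {..<n}"
      then show "p $$ (r, l) * q $$ (l, c) = 0"
        using that assms by (cases "l < k") (auto simp: PJminus_eq)
    qed
    finally show ?thesis .
  qed
  then show ?thesis using pq k by (auto simp: PJminus_eq)
qed

lemma lower_PJminus:
  assumes "k \<le> n" "b \<in> supp (\<ge>)"
  shows "b \<in> PJminus n k"
proof -
  have "b $$ (r, c) = 0" if "r < k" "k \<le> c" "c < n" for r c
    using suppD[OF assms(2), of r c] that assms(1) by force
  then show ?thesis using assms by (simp add: PJminus_eq)
qed

lemma last_cols_inj:
  assumes g: "g \<in> carrier (SL n)" and k: "k \<le> n" and y: "y \<in> carrier_vec (n - k)"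
    and 0: "last_cols n k g *\<^sub>v y = 0\<^sub>v n"
  shows "y = 0\<^sub>v (n - k)"
proof -
  \<comment> \<open>Padding \<open>y\<close> with \<open>k\<close> zeros reduces the claim to
    injectivity of the invertible matrix \<open>g\<close>.\<close>
  define x where "x = vec n (\<lambda>l. if l < k then 0 else y $ (l - k))"
  have x: "x \<in> carrier_vec n" by (simp add: x_def)
  have "g *\<^sub>v x = 0\<^sub>v n"
  proof (rule eq_vecI)
    fix r assume "r < dim_vec (0\<^sub>v n :: complex vec)"
    then have r: "r < n" by simp
    have "(g *\<^sub>v x) $ r = (\<Sum>l<n. g $$ (r, l) * x $ l)"
      using g x r by (auto simp: scalar_prod_def atLeast0LessThan)
    also have "\<dots> = (\<Sum>l = k..<n. g $$ (r, l) * x $ l)"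
      using k by (intro sum.mono_neutral_right) (auto simp: x_def)
    also have "\<dots> = (last_cols n k g *\<^sub>v y) $ r"
      unfolding last_cols_mult[OF k y r] by (intro sum.cong) (auto simp: x_def)
    finally show "(g *\<^sub>v x) $ r = 0\<^sub>v n $ r" using 0 by simp
  qed (use g in auto)
  then have "adj_mat g *\<^sub>v (g *\<^sub>v x) = 0\<^sub>v n" using SL_carrier[OF SL_adj[OF g]] by auto
  moreover have "adj_mat g *\<^sub>v (g *\<^sub>v x) = (adj_mat g * g) *\<^sub>v x"
    using assoc_mult_mat_vec[OF SL_carrier[OF SL_adj[OF g]] SL_carrier[OF g] x] by simp
  ultimately have x0: "x = 0\<^sub>v n" using g x by simp
  show ?thesis
  proof (rule eq_vecI)
    fix i assume i: "i < dim_vec (0\<^sub>v (n - k) :: complex vec)"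
    then have "x $ (k + i) = 0" unfolding x0 by simp
    then show "y $ i = 0\<^sub>v (n - k) $ i" using i by (simp add: x_def)
  qed (use y in auto)
qed

text \<open>The zero block of \<open>p\<close> keeps the first \<open>k\<close> columns of
  \<open>g\<close> out, so the last ones are multiplied by the lower right block of
  \<open>p\<close>. Used in both directions, this makes the plane depend only on the coset.\<close>

lemma last_cols_span_le:
  assumes k: "k \<le> n" and g: "g \<in> carrier (SL n)" and p: "p \<in> PJminus n k"
  shows "vspan n (set (cols (last_cols n k (g * p)))) \<subseteq> vspan n (set (cols (last_cols n k g)))"
proof -
  have pS: "p \<in> carrier (SL n)" using p k by (simp add: PJminus_eq)
  define A where "A = mat (n - k) (n - k) (\<lambda>(i, j). p $$ (k + i, k + j))"
  have A: "A \<in> carrier_mat (n - k) (n - k)" by (simp add: A_def)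
  have eq: "last_cols n k (g * p) = last_cols n k g * A"
  proof (rule eq_matI)
    fix r c assume "r < dim_row (last_cols n k g * A)" "c < dim_col (last_cols n k g * A)"
    then have rc: "r < n" "c < n - k" by (auto simp: last_cols_def A_def)
    then have "last_cols n k (g * p) $$ (r, c) = (g * p) $$ (r, k + c)" by (simp add: last_cols_def)
    also have "\<dots> = (\<Sum>l<n. g $$ (r, l) * p $$ (l, k + c))" using rc g pS by (subst SL_entry) auto
    also have "\<dots> = (\<Sum>l = k..<n. g $$ (r, l) * p $$ (l, k + c))"
      using k p rc by (intro sum.mono_neutral_right) (auto simp: PJminus_eq)
    also have "\<dots> = (\<Sum>l = 0..<n - k. g $$ (r, k + l) * p $$ (k + l, k + c))"
      using sum_shift_last[OF k, of "\<lambda>l. g $$ (r, l) * p $$ (l, k + c)"] by simp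
    also have "\<dots> = (last_cols n k g * A) $$ (r, c)"
      using rc by (simp add: last_cols_def A_def scalar_prod_def)
    finally show "last_cols n k (g * p) $$ (r, c) = (last_cols n k g * A) $$ (r, c)" .
  qed (auto simp: last_cols_def A_def)
  have "(last_cols n k g * A) *\<^sub>v x = last_cols n k g *\<^sub>v (A *\<^sub>v x)" "A *\<^sub>v x \<in> carrier_vec (n - k)"
    if "x \<in> carrier_vec (n - k)" for x
    using that A assoc_mult_mat_vec[OF last_cols_carrier A that] by auto
  then have "{(last_cols n k g * A) *\<^sub>v x | x. x \<in> carrier_vec (n - k)}
      \<subseteq> {last_cols n k g *\<^sub>v x | x. x \<in> carrier_vec (n - k)}" by blast
  then show ?thesis unfolding eq
    by (simp add: vspan_cols[OF last_cols_carrier] vspan_cols[OF mult_carrier_mat[OF last_cols_carrier A]])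
qed

end

section \<open>The projection on cosets and the comparison of the twists\<close>

context richardson
begin

abbreviation "PJcos k g \<equiv> g <#\<^bsub>SL n\<^esub> PJminus n k"

lemma PJcos_mem: "x \<in> PJcos k g \<longleftrightarrow> (\<exists>p\<in>PJminus n k. x = g * p)"
  by (auto simp: l_coset_def)

lemma one_PJminus: "k \<le> n \<Longrightarrow> 1\<^sub>m n \<in> PJminus n k"
  by (auto simp: PJminus_eq)

lemma piJ_eq:
  assumes k: "k \<le> n" and g: "g \<in> carrier (SL n)"
  shows "piJ n k (Lcos g) = PJcos k g"
  unfolding piJ_def
proof (rule the_equality)
  show "\<exists>h\<in>carrier (SL n). Lcos g = Lcos h \<and> PJcos k g = PJcos k h" using g by blast
  have le: "PJcos k (h * b) \<subseteq> PJcos k h" if h: "h \<in> carrier (SL n)" "b \<in> supp (\<ge>)" for h b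
  proof
    fix x assume "x \<in> PJcos k (h * b)"
    then obtain p where p: "p \<in> PJminus n k" "x = h * b * p" using PJcos_mem by auto
    then have "x = h * (b * p)" using h k by (simp add: SL_assoc PJminus_eq)
    then show "x \<in> PJcos k h" using PJcos_mem PJminus_times[OF k lower_PJminus[OF k h(2)] p(1)] by auto
  qed
  fix Y assume "\<exists>h\<in>carrier (SL n). Lcos g = Lcos h \<and> Y = PJcos k h"
  then obtain h where h: "h \<in> carrier (SL n)" "Lcos g = Lcos h" "Y = PJcos k h" by auto
  obtain b where b: "b \<in> supp (\<ge>)" "h = g * b" using Lcos_eqD[OF h(2,1)] by auto
  obtain b' where b': "b' \<in> supp (\<ge>)" "g = h * b'" using Lcos_eqD[OF h(2)[symmetric] g] by auto
  show "Y = PJcos k g" unfolding h(3) using le[OF g b(1)] le[OF h(1) b'(1)] unfolding b(2)[symmetric] b'(2)[symmetric] by blast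
qed

lemma toGr_eq:
  assumes k: "k \<le> n" and g: "g \<in> carrier (SL n)"
  shows "toGr n k (PJcos k g) = vspan n (set (cols (last_cols n k g)))"
  unfolding toGr_def
proof (rule the_equality)
  show "\<exists>h\<in>carrier (SL n). PJcos k g = PJcos k h \<and>
      vspan n (set (cols (last_cols n k g))) = vspan n (set (drop k (cols h)))"
    using g set_last_cols[OF SL_carrier[OF g] k] by auto
  fix V assume "\<exists>h\<in>carrier (SL n). PJcos k g = PJcos k h \<and> V = vspan n (set (drop k (cols h)))"
  then obtain h where h: "h \<in> carrier (SL n)" "PJcos k g = PJcos k h"
    "V = vspan n (set (cols (last_cols n k h)))"
    using set_last_cols[OF SL_carrier k] by auto
  have "h \<in> PJcos k h" "g \<in> PJcos k g" unfolding PJcos_mem using one_PJminus[OF k] g h(1) by force+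
  then obtain p q where pq: "p \<in> PJminus n k" "h = g * p" "q \<in> PJminus n k" "g = h * q"
    using h(2) PJcos_mem by metis
  show "V = vspan n (set (cols (last_cols n k g)))"
    unfolding h(3)
    using last_cols_span_le[OF k g pq(1), folded pq(2)] last_cols_span_le[OF k h(1) pq(3), folded pq(4)]
    by blast
qed

lemma transpose_left:
  assumes "A \<in> carrier (SL n)" "i < n" "j < n" "sperm q s M"
  shows "(transpose_mat M * A) $$ (i, j) = s i * A $$ (q i, j)"
proof -
  have MT: "transpose_mat M * A \<in> carrier (SL n)" using assms sperm_SL by auto
  have "A $$ (q i, j) = s i * (transpose_mat M * A) $$ (i, j)"
    using sperm_left[OF assms(4) MT assms(2,3)] sperm_cancel(3)[OF assms(4,1)] by simp
  then have "s i * A $$ (q i, j) = (s i * s i) * (transpose_mat M * A) $$ (i, j)" by simp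
  then show ?thesis using sperm_sign[OF assms(4), of i] by simp
qed

lemma transpose_right:
  assumes A: "A \<in> carrier (SL n)" "i < n" "j < n" and M: "sperm q s M"
  shows "(A * transpose_mat M) $$ (i, q j) = A $$ (i, j) * s j"
proof -
  have MT: "A * transpose_mat M \<in> carrier (SL n)" using assms sperm_SL by auto
  have "A * transpose_mat M * M = A" using A M sperm_SL[OF M] by (simp add: SL_assoc sperm_cancel(2)[OF M])
  then have "A $$ (i, j) = (A * transpose_mat M) $$ (i, q j) * s j"
    using sperm_right[OF M MT A(2,3)] by simp
  then have "A $$ (i, j) * s j = (A * transpose_mat M) $$ (i, q j) * (s j * s j)" by simp
  then show ?thesis using sperm_sign[OF M, of j] by simp
qed

text \<open>An inversion of a Grassmannian \<open>w\<close> pairs an index below \<open>k\<close>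
  with one from \<open>k\<close> on. Hence \<open>b * Q\<close> has a single nonzero entry in each
  of its first \<open>k\<close> columns, while the last ones are, up to scaling, in reduced echelon
  form with pivot rows \<open>w c\<close>.\<close>

lemma twist_config_pair:
  assumes c: "twist_config u b t" and k: "k \<le> n" and gr: "grassmannian n k w"
  shows "twisted_pair n k v w (\<lambda>i c. (b * Q) $$ (i, c)) (\<lambda>i c. (P * t) $$ (i, c))
    (\<lambda>i j. u $$ (i, j)) (\<lambda>i j. adj_mat u $$ (i, j)) (\<lambda>i c. adj_mat (b * Q) $$ (i, c))
    (\<lambda>i c. adj_mat (P * t) $$ (c, i))"
proof -
  let ?W = "\<lambda>i j. i = j \<or> i > j \<and> wi i < wi j" and ?V = "\<lambda>i j. i \<le> j \<and> v i \<le> v j"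
  have u: "u \<in> unip (\<le>)" and b: "b \<in> supp ?W" and t: "t \<in> supp ?V"
    and eq: "u * P = b * (Q * transpose_mat t)"
    using c by (auto simp: twist_config_def)
  note [simp] = unip_SL[OF u] supp_SL[OF b] supp_SL[OF t]
  have w1: "w a < w c" if "a < c" "c < k" for a c
    using gr that by (auto simp: grassmannian_def strict_mono_on_def)
  have w2: "w a < w c" if "k \<le> a" "a < c" "c < n" for a c
    using gr that by (auto simp: grassmannian_def strict_mono_on_def)
  have W: "tri ?W" by (auto simp: tri_def reflp_def transp_def)
  have ib: "adj_mat b \<in> supp ?W" by (rule supp_inv[OF W b])
  have it: "adj_mat t \<in> supp ?V" by (rule supp_inv[OF tri_V t])
  have iu: "adj_mat u \<in> unip (\<le>)" by (rule unip_inv[OF _ u]) simp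
  have lo: "?W \<le> (\<le>) \<or> ?W \<le> (\<ge>)" "?V \<le> (\<le>) \<or> ?V \<le> (\<ge>)" by auto
  have B: "(b * Q) $$ (i, c) = b $$ (i, w c) * f c" if "i < n" "c < n" for i c
    using sperm_right[OF Q supp_SL[OF b] that] .
  have C: "(P * t) $$ (v a, c) = e a * t $$ (a, c)" if "a < n" "c < n" for a c
    using sperm_left[OF P supp_SL[OF t] that] .
  have BI: "adj_mat (b * Q) $$ (c, l) = f c * adj_mat b $$ (w c, l)" if "c < n" "l < n" for c l
    using transpose_left[OF supp_SL[OF ib] that Q] by (simp add: SL_adj_mult sperm_inv[OF Q])
  have CI: "adj_mat (P * t) $$ (c, v a) = adj_mat t $$ (c, a) * e a" if "a < n" "c < n" for a c
    using transpose_right[OF supp_SL[OF it] that(2,1) P] by (simp add: SL_adj_mult sperm_inv[OF P])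
  have "u = u * P * transpose_mat P" by (simp add: algebra)
  also have "\<dots> = (b * Q) * transpose_mat (P * t)" unfolding eq by (simp add: algebra)
  finally have U: "u = (b * Q) * transpose_mat (P * t)" .
  \<comment> \<open>Inverting the product formula for \<open>u\<close> expresses the inverse of each
    factor through the other factor, which supplies a second description of both inverses.\<close>
  have D: "adj_mat u = adj_mat (transpose_mat (P * t)) * adj_mat (b * Q)"
    unfolding U by (rule SL_adj_mult) auto
  have BI': "adj_mat (b * Q) = transpose_mat (P * t) * adj_mat u" unfolding D by simp
  have CI': "transpose_mat (adj_mat (P * t)) = adj_mat u * (b * Q)"
    unfolding D by (simp add: SL_assoc SL_adj_transpose[symmetric])
  have bnd: "v i < n" "w i < n" if "i < n" for i
    using that sperm_bound[OF P] sperm_bound[OF Q] by auto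
  have nz: "e i \<noteq> 0" "f i \<noteq> 0" for i using sperm_nz[OF P] sperm_nz[OF Q] by auto
  show ?thesis
  proof
    show "k \<le> n" by (rule k)
    show "v a < n" "w a < n" if "a < n" for a using bnd that by auto
    show "\<exists>a<n. i = v a" if "i < n" for i using sperm_ex[OF P that] .
    show "a = c" if "v a = v c" for a c using that sperm_inj[OF P] by simp
    show "a = c" if "w a = w c" for a c using that sperm_inj[OF Q] by simp
    show "w a < w c" if "a < c" "c < k" for a c using w1 that .
    show "w a < w c" if "k \<le> a" "a < c" "c < n" for a c using w2 that .
    show "u $$ (i, j) = (\<Sum>c<n. (b * Q) $$ (i, c) * (P * t) $$ (j, c))" if "i < n" "j < n" for i j
    proof -
      have "u $$ (i, j) = (\<Sum>c<n. (b * Q) $$ (i, c) * transpose_mat (P * t) $$ (c, j))"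
        by (subst U, rule SL_entry) (use that in auto)
      then show ?thesis using that SL_dim[OF SL_times[OF PQ_SL(1) supp_SL[OF t]]]
        by (simp del: index_mult_mat(1))
    qed
    show "u $$ (i, j) = 0" if "i < n" "j < i" for i j
      using suppD[OF unip_supp[OF u], of i j] that by force
    show "u $$ (i, i) = 1" if "i < n" for i using unip_diag[OF u that] .
    show "adj_mat u $$ (i, j) = 0" if "i < n" "j < i" for i j
      using suppD[OF unip_supp[OF iu], of i j] that by force
    show "(b * Q) $$ (w c, c) \<noteq> 0" if "c < n" for c
      using B[of "w c" c] supp_diag_nonzero[OF lo(1) b, of "w c"] bnd that nz by simp
    have bs: "i = w c \<or> i > w c \<and> wi i < c" if "i < n" "c < n" "(b * Q) $$ (i, c) \<noteq> 0" for i c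
      using suppD[OF b, of i "w c"] B[of i c] bnd that by auto
    show "i = w c" if A: "i < n" "c < k" "(b * Q) $$ (i, c) \<noteq> 0" for i c
    proof -
      obtain a where "a < n" "i = w a" using sperm_ex[OF Q A(1)] by auto
      then show ?thesis using bs[of i c] A k w1[of a c] by auto
    qed
    show "w c \<le> i" if "i < n" "c < n" "(b * Q) $$ (i, c) \<noteq> 0" for i c
      using bs that by force
    show "(b * Q) $$ (w a, c) = 0" if "k \<le> a" "a < n" "c < n" "a \<noteq> c" for a c
      using bs[of "w a" c] that bnd w2[of a c] sperm_inj[OF Q, of a c] by - (rule ccontr, auto)
    show "(P * t) $$ (v c, c) \<noteq> 0" if "c < n" for c
      using C[of c c] supp_diag_nonzero[OF lo(2) t that] that nz by simp
    show "a \<le> c \<and> v a \<le> v c" if "a < n" "c < n" "(P * t) $$ (v a, c) \<noteq> 0" for a c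
      using C[of a c] suppD[OF t, of a c] that by auto
    show "adj_mat (b * Q) $$ (c, l) = (\<Sum>i<n. (P * t) $$ (i, c) * adj_mat u $$ (i, l))" if "c < n" "l < n" for c l
    proof -
      have "adj_mat (b * Q) $$ (c, l) = (\<Sum>i<n. transpose_mat (P * t) $$ (c, i) * adj_mat u $$ (i, l))"
        by (subst BI', rule SL_entry) (use that in auto)
      then show ?thesis using that SL_dim[OF SL_times[OF PQ_SL(1) supp_SL[OF t]]]
        by (simp del: index_mult_mat(1))
    qed
    show "adj_mat (b * Q) $$ (c, w c) \<noteq> 0" if "c < n" for c
      using BI[of c "w c"] supp_diag_nonzero[OF lo(1) ib, of "w c"] bnd that nz by simp
    show "l \<le> w c" if "c < k" "l < n" "adj_mat (b * Q) $$ (c, l) \<noteq> 0" for c l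
      using BI[of c l] suppD[OF ib, of "w c" l] bnd that k by fastforce
    show "adj_mat (b * Q) $$ (c, w a) = 0" if "k \<le> c" "c < n" "a < n" "a \<noteq> c" for a c
      using BI[of c "w a"] suppD[OF ib, of "w c" "w a"] bnd that w2[of c a] sperm_inj[OF Q, of a c]
      by - (rule ccontr, auto)
    show "adj_mat (P * t) $$ (c, i) = (\<Sum>l<n. adj_mat u $$ (i, l) * (b * Q) $$ (l, c))" if "i < n" "c < n" for i c
    proof -
      have "transpose_mat (adj_mat (P * t)) $$ (i, c) = (\<Sum>l<n. adj_mat u $$ (i, l) * (b * Q) $$ (l, c))"
        by (subst CI', rule SL_entry) (use that in auto)
      then show ?thesis using that SL_dim[OF SL_adj[OF SL_times[OF PQ_SL(1) supp_SL[OF t]]]]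
        by (simp del: index_mult_mat(1))
    qed
    show "adj_mat (P * t) $$ (c, v c) \<noteq> 0" if "c < n" for c
      using CI[of c c] supp_diag_nonzero[OF lo(2) it that] that nz by simp
    show "c \<le> a \<and> v c \<le> v a" if "a < n" "c < n" "adj_mat (P * t) $$ (c, v a) \<noteq> 0" for a c
      using CI[of a c] suppD[OF it, of c a] that by auto
    show "(\<Sum>l<n. adj_mat (P * t) $$ (a, l) * (P * t) $$ (l, c)) = (if a = c then 1 else 0)" if "a < n" "c < n" for a c
    proof -
      have "(\<Sum>l<n. adj_mat (P * t) $$ (a, l) * (P * t) $$ (l, c)) = (adj_mat (P * t) * (P * t)) $$ (a, c)"
        by (rule SL_entry[symmetric]) (use that in auto)
      then show ?thesis using that SL_adj_inv(2)[OF SL_times[OF PQ_SL(1) supp_SL[OF t]]] by simp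
    qed
    show "adj_mat u $$ (i, c) = (\<Sum>l<n. adj_mat (P * t) $$ (l, i) * adj_mat (b * Q) $$ (l, c))" if "i < n" "c < n" for i c
    proof -
      have "adj_mat u $$ (i, c) = (\<Sum>l<n. transpose_mat (adj_mat (P * t)) $$ (i, l) * adj_mat (b * Q) $$ (l, c))"
        by (subst D, subst SL_adj_transpose, simp, rule SL_entry) (use that in auto)
      then show ?thesis using that SL_dim[OF SL_adj[OF SL_times[OF PQ_SL(1) supp_SL[OF t]]]]
        by (simp del: index_mult_mat(1))
    qed
  qed
qed

lemma prow_nat:
  assumes "M \<in> carrier_mat n d" "r < n"
  shows "prow M (int r) = row M r" "prow M (int r + int n) = row M r" "prow M (int r - int n) = row M r"
proof -
  have "(int r - int n) mod int n = int r"
    using assms(2) by (simp add: minus_mod_self2)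
  then show "prow M (int r) = row M r" "prow M (int r + int n) = row M r" "prow M (int r - int n) = row M r"
    using assms by (simp_all add: prow_def)
qed

text \<open>An element of an index set lies either in the period of \<open>i\<close> or in the
  adjacent one, and these are the near and the far cases of the orthogonality relations.\<close>

lemma ms_twist_config:
  assumes c: "twist_config u b t" and k: "k < n" and gr: "grassmannian n k w"
  shows "ms_twist 1 n k (vspan n (set (cols (last_cols n k (b * Q))))) =
      vspan n (set (cols (last_cols n k (P * t))))"
    and "ms_twist (- 1) n k (vspan n (set (cols (last_cols n k (P * t))))) =
      vspan n (set (cols (last_cols n k (b * Q))))"
proof -
  have kn: "k \<le> n" using k by simp
  define B C where "B = b * Q" and "C = P * t"
  interpret T: twisted_pair n k v w "\<lambda>i c. B $$ (i, c)" "\<lambda>i c. C $$ (i, c)"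
    "\<lambda>i j. u $$ (i, j)" "\<lambda>i j. adj_mat u $$ (i, j)" "\<lambda>i c. adj_mat B $$ (i, c)"
    "\<lambda>i c. adj_mat C $$ (c, i)"
    unfolding B_def C_def by (rule twist_config_pair[OF c kn gr])
  interpret R: ms 1 n "n - k" using k by unfold_locales auto
  interpret L: ms "- 1" n "n - k" using k by unfold_locales auto
  let ?M = "last_cols n k B" and ?N = "last_cols n k C"
  have SL: "B \<in> carrier (SL n)" "C \<in> carrier (SL n)" using c by (auto simp: twist_config_def B_def C_def)
  have val: "z \<bullet> row (last_cols n k g) r = (\<Sum>c = k..<n. z $ (c - k) * g $$ (r, c))"
    if "z \<in> carrier_vec (n - k)" "r < n" for z g r
  proof -
    have "z \<bullet> row (last_cols n k g) r = row (last_cols n k g) r \<bullet> z"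
      by (rule comm_scalar_prod[of _ "n - k"]) (use that in \<open>auto simp: last_cols_def\<close>)
    also have "\<dots> = (last_cols n k g *\<^sub>v z) $ r" using that by (simp add: last_cols_def)
    finally show ?thesis using last_cols_mult[OF kn that] by simp
  qed
  note pn = prow_nat[OF last_cols_carrier]
  have 1: "ms_twist 1 n k (vspan n (set (cols ?M))) = vspan n (set (cols ?N))"
  proof (rule R.ms_twist_span[OF last_cols_carrier last_cols_carrier last_cols_inj[OF SL(1) kn] _ refl])
    fix i j assume i: "i < n" and "j \<in> ms_ind 1 ?M (int i)"
    then obtain z where j: "int i \<le> j" and z: "z \<in> carrier_vec (n - k)" "z \<bullet> prow ?M j \<noteq> 0"
      and z0: "\<And>l. int i \<le> l \<Longrightarrow> l < j \<Longrightarrow> z \<bullet> prow ?M l = 0"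
      unfolding R.ms_ind_iff[OF last_cols_carrier] by auto
    let ?z = "\<lambda>c. z $ (c - k)"
    show "row ?N i \<bullet> prow ?M j = (if int i = j then 1 else 0)"
    proof (cases "j < int n")
      case True
      then obtain m where m: "j = int m" "m < n" "i \<le> m"
        by (intro that[of "nat j"]) (use j in auto)
      have "(\<Sum>c = k..<n. B $$ (m, c) * C $$ (i, c)) = (if i = m then 1 else 0)"
      proof (rule T.right_near[of i m ?z])
        fix l assume "i \<le> l" "l < m"
        then show "(\<Sum>c = k..<n. ?z c * B $$ (l, c)) = 0"
          using z0[of "int l"] m pn(1)[of l] val[OF z(1), of l] by simp
      qed (use m z pn(1)[of m] val[OF z(1), of m] in auto)
      then show ?thesis using m pn(1)[of m] last_cols_scalar[OF kn i, of m] by (simp add: mult.commute)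
    next
      case False
      \<comment> \<open>One full period after \<open>i\<close> the row has already occurred at
        \<open>j - n\<close>, where \<open>z\<close> vanishes.\<close>
      have ji: "j < int i + int n"
      proof (rule ccontr)
        assume "\<not> j < int i + int n"
        moreover have "prow ?M (j - int n) = prow ?M j" by (simp add: prow_def last_cols_def)
        ultimately show False using z0[of "j - int n"] z k by simp
      qed
      define m where "m = nat (j - int n)"
      have m: "j = int m + int n" "m < i" using False ji by (auto simp: m_def)
      have "(\<Sum>c = k..<n. B $$ (m, c) * C $$ (i, c)) = 0"
      proof (rule T.right_far[of m i ?z])
        \<comment> \<open>Rows before \<open>m\<close> are passed in the second period, at position
          \<open>l + n\<close>; the rows from \<open>i\<close> to the end are passed in the
          first.\<close>
        fix l assume "l < m"
        then show "(\<Sum>c = k..<n. ?z c * B $$ (l, c)) = 0"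
          using z0[of "int l + int n"] m i pn(2)[of l] val[OF z(1), of l] by simp
      next
        fix l assume "i \<le> l" "l < n"
        then show "(\<Sum>c = k..<n. ?z c * B $$ (l, c)) = 0"
          using z0[of "int l"] m pn(1)[of l] val[OF z(1), of l] by simp
      qed (use m i z pn(2)[of m] val[OF z(1), of m] in auto)
      then show ?thesis using m i pn(2)[of m] last_cols_scalar[OF kn i, of m] by (simp add: mult.commute)
    qed
  qed
  have 2: "ms_twist (- 1) n k (vspan n (set (cols ?N))) = vspan n (set (cols ?M))"
  proof (rule L.ms_twist_span[OF last_cols_carrier last_cols_carrier last_cols_inj[OF SL(2) kn] _ refl])
    fix i j assume i: "i < n" and "j \<in> ms_ind (- 1) ?N (int i)"
    then obtain z where j: "j \<le> int i" and z: "z \<in> carrier_vec (n - k)" "z \<bullet> prow ?N j \<noteq> 0"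
      and z0: "\<And>l. l \<le> int i \<Longrightarrow> j < l \<Longrightarrow> z \<bullet> prow ?N l = 0"
      unfolding L.ms_ind_iff[OF last_cols_carrier] by auto
    let ?z = "\<lambda>c. z $ (c - k)"
    show "row ?M i \<bullet> prow ?N j = (if int i = j then 1 else 0)"
    proof (cases "0 \<le> j")
      case True
      then obtain m where m: "j = int m" "m \<le> i" using j by (metis of_nat_le_iff zero_le_imp_eq_int)
      have "(\<Sum>c = k..<n. B $$ (i, c) * C $$ (m, c)) = (if i = m then 1 else 0)"
      proof (rule T.left_near[of m i ?z])
        fix l assume "m < l" "l \<le> i"
        then show "(\<Sum>c = k..<n. ?z c * C $$ (l, c)) = 0"
          using z0[of "int l"] m i pn(1)[of l] val[OF z(1), of l] by simp
      qed (use m i z pn(1)[of m] val[OF z(1), of m] in auto)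
      then show ?thesis using m i pn(1)[of m] last_cols_scalar[OF kn i, of m] by simp
    next
      case False
      have ji: "int i - int n < j"
      proof (rule ccontr)
        assume "\<not> int i - int n < j"
        moreover have "prow ?N (j + int n) = prow ?N j" by (simp add: prow_def last_cols_def)
        ultimately show False using z0[of "j + int n"] z k by simp
      qed
      define m where "m = nat (j + int n)"
      have m: "j = int m - int n" "i < m" "m < n" using False ji by (auto simp: m_def)
      have "(\<Sum>c = k..<n. B $$ (i, c) * C $$ (m, c)) = 0"
      proof (rule T.left_far[of i m ?z])
        fix l assume "l \<le> i"
        then show "(\<Sum>c = k..<n. ?z c * C $$ (l, c)) = 0"
          using z0[of "int l"] m i pn(1)[of l] val[OF z(1), of l] by simp
      next
        fix l assume "m < l" "l < n"
        then show "(\<Sum>c = k..<n. ?z c * C $$ (l, c)) = 0"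
          using z0[of "int l - int n"] m pn(3)[of l] val[OF z(1), of l] by simp
      qed (use m i z pn(3)[of m] val[OF z(1), of m] in auto)
      then show ?thesis using m i pn(3)[of m] last_cols_scalar[OF kn i, of m] by simp
    qed
  qed
  from 1 2 show "ms_twist 1 n k (vspan n (set (cols (last_cols n k (b * Q))))) =
      vspan n (set (cols (last_cols n k (P * t))))"
    and "ms_twist (- 1) n k (vspan n (set (cols (last_cols n k (P * t))))) =
      vspan n (set (cols (last_cols n k (b * Q))))"
    unfolding B_def C_def by auto
qed

text \<open>Passing from \<open>u * P\<close> to \<open>b * Q\<close> replaces the representative by
  one whose last columns are in echelon form.\<close>

lemma twist_config_Lcos:
  assumes "twist_config u b t"
  shows "Lcos (u * P) = Lcos (b * Q)"
proof -
  have bt: "b \<in> carrier (SL n)" "t \<in> supp (\<lambda>i j. i \<le> j \<and> v i \<le> v j)" "u * P = b * (Q * transpose_mat t)"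
    using assms by (auto simp: twist_config_def)
  have "transpose_mat t \<in> supp (\<ge>)" using supp_transpose[OF bt(2)] by (rule supp_mono) auto
  then show ?thesis using Lcos_mult[of "b * Q" "transpose_mat t"] bt by (simp add: SL_assoc)
qed

text \<open>Two configurations are used: for the right twist the given point is \<open>b * Q\<close>
  and its image \<open>P * t\<close>, for the left twist the given point is \<open>P * t\<close> and
  its image \<open>b * Q\<close>.\<close>

theorem twists_match:
  assumes k: "k < n" and gr: "grassmannian n k w" and X: "X \<in> richR n v w"
  shows "toGr n k (piJ n k (twistR n v w X)) = ms_twistR n k (toGr n k (piJ n k X))"
    and "toGr n k (piJ n k (twistL n v w X)) = ms_twistL n k (toGr n k (piJ n k X))"
proof -
  have kn: "k \<le> n" using k by simp
  have Gr: "toGr n k (piJ n k (Lcos g)) = vspan n (set (cols (last_cols n k g)))" if "g \<in> carrier (SL n)" for g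
    using piJ_eq[OF kn that] toGr_eq[OF kn that] by simp
  have SL: "b * Q \<in> carrier (SL n)" "P * t \<in> carrier (SL n)" if "twist_config u b t" for u b t
    using that by (auto simp: twist_config_def)
  obtain u b t where c: "twist_config u b t" "X = Lcos (u * P)" using richR_twist_config[OF X] .
  have tw: "twistR n v w X = Lcos (P * t)" unfolding c(2) by (rule twist_config_twistR[OF c(1)])
  show "toGr n k (piJ n k (twistR n v w X)) = ms_twistR n k (toGr n k (piJ n k X))"
    unfolding tw unfolding c(2) twist_config_Lcos[OF c(1)] Gr[OF SL(1)[OF c(1)]] Gr[OF SL(2)[OF c(1)]]
    by (simp add: ms_twist_eq ms_twist_config(1)[OF c(1) k gr])
  obtain u b t where d: "twist_config u b t" "X = Lcos (P * t)" "twistL n v w X = Lcos (u * P)"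
    using richR_twist_config_left[OF X] .
  show "toGr n k (piJ n k (twistL n v w X)) = ms_twistL n k (toGr n k (piJ n k X))"
    unfolding d(3) unfolding d(2) twist_config_Lcos[OF d(1)] Gr[OF SL(1)[OF d(1)]] Gr[OF SL(2)[OF d(1)]]
    by (simp add: ms_twist_eq ms_twist_config(2)[OF d(1) k gr])
qed

end

theorem theorem2p7:
  fixes n k :: nat and v w :: "nat \<Rightarrow> nat"
  assumes "1 \<le> k" and "k < n"
    and "v permutes {..<n}" and "w permutes {..<n}"
    and "bruhat_le n v w"
    and "grassmannian n k w"
  shows "(\<forall>X \<in> richR n v w.
            toGr n k (piJ n k (twistR n v w X)) = ms_twistR n k (toGr n k (piJ n k X))) \<and>
         (\<forall>X \<in> richR n v w.
            toGr n k (piJ n k (twistL n v w X)) = ms_twistL n k (toGr n k (piJ n k X)))"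
proof -
  interpret S: SL_n n .
  obtain e f where "S.sperm v e (dot n v)" "S.sperm w f (dot n w)"
    using S.sperm_dot assms(3,4) by metis
  then interpret richardson n v w e f by unfold_locales
  show ?thesis using twists_match[OF assms(2,6)] by blast
qed

end
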